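(* Let $H\in(0,1/2)$, $T>0$, let $B^H$ be a fractional Brownian motion with Hurst index $H$, let $W$ be a Wiener process independent of $B^H$, let $f:[0,T]\to\mathbb R_+$ be a positive measurable function, and let $g\in AC([0,T])$, $g(t)=\int_0^tg'(s)\,ds$, with $g'\in L_2([0,T])$. Then for any $\varepsilon>0$ and any suitable expansion $g=g_W+g_B$, $$\mathbb P(A_{T,g,\varepsilon})\ \ge\ \exp\left\{-\frac12\int_0^T\left((g_W'(t))^2+(h(t))^2\right)dt\right\}\mathbb P(A_{T,0,\varepsilon}),$$ where $h(t)=(K^{H,*}_0g_B')(t)$.
   Context: For a trend $g$ and $\varepsilon>0$, $A_{T,g,\varepsilon}=\{|B^H(t)+W(t)+g(t)|\le \varepsilon f(t),\ 0\le t\le T\}$, and $A_{T,0,\varepsilon}$ is this event with $g\equiv0$. A fractional Brownian motion with Hurst index $H$ is a centered Gaussian process with covariance $\frac12(t^{2H}+s^{2H}-|t-s|^{2H})$. An expansion $g=g_W+g_B$ is called suitable if $g_W,g_B\in AC([0,T])$, $g_W(t)=\int_0^t g_W'(s)ds$, $g_B(t)=\int_0^t g_B'(s)ds$, and $g_W',g_B'\in L_2([0,T])$. With $C_1=\left(\frac{2H\Gamma(H+1/2)\Gamma(3/2-H)}{\Gamma(2-2H)}\right)^{1/2}$, $(K^{H,*}_0\varphi)(t)=\frac{C_1^{-1}t^{H-1/2}}{\Gamma(1/2-H)}\int_0^t (t-u)^{-1/2-H}u^{1/2-H}\varphi(u)\,du$, which maps $L_2([0,T])$ into itself.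
   Formalization: The fractional Brownian motion is additionally assumed to have almost surely continuous paths on [0,T]; without this the event need not be measurable and the inequality can fail for a modification altered at a random time. *)

theory Defs
  imports "HOL-Probability.Probability"
begin

section \<open>Gaussian processes, fractional Brownian motion, Wiener process\<close>

text \<open>A process on an index set \<open>I\<close> is a function \<open>X :: real \<Rightarrow> 'a \<Rightarrow> real\<close> (time first) of which only the
  values \<open>X t\<close> with \<open>t \<in> I\<close> matter.\<close>

context prob_space
begin

text \<open>Degenerate (almost surely constant) variables count as Gaussian; the library's
  \<^const>\<open>normal_density\<close> only covers positive standard deviation.\<close>

definition gaussian_rv :: "('a \<Rightarrow> real) \<Rightarrow> bool" where
  "gaussian_rv X \<longleftrightarrow>
     random_variable borel X \<and>
     ((\<exists>m. AE \<omega> in M. X \<omega> = m) \<or>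
      (\<exists>m \<sigma>. \<sigma> > 0 \<and> distributed M lborel X (\<lambda>x. ennreal (normal_density m \<sigma> x))))"

definition gaussian_process :: "real set \<Rightarrow> (real \<Rightarrow> 'a \<Rightarrow> real) \<Rightarrow> bool" where
  "gaussian_process I X \<longleftrightarrow>
     (\<forall>S c. finite S \<and> S \<subseteq> I \<longrightarrow> gaussian_rv (\<lambda>\<omega>. \<Sum>t\<in>S. c t * X t \<omega>))"

definition centered_gaussian_process :: "real set \<Rightarrow> (real \<Rightarrow> 'a \<Rightarrow> real) \<Rightarrow> bool" where
  "centered_gaussian_process I X \<longleftrightarrow>
     gaussian_process I X \<and> (\<forall>t\<in>I. expectation (X t) = 0)"

text \<open>No path regularity is included here.\<close>

definition fractional_brownian_motion :: "real \<Rightarrow> real set \<Rightarrow> (real \<Rightarrow> 'a \<Rightarrow> real) \<Rightarrow> bool" where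
  "fractional_brownian_motion H I X \<longleftrightarrow>
     centered_gaussian_process I X \<and>
     (\<forall>s\<in>I. \<forall>t\<in>I. expectation (\<lambda>\<omega>. X t \<omega> * X s \<omega>)
        = (1/2) * (t powr (2 * H) + s powr (2 * H) - \<bar>t - s\<bar> powr (2 * H)))"

definition continuous_paths :: "real set \<Rightarrow> (real \<Rightarrow> 'a \<Rightarrow> real) \<Rightarrow> bool" where
  "continuous_paths I X \<longleftrightarrow> (AE \<omega> in M. continuous_on I (\<lambda>t. X t \<omega>))"

definition wiener_process :: "real set \<Rightarrow> (real \<Rightarrow> 'a \<Rightarrow> real) \<Rightarrow> bool" where
  "wiener_process I W \<longleftrightarrow>
     (\<forall>t\<in>I. random_variable borel (W t)) \<and>
     (AE \<omega> in M. W 0 \<omega> = 0) \<and>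
     (\<forall>(n::nat) t. mono_on {..n} t \<and> t ` {..n} \<subseteq> I \<longrightarrow>
        indep_vars (\<lambda>_. borel) (\<lambda>i \<omega>. W (t (Suc i)) \<omega> - W (t i) \<omega>) {..<n}) \<and>
     (\<forall>s\<in>I. \<forall>t\<in>I. s < t \<longrightarrow>
        distributed M lborel (\<lambda>\<omega>. W t \<omega> - W s \<omega>)
          (\<lambda>x. ennreal (normal_density 0 (sqrt (t - s)) x))) \<and>
     continuous_paths I W"

definition independent_processes ::
    "real set \<Rightarrow> (real \<Rightarrow> 'a \<Rightarrow> real) \<Rightarrow> (real \<Rightarrow> 'a \<Rightarrow> real) \<Rightarrow> bool" where
  "independent_processes I X Y \<longleftrightarrow>
     indep_var (PiM I (\<lambda>_. borel)) (\<lambda>\<omega>. \<lambda>t\<in>I. X t \<omega>)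
               (PiM I (\<lambda>_. borel)) (\<lambda>\<omega>. \<lambda>t\<in>I. Y t \<omega>)"

end

text \<open>The set \<open>A\<^bsub>T,g,\<epsilon>\<^esub>\<close>. For almost surely continuous \<open>B\<close> and \<open>W\<close> it agrees up to a null set
  with a measurable set, so its probability is to be taken in the completion of \<open>M\<close>.\<close>

definition small_ball_event ::
    "'a measure \<Rightarrow> (real \<Rightarrow> 'a \<Rightarrow> real) \<Rightarrow> (real \<Rightarrow> 'a \<Rightarrow> real) \<Rightarrow> (real \<Rightarrow> real)
      \<Rightarrow> real \<Rightarrow> (real \<Rightarrow> real) \<Rightarrow> real \<Rightarrow> 'a set" where
  "small_ball_event M B W f T g \<epsilon> =
     {\<omega> \<in> space M. \<forall>t\<in>{0..T}. \<bar>B t \<omega> + W t \<omega> + g t\<bar> \<le> \<epsilon> * f t}"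


section \<open>Trends and suitable expansions\<close>

definition AC_on :: "real \<Rightarrow> (real \<Rightarrow> real) \<Rightarrow> bool" where
  "AC_on T \<phi> \<longleftrightarrow>
     (\<forall>e>0. \<exists>d>0. \<forall>(n::nat) a b.
        (\<forall>i<n. 0 \<le> a i \<and> a i \<le> b i \<and> b i \<le> T) \<and>
        disjoint_family_on (\<lambda>i. {a i<..<b i}) {..<n} \<and>
        (\<Sum>i<n. b i - a i) < d
        \<longrightarrow> (\<Sum>i<n. \<bar>\<phi> (b i) - \<phi> (a i)\<bar>) < e)"

definition L2_on :: "real \<Rightarrow> (real \<Rightarrow> real) \<Rightarrow> bool" where
  "L2_on T \<phi> \<longleftrightarrow>
     set_borel_measurable lebesgue {0..T} \<phi> \<and>
     set_integrable lebesgue {0..T} (\<lambda>t. (\<phi> t)\<^sup>2)"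

text \<open>The derivative of an absolutely continuous function exists almost everywhere only, so it is
  represented by a function \<open>\<phi>'\<close> agreeing with it almost everywhere.\<close>

definition AC_with_L2_deriv :: "real \<Rightarrow> (real \<Rightarrow> real) \<Rightarrow> (real \<Rightarrow> real) \<Rightarrow> bool" where
  "AC_with_L2_deriv T \<phi> \<phi>' \<longleftrightarrow>
     AC_on T \<phi> \<and>
     (AE t in lebesgue. t \<in> {0..T} \<longrightarrow> (\<phi> has_real_derivative \<phi>' t) (at t within {0..T})) \<and>
     (\<forall>t\<in>{0..T}. \<phi> t = (LINT s:{0..t}|lebesgue. \<phi>' s)) \<and>
     L2_on T \<phi>'"

definition suitable_expansion ::
    "real \<Rightarrow> (real \<Rightarrow> real) \<Rightarrow> (real \<Rightarrow> real) \<Rightarrow> (real \<Rightarrow> real) \<Rightarrow> (real \<Rightarrow> real) \<Rightarrow> (real \<Rightarrow> real) \<Rightarrow> bool" where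
  "suitable_expansion T g gW gW' gB gB' \<longleftrightarrow>
     (\<forall>t\<in>{0..T}. g t = gW t + gB t) \<and>
     AC_with_L2_deriv T gW gW' \<and> AC_with_L2_deriv T gB gB'"


section \<open>The operator \<open>K\<^sub>0\<close>\<close>

definition C1 :: "real \<Rightarrow> real" where
  "C1 H = sqrt (2 * H * Gamma (H + 1/2) * Gamma (3/2 - H) / Gamma (2 - 2 * H))"

text \<open>For \<open>\<phi>\<close> in \<open>L\<^sub>2\<close> the integrand is integrable for almost every \<open>t\<close>; elsewhere the
  Bochner integral is \<open>0\<close> by convention, which does not affect \<open>L\<^sub>2\<close>-norms.\<close>

definition K0_star :: "real \<Rightarrow> (real \<Rightarrow> real) \<Rightarrow> real \<Rightarrow> real" where
  "K0_star H \<phi> t =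
     inverse (C1 H) * t powr (H - 1/2) / Gamma (1/2 - H) *
       (LINT u:{0..t}|lebesgue. (t - u) powr (- 1/2 - H) * u powr (1/2 - H) * \<phi> u)"

end

theory Submission
  imports Defs
begin

text \<open>Restricted to finitely many times, \<open>B + W\<close> is a centered Gaussian vector \<open>X\<close> with covariance \<open>R\<close>.
  If \<open>(a \<bullet> m)\<^sup>2 \<le> K (a \<bullet> R a)\<close> for all \<open>a\<close>, the Cameron--Martin shift by \<open>m\<close> costs at most a factor
  \<open>exp (- K/2)\<close> on a symmetric box, because the linear term of the density averages out. For \<open>m = g\<close>
  this inequality with \<open>K = \<parallel>g\<^sub>W'\<parallel>\<^sup>2 + \<parallel>h\<parallel>\<^sup>2\<close> follows from the Cauchy--Schwarz inequality, once \<open>B\<close> is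
  represented by the Molchan--Golosov kernel: functions \<open>k\<^sub>s\<close>, supported in \<open>[0, s]\<close>, with
  \<open>\<langle>k\<^sub>s, k\<^sub>t\<rangle> = E B\<^sub>s B\<^sub>t\<close> and \<open>\<langle>K\<^sub>0\<^sup>* \<phi>, k\<^sub>s\<rangle> = \<integral>\<^sub>0\<^sup>s \<phi>\<close>. Here \<open>k\<^sub>s = K\<^sub>0\<^sup>* (\<partial>E B B\<^sub>s)\<close> on \<open>[0, s]\<close>, and both
  identities reduce to the fact that the adjoint of \<open>K\<^sub>0\<^sup>*\<close> maps \<open>k\<^sub>s\<close> to the indicator of \<open>[0, s]\<close>. The passage
  to all times uses that countably many times decide the event for continuous paths.\<close>

text \<open>The kernel is used only through inner products in L2: \<open>B\<close> is never written
  as a stochastic integral, so the finite-dimensional laws of \<open>B\<close> and \<open>W\<close>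
  suffice. The covariance of X may be singular (it is as soon as 0 is among the times, since X
  vanishes there almost surely), so no density of the whole vector is available; only the component
  along the shift is given one. Laws are handled as integrals of the cosine of a linear combination
  plus a phase: the free phase lets real integrals carry the whole characteristic function. The cost
  is a sum of two squared norms because the covariance of \<open>B + W\<close> is a sum and the two
  Cauchy-Schwarz bounds combine like vectors in an orthogonal sum. On the analytic side a stands for
  1/2 - H throughout; the kernels are singular at endpoints, so the identities are proved for
  nonnegative integrals, where Tonelli applies without convergence questions. The constant
  \<open>C1\<close> is exactly what gives the indicator in the adjoint identity the value 1.\<close>

section \<open>Beta-type integrals\<close>

text \<open>The Beta integrals below come from the standard one on (0, 1) by a differentiable
  bijection \<open>g\<close>. The form with nonnegative integrals is the one in which they are fed
  into Tonelli later.\<close>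

lemma nn_integral_Beta_subst:
  fixes g g' :: "real \<Rightarrow> real"
  assumes pq: "p > 0" "q > (0::real)"
    and S: "S \<in> sets lebesgue"
    and der: "\<And>x. x \<in> S \<Longrightarrow> (g has_field_derivative g' x) (at x within S)"
    and inj: "inj_on g S" and img: "g ` S = {0<..<1}"
  shows "(\<integral>\<^sup>+x. ennreal (\<bar>g' x\<bar> * (g x powr (p - 1) * (1 - g x) powr (q - 1))) * indicator S x \<partial>lborel)
    = ennreal (Beta p q)"
proof -
  let ?f = "\<lambda>t::real. t powr (p - 1) * (1 - t) powr (q - 1)"
  have f: "(?f has_integral Beta p q) {0<..<1}"
    using has_integral_Beta_real[OF pq] by (simp add: has_integral_Icc_iff_Ioo)
  then have "?f absolutely_integrable_on {0<..<1}"
    by (intro nonnegative_absolutely_integrable_1) (auto simp: has_integral_integrable)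
  with f have "?f absolutely_integrable_on g ` S \<and> integral (g ` S) ?f = Beta p q"
    by (auto simp: img integral_unique)
  then have *: "(\<lambda>x. \<bar>g' x\<bar> * ?f (g x)) absolutely_integrable_on S"
      "integral S (\<lambda>x. \<bar>g' x\<bar> * ?f (g x)) = Beta p q"
    using has_absolute_integral_change_of_variables_1'[OF S der inj, of ?f "Beta p q"] by auto
  then have "((\<lambda>x. \<bar>g' x\<bar> * ?f (g x)) has_integral Beta p q) S"
    using set_lebesgue_integral_eq_integral(1)[OF *(1)] by (simp add: has_integral_iff)
  then show ?thesis
    by (intro nn_integral_has_integral_lebesgue') auto
qed

text \<open>The substitution \<open>k * w / (A + k * w)\<close> sends the half-line to (0, 1), and
  its complement to 1 is \<open>A / (A + k * w)\<close>; all powers of \<open>A + k * w\<close> then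
  collect into the exponent \<open>- p - q\<close>.\<close>

lemma nn_integral_Beta_Ioi:
  assumes pq: "p > 0" "q > (0::real)" and A: "A > 0" "k > 0"
  shows "(\<integral>\<^sup>+w. ennreal (w powr (p - 1) * (A + k * w) powr (- p - q)) * indicator {0<..} w \<partial>lborel)
    = ennreal (A powr (- q) * k powr (- p) * Beta p q)"
proof -
  let ?g = "\<lambda>w. k * w / (A + k * w)" and ?g' = "\<lambda>w. k * A / (A + k * w)\<^sup>2"
  have img: "?g ` {0<..} = {0<..<1}"
  proof safe
    fix y :: real assume "y \<in> {0<..<1}"
    then show "y \<in> ?g ` {0<..}"
      using A by (intro image_eqI[of _ _ "A * y / (k * (1 - y))"]) (auto simp: field_simps)
  qed (use A in \<open>auto simp: add_pos_pos field_simps\<close>)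
  have inj: "inj_on ?g {0<..}"
  proof (rule inj_onI)
    fix x y assume *: "x \<in> {0<..}" "y \<in> {0<..}" "?g x = ?g y"
    have p: "A + k * x > 0" "A + k * y > 0" using A * by (auto simp: add_pos_pos)
    from *(3) p have "k * x * (A + k * y) = k * y * (A + k * x)"
      by (simp add: frac_eq_eq)
    with A show "x = y" by (simp add: algebra_simps)
  qed
  have der: "(?g has_field_derivative ?g' w) (at w within {0<..})" if "w \<in> {0<..}" for w
  proof -
    have p: "A + k * w > 0" using A that by (auto simp: add_pos_pos)
    show ?thesis
      by (rule derivative_eq_intros refl | use p in \<open>simp add: power2_eq_square field_simps\<close>)+
  qed
  have eq: "\<bar>?g' w\<bar> * (?g w powr (p - 1) * (1 - ?g w) powr (q - 1)) =
      A powr q * k powr p * (w powr (p - 1) * (A + k * w) powr (- p - q))" if "w > 0" for w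
  proof -
    have p: "A + k * w > 0" using A that by (auto simp: add_pos_pos)
    then have "1 - ?g w = A / (A + k * w)" by (simp add: field_simps)
    moreover have "\<bar>k * A / D\<^sup>2\<bar> * ((k * w / D) powr (p - 1) * (A / D) powr (q - 1)) =
      A powr q * k powr p * (w powr (p - 1) * D powr (- p - q))" if "D > 0" for D
      using A \<open>w > 0\<close> that
      by (simp add: powr_mult powr_divide powr_diff powr_add powr_minus power2_eq_square field_simps)
    ultimately show ?thesis using p by simp
  qed
  have "ennreal (Beta p q) = (\<integral>\<^sup>+w. ennreal (\<bar>?g' w\<bar> * (?g w powr (p - 1) * (1 - ?g w) powr (q - 1)))
      * indicator {0<..} w \<partial>lborel)"
    by (intro nn_integral_Beta_subst[symmetric] pq der inj img) auto
  also have "\<dots> = (\<integral>\<^sup>+w. ennreal (A powr q * k powr p) *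
      (ennreal (w powr (p - 1) * (A + k * w) powr (- p - q)) * indicator {0<..} w) \<partial>lborel)"
  proof (rule nn_integral_cong, goal_cases)
    case (1 w)
    show ?case
    proof (cases "w \<in> {0<..}")
      case True
      then show ?thesis
        using arg_cong[OF eq[of w], of ennreal] by (simp flip: ennreal_mult')
    qed simp
  qed
  also have "\<dots> = ennreal (A powr q * k powr p) *
    (\<integral>\<^sup>+w. ennreal (w powr (p - 1) * (A + k * w) powr (- p - q)) * indicator {0<..} w \<partial>lborel)" (is "_ = _ * ?I")
    by (intro nn_integral_cmult) auto
  finally have B: "ennreal (Beta p q) = ennreal (A powr q * k powr p) * ?I" .
  have "ennreal (A powr (- q) * k powr (- p) * Beta p q) =
      ennreal (A powr (- q) * k powr (- p)) * ennreal (Beta p q)"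
    by (simp add: ennreal_mult')
  also have "\<dots> = ennreal (A powr (- q) * k powr (- p) * (A powr q * k powr p)) * ?I"
    unfolding B by (simp add: ennreal_mult' mult.assoc)
  also have "A powr (- q) * k powr (- p) * (A powr q * k powr p) = 1"
    using A by (simp add: powr_minus field_simps)
  finally show ?thesis by simp
qed

text \<open>The exponents add up to -2, as a Moebius substitution requires: the map sending 0,
  \<open>t\<close>, \<open>r\<close> to 0, 1, infinity turns the integrand into the standard
  one.\<close>

lemma nn_integral_Beta_three_points:
  assumes pq: "p > 0" "q > (0::real)" and t: "0 < t" "t < r"
  shows "(\<integral>\<^sup>+v. ennreal (v powr (p - 1) * (t - v) powr (q - 1) * (r - v) powr (- p - q)) * indicator {0<..<t} v \<partial>lborel)
    = ennreal (t powr (p + q - 1) * r powr (- q) * (r - t) powr (- p) * Beta p q)"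
proof -
  let ?g = "\<lambda>v. v * (r - t) / (t * (r - v))" and ?g' = "\<lambda>v. (r - t) * r / (t * (r - v)\<^sup>2)"
  have img: "?g ` {0<..<t} = {0<..<1}"
  proof safe
    fix y :: real assume y: "y \<in> {0<..<1}"
    have p: "r - t + t * y > 0" using t y by (auto simp: add_pos_pos)
    have l: "t * y < t" using t y by simp
    have "r - y * r * t / (r - t + t * y) = r * (r - t) / (r - t + t * y)"
      using p by (simp add: field_simps)
    moreover have "y = y * r * t / D * (r - t) / (t * (r * (r - t) / D))" if "D > 0" for D
      using t that by simp
    \<comment> \<open>The preimage of \<open>y\<close>: after clearing the denominator the equation
      \<open>?g v = y\<close> is linear in \<open>v\<close>.\<close>
    ultimately have "y = ?g (y * r * t / (r - t + t * y))"
      using p by simp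
    moreover have "y * r * t / (r - t + t * y) < t"
    proof -
      have "y * (r - t) < 1 * (r - t)" using t y by (intro mult_strict_right_mono) auto
      then have "y * r < r - t + t * y" by (simp add: algebra_simps)
      then have "y * r * t < t * (r - t + t * y)" using t by simp
      then show ?thesis using p by (simp add: pos_divide_less_eq)
    qed
    ultimately show "y \<in> ?g ` {0<..<t}"
      using t y p by (intro image_eqI[of _ _ "y * r * t / (r - t + t * y)"]) auto
  next
    fix v assume v: "v \<in> {0<..<t}"
    show "?g v \<in> {0<..<1}" 
    proof -
      have "v * r < t * r" using v t by auto
      then show ?thesis using v t by (auto simp: field_simps)
    qed
  qed
  have inj: "inj_on ?g {0<..<t}"
  proof (rule inj_onI)
    fix x y assume *: "x \<in> {0<..<t}" "y \<in> {0<..<t}" "?g x = ?g y"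
    have p: "t * (r - x) > 0" "t * (r - y) > 0" using t * by auto
    from *(3) p have "x * (r - t) * (t * (r - y)) = y * (r - t) * (t * (r - x))"
      by (metis frac_eq_eq less_irrefl)
    then have "(t * (r - t)) * (x * (r - y)) = (t * (r - t)) * (y * (r - x))" by (simp add: mult_ac)
    with t have "x * (r - y) = y * (r - x)" by simp
    with t show "x = y" by (simp add: algebra_simps)
  qed
  have der: "(?g has_field_derivative ?g' w) (at w within {0<..<t})" if "w \<in> {0<..<t}" for w
  proof -
    have p: "t * (r - w) \<noteq> 0" using t that by auto
    have "(?g has_field_derivative ((r - t) * (t * (r - w)) - w * (r - t) * (- t)) / (t * (r - w) * (t * (r - w)))) (at w within {0<..<t})"
      using p by (auto intro!: derivative_eq_intros)
    also have "(r - t) * (t * (r - w)) - w * (r - t) * (- t) = t * ((r - t) * r)"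
      by (simp add: algebra_simps)
    also have "t * ((r - t) * r) / (t * (r - w) * (t * (r - w))) = ?g' w"
      using t by (simp add: power2_eq_square)
    finally show ?thesis .
  qed
  have eq: "\<bar>?g' v\<bar> * (?g v powr (p - 1) * (1 - ?g v) powr (q - 1)) =
      t powr (1 - p - q) * r powr q * (r - t) powr p *
       (v powr (p - 1) * (t - v) powr (q - 1) * (r - v) powr (- p - q))" if "0 < v" "v < t" for v
  proof -
    have "1 - ?g v = r * (t - v) / (t * (r - v))" using that t by (simp add: field_simps)
    moreover have "\<bar>C * r / (t * D\<^sup>2)\<bar> * ((v * C / (t * D)) powr (p - 1) * (r * E / (t * D)) powr (q - 1)) =
      t powr (1 - p - q) * r powr q * C powr p *
       (v powr (p - 1) * E powr (q - 1) * D powr (- p - q))" if "C > 0" "D > 0" "E > 0" for C D E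
      using t \<open>v > 0\<close> that
      by (simp add: powr_mult powr_divide powr_diff powr_add powr_minus power2_eq_square field_simps)
    ultimately show ?thesis using that t by simp
  qed
  have "ennreal (Beta p q) = (\<integral>\<^sup>+w. ennreal (\<bar>?g' w\<bar> * (?g w powr (p - 1) * (1 - ?g w) powr (q - 1)))
      * indicator {0<..<t} w \<partial>lborel)"
    by (intro nn_integral_Beta_subst[symmetric] pq der inj img) auto
  also have "\<dots> = (\<integral>\<^sup>+v. ennreal (t powr (1 - p - q) * r powr q * (r - t) powr p) *
      (ennreal (v powr (p - 1) * (t - v) powr (q - 1) * (r - v) powr (- p - q)) * indicator {0<..<t} v) \<partial>lborel)"
  proof (rule nn_integral_cong, goal_cases)
    case (1 w)
    show ?case
    proof (cases "w \<in> {0<..<t}")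
      case True
      then show ?thesis
        using arg_cong[OF eq[of w], of ennreal] by (simp flip: ennreal_mult')
    qed simp
  qed
  also have "\<dots> = ennreal (t powr (1 - p - q) * r powr q * (r - t) powr p) *
    (\<integral>\<^sup>+v. ennreal (v powr (p - 1) * (t - v) powr (q - 1) * (r - v) powr (- p - q)) * indicator {0<..<t} v \<partial>lborel)" (is "_ = _ * ?I")
    by (intro nn_integral_cmult) auto
  finally have B: "ennreal (Beta p q) = ennreal (t powr (1 - p - q) * r powr q * (r - t) powr p) * ?I" .
  let ?c = "t powr (p + q - 1) * r powr (- q) * (r - t) powr (- p)"
  have "ennreal (?c * Beta p q) = ennreal ?c * ennreal (Beta p q)"
    by (simp add: ennreal_mult')
  also have "\<dots> = ennreal (?c * (t powr (1 - p - q) * r powr q * (r - t) powr p)) * ?I"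
    unfolding B by (simp add: ennreal_mult' mult.assoc)
  also have "?c * (t powr (1 - p - q) * r powr q * (r - t) powr p) = 1"
    using t by (simp add: powr_diff powr_add powr_minus field_simps)
  finally show ?thesis by simp
qed

lemma nn_integral_Beta_interval:
  assumes pq: "p > 0" "q > (0::real)" and t: "0 < t"
  shows "(\<integral>\<^sup>+v. ennreal (v powr (p - 1) * (t - v) powr (q - 1)) * indicator {0<..<t} v \<partial>lborel)
    = ennreal (t powr (p + q - 1) * Beta p q)"
proof -
  let ?g = "\<lambda>v. v / t" and ?g' = "\<lambda>v. 1 / t"
  have img: "?g ` {0<..<t} = {0<..<1}"
  proof safe
    fix y :: real assume y: "y \<in> {0<..<1}"
    then show "y \<in> ?g ` {0<..<t}" using t by (intro image_eqI[of _ _ "y * t"]) auto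
  qed (use t in auto)
  have eq: "\<bar>?g' v\<bar> * (?g v powr (p - 1) * (1 - ?g v) powr (q - 1)) =
      t powr (1 - p - q) * (v powr (p - 1) * (t - v) powr (q - 1))" if "0 < v" "v < t" for v
  proof -
    have "1 - ?g v = (t - v) / t" using that t by (simp add: field_simps)
    moreover have "(1 / t) * ((v / t) powr (p - 1) * (E / t) powr (q - 1)) =
      t powr (1 - p - q) * (v powr (p - 1) * E powr (q - 1))" if "E > 0" for E
      using t \<open>v > 0\<close> that
      by (simp add: powr_mult powr_divide powr_diff powr_add powr_minus field_simps)
    ultimately show ?thesis using that t by simp
  qed
  have "ennreal (Beta p q) = (\<integral>\<^sup>+w. ennreal (\<bar>?g' w\<bar> * (?g w powr (p - 1) * (1 - ?g w) powr (q - 1)))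
      * indicator {0<..<t} w \<partial>lborel)"
    using t by (intro nn_integral_Beta_subst[symmetric] pq img)
       (auto intro!: derivative_eq_intros inj_onI)
  also have "\<dots> = (\<integral>\<^sup>+v. ennreal (t powr (1 - p - q)) *
      (ennreal (v powr (p - 1) * (t - v) powr (q - 1)) * indicator {0<..<t} v) \<partial>lborel)"
  proof (rule nn_integral_cong, goal_cases)
    case (1 w)
    show ?case
    proof (cases "w \<in> {0<..<t}")
      case True
      then show ?thesis
        using arg_cong[OF eq[of w], of ennreal] by (simp flip: ennreal_mult')
    qed simp
  qed
  also have "\<dots> = ennreal (t powr (1 - p - q)) *
    (\<integral>\<^sup>+v. ennreal (v powr (p - 1) * (t - v) powr (q - 1)) * indicator {0<..<t} v \<partial>lborel)" (is "_ = _ * ?I")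
    by (intro nn_integral_cmult) auto
  finally have B: "ennreal (Beta p q) = ennreal (t powr (1 - p - q)) * ?I" .
  let ?c = "t powr (p + q - 1)"
  have "ennreal (?c * Beta p q) = ennreal ?c * ennreal (Beta p q)"
    by (simp add: ennreal_mult')
  also have "\<dots> = ennreal (?c * t powr (1 - p - q)) * ?I"
    unfolding B by (simp add: ennreal_mult' mult.assoc)
  also have "?c * t powr (1 - p - q) = 1"
    using t by (simp add: powr_diff powr_add powr_minus field_simps)
  finally show ?thesis by simp
qed

text \<open>Derivatives are asked for in the interior only, because the power integrands below blow
  up at endpoints where their primitives are still continuous.\<close>

lemma nn_integral_FTC_Ioo:
  fixes F f :: "real \<Rightarrow> real"
  assumes "a \<le> b" "continuous_on {a..b} F"
    and "\<And>x. x \<in> {a<..<b} \<Longrightarrow> (F has_real_derivative f x) (at x)"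
    and "\<And>x. x \<in> {a<..<b} \<Longrightarrow> 0 \<le> f x"
  shows "(\<integral>\<^sup>+x. ennreal (f x) * indicator {a<..<b} x \<partial>lborel) = ennreal (F b - F a)"
proof -
  have "(f has_integral (F b - F a)) {a..b}"
    using assms by (intro fundamental_theorem_of_calculus_interior)
      (auto simp: has_real_derivative_iff_has_vector_derivative)
  then have "(f has_integral (F b - F a)) {a<..<b}"
    by (simp add: has_integral_Icc_iff_Ioo)
  then show ?thesis
    using assms(4) by (intro nn_integral_has_integral_lebesgue') auto
qed

lemma nn_integral_powr_tail:
  fixes v s b :: real
  assumes "v < s" "b > 0"
  shows "(\<integral>\<^sup>+r. ennreal ((r - v) powr (- b - 1)) * indicator {s<..} r \<partial>lborel)
    = ennreal ((s - v) powr (- b) / b)"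
proof -
  have "(\<integral>\<^sup>+r. ennreal ((r - v) powr (- b - 1)) * indicator {s<..} r \<partial>lborel)
      = (\<integral>\<^sup>+r. ennreal ((r - v) powr (- b - 1)) * indicator {s..} r \<partial>lborel)"
    using AE_lborel_singleton[of s]
    by (intro nn_integral_cong_AE) (auto elim!: eventually_mono split: split_indicator)
  also have "\<dots> = ennreal (0 - (- ((s - v) powr (- b) / b)))"
  proof (rule nn_integral_FTC_atLeast)
    show "((\<lambda>r. - ((r - v) powr (- b) / b)) has_real_derivative (r - v) powr (- b - 1)) (at r)"
      if "s \<le> r" for r
      using assms that by (auto intro!: derivative_eq_intros simp: field_simps)
    have "filterlim (\<lambda>r. - v + r) at_top at_top"
      by (rule filterlim_tendsto_add_at_top[OF tendsto_const filterlim_ident])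
    then have "filterlim (\<lambda>r. r - v) at_top at_top" by simp
    then have "((\<lambda>r. (r - v) powr (- b)) \<longlongrightarrow> 0) at_top"
      using assms by (intro tendsto_neg_powr) auto
    then show "((\<lambda>r. - ((r - v) powr (- b) / b)) \<longlongrightarrow> 0) at_top"
      using tendsto_minus[OF tendsto_divide[OF _ tendsto_const[of b]]] assms by fastforce
  qed auto
  finally show ?thesis by simp
qed

text \<open>The exponents again add up to -2: \<open>(t - u) / (r - t)\<close> has derivative
  \<open>(r - u) / (r - t)\<^sup>2\<close>, so its power \<open>a\<close> is a primitive up to the
  factor \<open>a * (r - u)\<close>.\<close>

lemma nn_integral_two_points:
  fixes u s r a :: real
  assumes a: "a > 0" and u: "u < s" "s < r"
  shows "(\<integral>\<^sup>+t. ennreal ((t - u) powr (a - 1) * (r - t) powr (- a - 1)) * indicator {u<..<s} t \<partial>lborel)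
    = ennreal ((s - u) powr a * (r - s) powr (- a) / (a * (r - u)))"
proof -
  let ?F = "\<lambda>t. (t - u) powr a * (r - t) powr (- a) / (a * (r - u))"
  have "(\<integral>\<^sup>+t. ennreal ((t - u) powr (a - 1) * (r - t) powr (- a - 1)) * indicator {u<..<s} t \<partial>lborel)
    = ennreal (?F s - ?F u)"
  proof (rule nn_integral_FTC_Ioo)
    show "continuous_on {u..s} ?F"
      using a u by (intro continuous_intros continuous_on_powr') auto
    fix x assume x: "x \<in> {u<..<s}"
    have "((\<lambda>t. (t - u) powr a * (r - t) powr (- a)) has_real_derivative a * (x - u) powr (a - 1) * (r - x) powr (- a) +
        a * (x - u) powr a * (r - x) powr (- a - 1)) (at x)"
      using a u x by (auto intro!: derivative_eq_intros simp: mult_ac)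
    then have "(?F has_real_derivative (a * (x - u) powr (a - 1) * (r - x) powr (- a) +
        a * (x - u) powr a * (r - x) powr (- a - 1)) / (a * (r - u))) (at x)"
      by (rule DERIV_cdivide)
    also have "(x - u) powr a = (x - u) powr (a - 1) * (x - u)"
      using x by (simp add: powr_diff)
    also have "(r - x) powr (- a) = (r - x) powr (- a - 1) * (r - x)"
      using x u by (simp add: powr_diff)
    also have "(a * (x - u) powr (a - 1) * ((r - x) powr (- a - 1) * (r - x)) +
        a * ((x - u) powr (a - 1) * (x - u)) * (r - x) powr (- a - 1)) / (a * (r - u)) =
        (x - u) powr (a - 1) * (r - x) powr (- a - 1)"
    proof -
      have "a * P * (Q * (r - x)) + a * (P * (x - u)) * Q = P * Q * (a * (r - u))" for P Q
        by (simp add: algebra_simps)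
      then show ?thesis using a u by simp
    qed
    finally show "(?F has_real_derivative (x - u) powr (a - 1) * (r - x) powr (- a - 1)) (at x)" .
  qed (use u in auto)
  then show ?thesis using a by simp
qed

text \<open>Both sides are \<open>Gamma a * Gamma (1 - a)\<close>. The identity gives the constant
  term and the tail term in \<open>kernel_adjoint_identity\<close> a common factor.\<close>

lemma Beta_product:
  assumes "0 < a" "a < 1/2"
  shows "2 * a * Beta (a + 1) a * Beta (1 - a) (2 * a) = Beta (1 - a) (a::real)"
proof -
  have "Gamma (1 + 2 * a) = 2 * a * Gamma (2 * a)"
    using assms Gamma_plus1[of "2 * a"] nonpos_Ints_nonpos[of "2 * a"] by (auto simp: add.commute)
  moreover have "Gamma (1 + a) > 0" "Gamma (2 * a) > 0" "Gamma a > 0" using assms by auto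
  moreover have "a + 1 + a = 1 + 2 * a" "1 - a + 2 * a = 1 + a" "1 - a + a = 1" "a + 1 = 1 + a" by simp_all
  ultimately show ?thesis
    using assms unfolding Beta_def by (simp add: field_simps less_imp_neq[symmetric])
qed

lemma nn_integral_Fubini_lborel:
  fixes f :: "real \<Rightarrow> real \<Rightarrow> ennreal"
  assumes "case_prod f \<in> borel_measurable (borel \<Otimes>\<^sub>M borel)"
  shows "(\<integral>\<^sup>+x. \<integral>\<^sup>+y. f x y \<partial>lborel \<partial>lborel) = (\<integral>\<^sup>+y. \<integral>\<^sup>+x. f x y \<partial>lborel \<partial>lborel)"
proof -
  have "case_prod f \<in> borel_measurable (lborel \<Otimes>\<^sub>M lborel)"
    using assms by (simp cong: measurable_cong_sets sets_pair_measure_cong)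
  from lborel_pair.Fubini'[OF this] show ?thesis by simp
qed

section \<open>The adjoint of the operator \<open>K\<^sub>0\<close>\<close>

text \<open>Writing \<open>(s - v) powr (- 2 a)\<close> as an integral over \<open>r > s\<close> turns the inner integral into one whose exponents add
  up to \<open>- 2\<close>; such integrals are elementary multiples of a Beta value.\<close>

lemma kernel_tail_representation:
  assumes a: "0 < a" "a < 1/2" and t: "0 < t" "t < s"
  shows "(\<integral>\<^sup>+v. ennreal ((t - v) powr (a - 1) * v powr a * (s - v) powr (- 2 * a)) * indicator {0<..<t} v \<partial>lborel)
    = (\<integral>\<^sup>+r. ennreal (2 * a * Beta (a + 1) a * t powr (2 * a) * r powr (- a) * (r - t) powr (- a - 1)) * indicator {s<..} r \<partial>lborel)"
proof -
  \<comment> \<open>The factor \<open>2 * a\<close> cancels the denominator of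
    \<open>nn_integral_powr_tail\<close>; the exponents are spelled to fit
    \<open>nn_integral_Beta_three_points\<close> with parameters \<open>a + 1\<close> and
    \<open>a\<close>.\<close>
  let ?f = "\<lambda>v r. ennreal (2 * a * (v powr (a + 1 - 1) * (t - v) powr (a - 1) * (r - v) powr (- (a + 1) - a)))
     * indicator {0<..<t} v * indicator {s<..} r"
  have "(\<integral>\<^sup>+v. ennreal ((t - v) powr (a - 1) * v powr a * (s - v) powr (- 2 * a)) * indicator {0<..<t} v \<partial>lborel)
     = (\<integral>\<^sup>+v. \<integral>\<^sup>+r. ?f v r \<partial>lborel \<partial>lborel)"
  proof (rule nn_integral_cong)
    fix v :: real
    show "ennreal ((t - v) powr (a - 1) * v powr a * (s - v) powr (- 2 * a)) * indicator {0<..<t} v =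
      (\<integral>\<^sup>+r. ?f v r \<partial>lborel)"
    proof (cases "v \<in> {0<..<t}")
      case True
      have "(\<integral>\<^sup>+r. ?f v r \<partial>lborel) =
        (\<integral>\<^sup>+r. ennreal (2 * a * (t - v) powr (a - 1) * v powr a) * (ennreal ((r - v) powr (- (2 * a) - 1)) * indicator {s<..} r) \<partial>lborel)"
        using True a by (intro nn_integral_cong) (auto simp: mult_ac simp flip: ennreal_mult' split: split_indicator)
      also have "\<dots> = ennreal (2 * a * (t - v) powr (a - 1) * v powr a) * ennreal ((s - v) powr (- (2 * a)) / (2 * a))"
        using True t a by (subst nn_integral_cmult) (auto simp: nn_integral_powr_tail)
      also have "\<dots> = ennreal ((t - v) powr (a - 1) * v powr a * (s - v) powr (- 2 * a))"
        using a by (subst ennreal_mult'[symmetric]) auto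
      finally show ?thesis using True by simp
    qed simp
  qed
  also have "\<dots> = (\<integral>\<^sup>+r. \<integral>\<^sup>+v. ?f v r \<partial>lborel \<partial>lborel)"
    by (rule nn_integral_Fubini_lborel) measurable
  also have "\<dots> = (\<integral>\<^sup>+r. ennreal (2 * a * Beta (a + 1) a * t powr (2 * a) * r powr (- a) * (r - t) powr (- a - 1)) * indicator {s<..} r \<partial>lborel)"
  proof (rule nn_integral_cong)
    fix r :: real
    show "(\<integral>\<^sup>+v. ?f v r \<partial>lborel) = ennreal (2 * a * Beta (a + 1) a * t powr (2 * a) * r powr (- a) * (r - t) powr (- a - 1)) * indicator {s<..} r"
    proof (cases "r \<in> {s<..}")
      case True
      have "(\<integral>\<^sup>+v. ?f v r \<partial>lborel) = (\<integral>\<^sup>+v. ennreal (2 * a) * (ennreal (v powr (a + 1 - 1) * (t - v) powr (a - 1) * (r - v) powr (- (a + 1) - a))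
           * indicator {0<..<t} v) \<partial>lborel)"
        using True a by (intro nn_integral_cong) (auto simp: mult_ac simp flip: ennreal_mult' split: split_indicator)
      also have "\<dots> = ennreal (2 * a) * ennreal (t powr (a + 1 + a - 1) * r powr (- a) * (r - t) powr (- (a + 1)) * Beta (a + 1) a)"
        using True t a by (subst nn_integral_cmult, simp, subst nn_integral_Beta_three_points) auto
      also have "\<dots> = ennreal (2 * a * Beta (a + 1) a * t powr (2 * a) * r powr (- a) * (r - t) powr (- a - 1))"
        using a by (subst ennreal_mult'[symmetric]) (auto simp: mult_ac)
      finally show ?thesis using True by simp
    qed simp
  qed
  finally show ?thesis .
qed

text \<open>Substitute \<open>u powr (- a) = (s + (s - u) y) powr (- a) + \<integral> a (1 + y) (t + (t - u) y) powr (- a - 1) dt\<close>, with \<open>t\<close>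
  ranging over \<open>[u, s]\<close>, in \<open>Beta (1 - a) a = \<integral> y powr (- a) / (1 + y) dy\<close>.\<close>

lemma Beta_expansion:
  assumes a: "0 < a" "a < 1/2" and u: "0 < u" "u < s"
  shows "ennreal (u powr (- a) * Beta (1 - a) a) =
    (\<integral>\<^sup>+y. ennreal ((s + (s - u) * y) powr (- a) * y powr (- a) / (1 + y)) * indicator {0<..} y \<partial>lborel) +
    (\<integral>\<^sup>+t. ennreal (a * Beta (1 - a) (2 * a) * (t - u) powr (a - 1) * t powr (- 2 * a)) * indicator {u<..<s} t \<partial>lborel)"
proof -
  let ?w = "\<lambda>y. y powr (1 - a - 1) * (1 + 1 * y) powr (- (1 - a) - a)"
  \<comment> \<open>This is \<open>?w\<close> times the derivative in \<open>t\<close>. The factor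
    \<open>1 + y\<close> of the derivative cancels that of \<open>?w\<close>, so the
    \<open>y\<close>-integral is again of Beta type, now with parameters \<open>1 - a\<close> and
    \<open>2 * a\<close>.\<close>
  let ?f = "\<lambda>y t. ennreal (a * (y powr (1 - a - 1) * (t + (t - u) * y) powr (- (1 - a) - 2 * a))) * indicator {u<..<s} t * indicator {0<..} y"
  have w: "?w y = y powr (- a) / (1 + y)" if "y > 0" for y
    using that by (simp add: powr_minus field_simps)
  have split: "ennreal (u powr (- a) * ?w y) * indicator {0<..} y =
      ennreal ((s + (s - u) * y) powr (- a) * y powr (- a) / (1 + y)) * indicator {0<..} y
      + (\<integral>\<^sup>+t. ?f y t \<partial>lborel)" for y
  proof (cases "y > 0")
    case True
    have pos: "t + (t - u) * y > 0" if "u \<le> t" for t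
      using that u True by (intro add_pos_nonneg) auto
    have "(\<integral>\<^sup>+t. ennreal (a * (1 + y) * (t + (t - u) * y) powr (- a - 1)) * indicator {u<..<s} t \<partial>lborel)
      = ennreal (- ((s + (s - u) * y) powr (- a)) - (- ((u + (u - u) * y) powr (- a))))"
    proof (rule nn_integral_FTC_Ioo)
      have "t + (t - u) * y \<noteq> 0" if "t \<in> {u..s}" for t using pos[of t] that by simp
      then show "continuous_on {u..s} (\<lambda>t. - ((t + (t - u) * y) powr (- a)))"
        by (intro continuous_intros) auto
      show "((\<lambda>t. - ((t + (t - u) * y) powr (- a))) has_real_derivative a * (1 + y) * (t + (t - u) * y) powr (- a - 1)) (at t)"
        if "t \<in> {u<..<s}" for t
        using pos[of t] that by (auto intro!: derivative_eq_intros simp: algebra_simps)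
    qed (use u a True in auto)
    then have I: "(\<integral>\<^sup>+t. ennreal (a * (1 + y) * (t + (t - u) * y) powr (- a - 1)) * indicator {u<..<s} t \<partial>lborel)
      = ennreal (u powr (- a) - (s + (s - u) * y) powr (- a))" by simp
    have le: "(s + (s - u) * y) powr (- a) \<le> u powr (- a)"
      using u a True by (intro powr_mono2') (auto intro: order.trans[of u s])
    have "(\<integral>\<^sup>+t. ?f y t \<partial>lborel) = (\<integral>\<^sup>+t. ennreal (?w y) *
        (ennreal (a * (1 + y) * (t + (t - u) * y) powr (- a - 1)) * indicator {u<..<s} t) \<partial>lborel)"
      using True a w[OF True] by (intro nn_integral_cong) (auto simp: mult_ac simp flip: ennreal_mult' split: split_indicator)
    also have "\<dots> = ennreal (?w y) * ennreal (u powr (- a) - (s + (s - u) * y) powr (- a))"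
      by (subst nn_integral_cmult) (auto simp: I)
    also have "\<dots> = ennreal (u powr (- a) * ?w y - (s + (s - u) * y) powr (- a) * ?w y)"
      by (subst ennreal_mult'[symmetric]) (auto simp: algebra_simps)
    finally have *: "(\<integral>\<^sup>+t. ?f y t \<partial>lborel) = ennreal (u powr (- a) * ?w y - (s + (s - u) * y) powr (- a) * ?w y)" .
    have "(s + (s - u) * y) powr (- a) * ?w y \<le> u powr (- a) * ?w y"
      by (intro mult_right_mono le) auto
    then have "ennreal (u powr (- a) * ?w y) = ennreal ((s + (s - u) * y) powr (- a) * ?w y) +
        ennreal (u powr (- a) * ?w y - (s + (s - u) * y) powr (- a) * ?w y)"
      by (subst ennreal_plus[symmetric]) auto
    then show ?thesis
      unfolding * using True w[OF True] by simp
  qed simp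
  have "ennreal (u powr (- a) * Beta (1 - a) a) = ennreal (u powr (- a)) * ennreal (1 powr (- a) * 1 powr (- (1 - a)) * Beta (1 - a) a)"
    by (simp add: ennreal_mult')
  also have "\<dots> = (\<integral>\<^sup>+y. ennreal (u powr (- a)) * (ennreal (?w y) * indicator {0<..} y) \<partial>lborel)"
    using a by (subst nn_integral_cmult, simp, subst nn_integral_Beta_Ioi) auto
  also have "\<dots> = (\<integral>\<^sup>+y. ennreal ((s + (s - u) * y) powr (- a) * y powr (- a) / (1 + y)) * indicator {0<..} y
      + (\<integral>\<^sup>+t. ?f y t \<partial>lborel) \<partial>lborel)"
    by (intro nn_integral_cong, subst split[symmetric], subst ennreal_mult', simp, simp only: mult.assoc)
  also have "\<dots> = (\<integral>\<^sup>+y. ennreal ((s + (s - u) * y) powr (- a) * y powr (- a) / (1 + y)) * indicator {0<..} y \<partial>lborel)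
      + (\<integral>\<^sup>+y. \<integral>\<^sup>+t. ?f y t \<partial>lborel \<partial>lborel)"
    by (intro nn_integral_add) auto
  also have "(\<integral>\<^sup>+y. \<integral>\<^sup>+t. ?f y t \<partial>lborel \<partial>lborel) = (\<integral>\<^sup>+t. \<integral>\<^sup>+y. ?f y t \<partial>lborel \<partial>lborel)"
    by (rule nn_integral_Fubini_lborel) measurable
  also have "\<dots> = (\<integral>\<^sup>+t. ennreal (a * Beta (1 - a) (2 * a) * (t - u) powr (a - 1) * t powr (- 2 * a)) * indicator {u<..<s} t \<partial>lborel)"
  proof (rule nn_integral_cong)
    fix t :: real
    show "(\<integral>\<^sup>+y. ?f y t \<partial>lborel) = ennreal (a * Beta (1 - a) (2 * a) * (t - u) powr (a - 1) * t powr (- 2 * a)) * indicator {u<..<s} t"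
    proof (cases "t \<in> {u<..<s}")
      case True
      have "(\<integral>\<^sup>+y. ?f y t \<partial>lborel) = (\<integral>\<^sup>+y. ennreal a * (ennreal (y powr (1 - a - 1) * (t + (t - u) * y) powr (- (1 - a) - 2 * a)) * indicator {0<..} y) \<partial>lborel)"
        using True a by (intro nn_integral_cong) (auto simp flip: ennreal_mult' split: split_indicator)
      also have "\<dots> = ennreal a * ennreal (t powr (- (2 * a)) * (t - u) powr (- (1 - a)) * Beta (1 - a) (2 * a))"
        using True u a by (subst nn_integral_cmult, simp, subst nn_integral_Beta_Ioi) auto
      also have "\<dots> = ennreal (a * Beta (1 - a) (2 * a) * (t - u) powr (a - 1) * t powr (- 2 * a))"
        using a by (subst ennreal_mult'[symmetric]) (auto simp: mult_ac)
      finally show ?thesis using True by simp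
    qed simp
  qed
  finally show ?thesis .
qed

text \<open>Up to constants and a power of \<open>u\<close>, this is the integral of
  \<open>K0_kernel H t u * MG_kernel H s t\<close> over \<open>t\<close>. After
  \<open>kernel_tail_representation\<close> the factor \<open>t powr (2 * a)\<close> cancels
  \<open>t powr (- 2 * a)\<close> and the \<open>t\<close>-integral is elementary; what remains is
  \<open>2 * Beta (a + 1) a\<close> times the two terms of \<open>Beta_expansion\<close>.\<close>

lemma kernel_adjoint_identity:
  assumes a: "0 < a" "a < 1/2" and u: "0 < u" "u < s"
  shows "(\<integral>\<^sup>+t. ennreal ((t - u) powr (a - 1) * t powr (- 2 * a)) * (ennreal (Beta (1 - a) a) +
      (\<integral>\<^sup>+v. ennreal ((t - v) powr (a - 1) * v powr a * (s - v) powr (- 2 * a)) * indicator {0<..<t} v \<partial>lborel))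
      * indicator {u<..<s} t \<partial>lborel)
    = ennreal (2 * Beta (a + 1) a * Beta (1 - a) a * u powr (- a))"
proof -
  let ?C = "2 * Beta (a + 1) a"
  let ?w = "\<lambda>t. (t - u) powr (a - 1) * t powr (- 2 * a)"
  let ?h = "\<lambda>t r. ennreal (a * ?C * r powr (- a) * ((t - u) powr (a - 1) * (r - t) powr (- a - 1))) * indicator {u<..<s} t * indicator {s<..} r"
  have Bp: "Beta (a + 1) a > 0" "Beta (1 - a) a > 0" "Beta (1 - a) (2 * a) > 0"
    using a by (auto simp: Beta_def intro!: divide_pos_pos mult_pos_pos)
  have prod: "?C * (a * Beta (1 - a) (2 * a)) = Beta (1 - a) a"
    using Beta_product[OF a] by (simp add: mult_ac)
  have "(\<integral>\<^sup>+t. ennreal (?w t) * (ennreal (Beta (1 - a) a) +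
      (\<integral>\<^sup>+v. ennreal ((t - v) powr (a - 1) * v powr a * (s - v) powr (- 2 * a)) * indicator {0<..<t} v \<partial>lborel))
      * indicator {u<..<s} t \<partial>lborel)
     = (\<integral>\<^sup>+t. ennreal (Beta (1 - a) a * ?w t) * indicator {u<..<s} t + (\<integral>\<^sup>+r. ?h t r \<partial>lborel) \<partial>lborel)"
  proof (rule nn_integral_cong)
    fix t :: real
    show "ennreal (?w t) * (ennreal (Beta (1 - a) a) +
      (\<integral>\<^sup>+v. ennreal ((t - v) powr (a - 1) * v powr a * (s - v) powr (- 2 * a)) * indicator {0<..<t} v \<partial>lborel))
      * indicator {u<..<s} t = ennreal (Beta (1 - a) a * ?w t) * indicator {u<..<s} t + (\<integral>\<^sup>+r. ?h t r \<partial>lborel)"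
    proof (cases "t \<in> {u<..<s}")
      case True
      then have t: "0 < t" "t < s" using u by auto
      have "(\<integral>\<^sup>+r. ?h t r \<partial>lborel) = (\<integral>\<^sup>+r. ennreal (?w t) *
        (ennreal (2 * a * Beta (a + 1) a * t powr (2 * a) * r powr (- a) * (r - t) powr (- a - 1)) * indicator {s<..} r) \<partial>lborel)"
      proof (rule nn_integral_cong)
        fix r
        have "t powr (- 2 * a) * t powr (2 * a) = 1" using t by (simp flip: powr_add)
        then have "?w t * (2 * a * Beta (a + 1) a * t powr (2 * a) * r powr (- a) * (r - t) powr (- a - 1))
          = a * ?C * r powr (- a) * ((t - u) powr (a - 1) * (r - t) powr (- a - 1))" by algebra
        then have *: "ennreal (a * ?C * r powr (- a) * ((t - u) powr (a - 1) * (r - t) powr (- a - 1)))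
          = ennreal (?w t) * ennreal (2 * a * Beta (a + 1) a * t powr (2 * a) * r powr (- a) * (r - t) powr (- a - 1))"
          by (subst ennreal_mult'[symmetric], simp) (simp only:)
        show "?h t r = ennreal (?w t) *
          (ennreal (2 * a * Beta (a + 1) a * t powr (2 * a) * r powr (- a) * (r - t) powr (- a - 1)) * indicator {s<..} r)"
          unfolding * using True by (simp add: mult.assoc)
      qed
      also have "\<dots> = ennreal (?w t) * (\<integral>\<^sup>+v. ennreal ((t - v) powr (a - 1) * v powr a * (s - v) powr (- 2 * a)) * indicator {0<..<t} v \<partial>lborel)"
        by (subst nn_integral_cmult, simp) (simp only: kernel_tail_representation[OF a t])
      finally show ?thesis using True Bp by (simp add: distrib_left ennreal_mult' mult_ac)
    qed simp
  qed
  also have "\<dots> = (\<integral>\<^sup>+t. ennreal (Beta (1 - a) a * ?w t) * indicator {u<..<s} t \<partial>lborel) +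
      (\<integral>\<^sup>+t. \<integral>\<^sup>+r. ?h t r \<partial>lborel \<partial>lborel)"
    by (intro nn_integral_add) auto
  also have "(\<integral>\<^sup>+t. \<integral>\<^sup>+r. ?h t r \<partial>lborel \<partial>lborel) = (\<integral>\<^sup>+r. \<integral>\<^sup>+t. ?h t r \<partial>lborel \<partial>lborel)"
    by (rule nn_integral_Fubini_lborel) measurable
  also have "\<dots> = (\<integral>\<^sup>+r. ennreal (?C * r powr (- a) * ((s - u) powr a * (r - s) powr (- a) / (r - u))) * indicator {s<..} r \<partial>lborel)"
  proof (rule nn_integral_cong)
    fix r :: real
    show "(\<integral>\<^sup>+t. ?h t r \<partial>lborel) = ennreal (?C * r powr (- a) * ((s - u) powr a * (r - s) powr (- a) / (r - u))) * indicator {s<..} r"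
    proof (cases "r \<in> {s<..}")
      case True
      then have "(\<integral>\<^sup>+t. ?h t r \<partial>lborel) = (\<integral>\<^sup>+t. ennreal (a * ?C * r powr (- a)) *
          (ennreal ((t - u) powr (a - 1) * (r - t) powr (- a - 1)) * indicator {u<..<s} t) \<partial>lborel)"
        using a Bp by (intro nn_integral_cong) (auto simp flip: ennreal_mult' split: split_indicator)
      also have "\<dots> = ennreal (a * ?C * r powr (- a)) * ennreal ((s - u) powr a * (r - s) powr (- a) / (a * (r - u)))"
        using True u a by (subst nn_integral_cmult) (auto simp: nn_integral_two_points)
      also have "\<dots> = ennreal (?C * r powr (- a) * ((s - u) powr a * (r - s) powr (- a) / (r - u)))"
        using a Bp True u by (subst ennreal_mult'[symmetric]) (auto simp: field_simps)
      finally show ?thesis using True by simp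
    qed simp
  qed
  \<comment> \<open>The substitution r = s + (s - u) y produces the first term of
    \<open>Beta_expansion\<close>.\<close>
  also have "\<dots> = ennreal (s - u) * (\<integral>\<^sup>+y. ennreal (?C * (s + (s - u) * y) powr (- a) *
      ((s - u) powr a * (s + (s - u) * y - s) powr (- a) / (s + (s - u) * y - u))) * indicator {s<..} (s + (s - u) * y) \<partial>lborel)"
    using u by (subst nn_integral_real_affine[where c = "s - u" and t = s]) auto
  also have "\<dots> = (\<integral>\<^sup>+y. ennreal (s - u) * (ennreal (?C * (s + (s - u) * y) powr (- a) *
      ((s - u) powr a * (s + (s - u) * y - s) powr (- a) / (s + (s - u) * y - u))) * indicator {s<..} (s + (s - u) * y)) \<partial>lborel)"
    by (subst nn_integral_cmult) auto
  also have "\<dots> = (\<integral>\<^sup>+y. ennreal ?C * (ennreal ((s + (s - u) * y) powr (- a) * y powr (- a) / (1 + y)) * indicator {0<..} y) \<partial>lborel)"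
  proof (rule nn_integral_cong)
    fix y :: real
    show "ennreal (s - u) * (ennreal (?C * (s + (s - u) * y) powr (- a) *
      ((s - u) powr a * (s + (s - u) * y - s) powr (- a) / (s + (s - u) * y - u))) * indicator {s<..} (s + (s - u) * y))
      = ennreal ?C * (ennreal ((s + (s - u) * y) powr (- a) * y powr (- a) / (1 + y)) * indicator {0<..} y)"
    proof (cases "y > 0")
      case True
      have "s + (s - u) * y - u = (s - u) * (1 + y)" by (simp add: algebra_simps)
      moreover have "(s - u) powr a * ((s - u) * y) powr (- a) = y powr (- a)"
        using u True by (simp add: powr_mult powr_minus)
      ultimately have "(s - u) * (?C * (s + (s - u) * y) powr (- a) *
        ((s - u) powr a * (s + (s - u) * y - s) powr (- a) / (s + (s - u) * y - u)))
        = ?C * ((s + (s - u) * y) powr (- a) * y powr (- a) / (1 + y))"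
        using u True by simp
      then have "ennreal (s - u) * ennreal (?C * (s + (s - u) * y) powr (- a) *
          ((s - u) powr a * (s + (s - u) * y - s) powr (- a) / (s + (s - u) * y - u)))
        = ennreal ?C * ennreal ((s + (s - u) * y) powr (- a) * y powr (- a) / (1 + y))"
        using u Bp by (simp flip: ennreal_mult')
      then show ?thesis using True u by (simp add: mult.assoc)
    next
      case False
      then show ?thesis using u by (simp add: mult_nonneg_nonpos indicator_def zero_less_mult_iff)
    qed
  qed
  also have "\<dots> = ennreal ?C * (\<integral>\<^sup>+y. ennreal ((s + (s - u) * y) powr (- a) * y powr (- a) / (1 + y)) * indicator {0<..} y \<partial>lborel)"
    by (subst nn_integral_cmult) auto
  \<comment> \<open>By \<open>prod\<close>, the constant term is the second term of
    \<open>Beta_expansion\<close> times the same \<open>?C\<close>.\<close>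
  also have "(\<integral>\<^sup>+t. ennreal (Beta (1 - a) a * ?w t) * indicator {u<..<s} t \<partial>lborel) =
     (\<integral>\<^sup>+t. ennreal ?C * (ennreal (a * Beta (1 - a) (2 * a) * (t - u) powr (a - 1) * t powr (- 2 * a)) * indicator {u<..<s} t) \<partial>lborel)"
  proof (rule nn_integral_cong)
    fix t
    have "Beta (1 - a) a * ?w t = ?C * (a * Beta (1 - a) (2 * a) * (t - u) powr (a - 1) * t powr (- 2 * a))"
      unfolding prod[symmetric] by (simp add: mult_ac)
    then have "ennreal (Beta (1 - a) a * ?w t) =
      ennreal ?C * ennreal (a * Beta (1 - a) (2 * a) * (t - u) powr (a - 1) * t powr (- 2 * a))"
      using Bp by (subst ennreal_mult'[symmetric], simp) (simp only:)
    then show "ennreal (Beta (1 - a) a * ?w t) * indicator {u<..<s} t =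
      ennreal ?C * (ennreal (a * Beta (1 - a) (2 * a) * (t - u) powr (a - 1) * t powr (- 2 * a)) * indicator {u<..<s} t)"
      by (simp only: mult.assoc)
  qed
  also have "\<dots> = ennreal ?C * (\<integral>\<^sup>+t. ennreal (a * Beta (1 - a) (2 * a) * (t - u) powr (a - 1) * t powr (- 2 * a)) * indicator {u<..<s} t \<partial>lborel)"
    by (subst nn_integral_cmult) auto
  also have "\<dots> + ennreal ?C * (\<integral>\<^sup>+y. ennreal ((s + (s - u) * y) powr (- a) * y powr (- a) / (1 + y)) * indicator {0<..} y \<partial>lborel)
     = ennreal ?C * ennreal (u powr (- a) * Beta (1 - a) a)"
    unfolding Beta_expansion[OF a u] by (simp add: distrib_left add.commute)
  also have "\<dots> = ennreal (?C * Beta (1 - a) a * u powr (- a))"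
    using Bp by (subst ennreal_mult'[symmetric]) (auto simp: mult_ac)
  finally show ?thesis .
qed

section \<open>The Molchan--Golosov kernel\<close>

text \<open>Extended by 0 outside the triangle 0 < u < t, so that later integrals run over the whole
  line.\<close>

definition K0_kernel :: "real \<Rightarrow> real \<Rightarrow> real \<Rightarrow> real" where
  "K0_kernel H t u = (if 0 < u \<and> u < t
     then inverse (C1 H) / Gamma (1/2 - H) * t powr (H - 1/2) * ((t - u) powr (- 1/2 - H) * u powr (1/2 - H)) else 0)"

text \<open>The derivative in \<open>u\<close> of the covariance of fractional Brownian motion at
  the times \<open>u\<close> and \<open>s\<close>, cut off at \<open>s\<close>.\<close>

definition cov_deriv :: "real \<Rightarrow> real \<Rightarrow> real \<Rightarrow> real" where
  "cov_deriv H s u = (if 0 < u \<and> u < s then H * (u powr (2 * H - 1) + (s - u) powr (2 * H - 1)) else 0)"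

text \<open>A nonnegative integral, hence measurable and open to Tonelli at once. By
  \<open>K0_cov_deriv_integral\<close> it is finite on (0, s), so \<open>enn2real\<close> loses
  nothing there.\<close>

definition MG_kernel :: "real \<Rightarrow> real \<Rightarrow> real \<Rightarrow> real" where
  "MG_kernel H s t = (if 0 < t \<and> t < s then enn2real (\<integral>\<^sup>+u. ennreal (K0_kernel H t u * cov_deriv H s u) \<partial>lborel) else 0)"

lemma K0_kernel_measurable [measurable (raw)]:
  assumes [measurable]: "f \<in> borel_measurable M" "g \<in> borel_measurable M"
  shows "(\<lambda>x. K0_kernel H (f x) (g x)) \<in> borel_measurable M"
  unfolding K0_kernel_def by measurable

lemma cov_deriv_measurable [measurable (raw)]:
  assumes [measurable]: "f \<in> borel_measurable M" "g \<in> borel_measurable M"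
  shows "(\<lambda>x. cov_deriv H (f x) (g x)) \<in> borel_measurable M"
  unfolding cov_deriv_def by measurable

lemma MG_kernel_measurable [measurable]: "MG_kernel H s \<in> borel_measurable borel"
  unfolding MG_kernel_def[abs_def] by measurable

context
  fixes H :: real
  assumes H: "0 < H" "H < 1/2"
begin

lemma C1_pos: "C1 H > 0"
  unfolding C1_def using H by (auto intro!: divide_pos_pos mult_pos_pos)

lemma K0_kernel_nonneg: "K0_kernel H t u \<ge> 0"
  unfolding K0_kernel_def using H C1_pos by (auto intro!: divide_nonneg_nonneg less_imp_le[OF Gamma_real_pos])

lemma cov_deriv_nonneg: "cov_deriv H t u \<ge> 0"
  unfolding cov_deriv_def using H by auto

lemma MG_kernel_nonneg: "MG_kernel H s t \<ge> 0"
  unfolding MG_kernel_def by auto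

text \<open>The place where the value of \<open>C1\<close> matters: with a = 1/2 - H its square is
  \<open>2 * H * Gamma (1 - a) * Gamma (1 + a) / Gamma (1 + 2 * a)\<close>, which normalises the
  constant produced by \<open>kernel_adjoint_identity\<close>.\<close>

lemma K0_constant:
  "(inverse (C1 H) / Gamma (1/2 - H))\<^sup>2 * H * (2 * Beta (1/2 - H + 1) (1/2 - H) * Beta (1 - (1/2 - H)) (1/2 - H)) = 1"
proof -
  define a where "a = 1/2 - H"
  have a: "0 < a" "a < 1/2" and Ha: "H = 1/2 - a" using H by (auto simp: a_def)
  have g: "Gamma a > 0" "Gamma (1 + a) > 0" "Gamma (1 - a) > 0" "Gamma (1 + 2 * a) > 0" using a by auto
  have "(C1 H)\<^sup>2 = 2 * H * Gamma (H + 1/2) * Gamma (3/2 - H) / Gamma (2 - 2 * H)"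
    unfolding C1_def using H
    by (intro real_sqrt_pow2 divide_nonneg_nonneg mult_nonneg_nonneg less_imp_le[OF Gamma_real_pos]) auto
  moreover have "H + 1/2 = 1 - a" "3/2 - H = 1 + a" "2 - 2 * H = 1 + 2 * a" using Ha by auto
  ultimately have C: "(C1 H)\<^sup>2 = 2 * H * Gamma (1 - a) * Gamma (1 + a) / Gamma (1 + 2 * a)" by simp
  have e: "a + 1 + a = 1 + 2 * a" "1 - a + a = 1" "a + 1 = 1 + a" by auto
  have "(inverse (C1 H) / Gamma a)\<^sup>2 * H * (2 * Beta (a + 1) a * Beta (1 - a) a)
     = H * (2 * Beta (a + 1) a * Beta (1 - a) a) / ((C1 H)\<^sup>2 * (Gamma a)\<^sup>2)"
    by (simp add: field_simps)
  also have "\<dots> = 1"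
    unfolding C Beta_def e using g H a by (simp add: field_simps power2_eq_square less_imp_neq[symmetric])
  finally show ?thesis by (simp add: a_def)
qed

text \<open>The two summands of \<open>cov_deriv\<close> are integrated separately. With a = 1/2 - H
  the first gives a Beta integral independent of \<open>t\<close>, since its exponents
  \<open>- a\<close> and \<open>a - 1\<close> add up to -1; the second is finite because
  \<open>s - v\<close> stays above \<open>s - t\<close>.\<close>

lemma K0_cov_deriv_integral:
  assumes t: "0 < t" "t < s"
  shows "(\<integral>\<^sup>+u. ennreal (K0_kernel H t u * cov_deriv H s u) \<partial>lborel) =
    ennreal (inverse (C1 H) / Gamma (1/2 - H) * H * t powr (H - 1/2)) * (ennreal (Beta (1 - (1/2 - H)) (1/2 - H)) +
      (\<integral>\<^sup>+v. ennreal ((t - v) powr (1/2 - H - 1) * v powr (1/2 - H) * (s - v) powr (- 2 * (1/2 - H))) * indicator {0<..<t} v \<partial>lborel))"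
    (is "?l = ennreal ?c * (_ + ?G)")
    and "(\<integral>\<^sup>+u. ennreal (K0_kernel H t u * cov_deriv H s u) \<partial>lborel) < \<infinity>"
proof -
  define a where "a = 1/2 - H"
  have a: "0 < a" "a < 1/2" and Ha: "H = 1/2 - a" using H by (auto simp: a_def)
  have c: "?c \<ge> 0" using H C1_pos by (auto intro!: mult_nonneg_nonneg divide_nonneg_nonneg less_imp_le[OF Gamma_real_pos])
  have G: "?G = (\<integral>\<^sup>+v. ennreal ((t - v) powr (a - 1) * v powr a * (s - v) powr (- 2 * a)) * indicator {0<..<t} v \<partial>lborel)"
    by (simp add: a_def)
  have "?l = (\<integral>\<^sup>+v. ennreal ?c * (ennreal (v powr (1 - a - 1) * (t - v) powr (a - 1)) * indicator {0<..<t} v +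
      ennreal ((t - v) powr (a - 1) * v powr a * (s - v) powr (- 2 * a)) * indicator {0<..<t} v) \<partial>lborel)"
  proof (rule nn_integral_cong)
    fix v :: real
    show "ennreal (K0_kernel H t v * cov_deriv H s v) = ennreal ?c * (ennreal (v powr (1 - a - 1) * (t - v) powr (a - 1)) * indicator {0<..<t} v +
      ennreal ((t - v) powr (a - 1) * v powr a * (s - v) powr (- 2 * a)) * indicator {0<..<t} v)"
    proof (cases "0 < v \<and> v < t")
      case True
      have e: "- 1/2 - H = a - 1" "1/2 - H = a" "2 * H - 1 = - 2 * a" using Ha by auto
      have *: "v powr (1 - a - 1) = v powr a * v powr (- 2 * a)" using True by (simp flip: powr_add)
      have v: "0 < v" "v < t" "v < s" using True t by auto
      have "K0_kernel H t v * cov_deriv H s v = ?c * (v powr (1 - a - 1) * (t - v) powr (a - 1) + (t - v) powr (a - 1) * v powr a * (s - v) powr (- 2 * a))"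
        unfolding * by (simp only: K0_kernel_def cov_deriv_def e v simp_thms if_True) (simp add: algebra_simps add_divide_distrib)
      then have "ennreal (K0_kernel H t v * cov_deriv H s v) = ennreal ?c * (ennreal (v powr (1 - a - 1) * (t - v) powr (a - 1)) +
          ennreal ((t - v) powr (a - 1) * v powr a * (s - v) powr (- 2 * a)))"
        by (simp only:) (subst ennreal_mult'[OF c], subst ennreal_plus, auto)
      then show ?thesis using True by simp
    qed (auto simp: K0_kernel_def)
  qed
  also have "\<dots> = ennreal ?c * ((\<integral>\<^sup>+v. ennreal (v powr (1 - a - 1) * (t - v) powr (a - 1)) * indicator {0<..<t} v \<partial>lborel) + ?G)"
    unfolding G by (subst nn_integral_cmult, simp, subst nn_integral_add) auto
  also have "(\<integral>\<^sup>+v. ennreal (v powr (1 - a - 1) * (t - v) powr (a - 1)) * indicator {0<..<t} v \<partial>lborel) = ennreal (Beta (1 - a) a)"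
    using a t by (subst nn_integral_Beta_interval) auto
  finally show 1: "?l = ennreal ?c * (ennreal (Beta (1 - (1/2 - H)) (1/2 - H)) + ?G)" by (simp add: a_def)
  have "?G \<le> (\<integral>\<^sup>+v. ennreal ((s - t) powr (- 2 * a)) * (ennreal (v powr (a + 1 - 1) * (t - v) powr (a - 1)) * indicator {0<..<t} v) \<partial>lborel)"
    unfolding G
  proof (intro nn_integral_mono)
    fix v :: real
    have "(t - v) powr (a - 1) * v powr a * (s - v) powr (- 2 * a) \<le> (s - t) powr (- 2 * a) * (v powr (a + 1 - 1) * (t - v) powr (a - 1))"
      if "0 < v" "v < t"
    proof -
      have "(s - v) powr (- 2 * a) \<le> (s - t) powr (- 2 * a)" using that a t by (intro powr_mono2') auto
      then have "(v powr a * (t - v) powr (a - 1)) * (s - v) powr (- 2 * a) \<le> (v powr a * (t - v) powr (a - 1)) * (s - t) powr (- 2 * a)"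
        by (intro mult_left_mono) auto
      then show ?thesis by (simp add: mult_ac)
    qed
    then show "ennreal ((t - v) powr (a - 1) * v powr a * (s - v) powr (- 2 * a)) * indicator {0<..<t} v \<le>
      ennreal ((s - t) powr (- 2 * a)) * (ennreal (v powr (a + 1 - 1) * (t - v) powr (a - 1)) * indicator {0<..<t} v)"
      by (auto split: split_indicator simp flip: ennreal_mult' intro!: ennreal_leI)
  qed
  also have "\<dots> = ennreal ((s - t) powr (- 2 * a)) * ennreal (t powr (a + 1 + a - 1) * Beta (a + 1) a)"
    using a t by (subst nn_integral_cmult, simp, subst nn_integral_Beta_interval) auto
  also have "\<dots> < \<infinity>" by (simp add: ennreal_mult_less_top)
  finally have "?G < \<infinity>" .
  then show "?l < \<infinity>" unfolding 1 by (auto simp: ennreal_mult_less_top)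
qed

lemma MG_kernel_eq:
  assumes "0 < t" "t < s"
  shows "ennreal (MG_kernel H s t) = (\<integral>\<^sup>+u. ennreal (K0_kernel H t u * cov_deriv H s u) \<partial>lborel)"
  using assms K0_cov_deriv_integral(2)[OF assms] by (simp add: MG_kernel_def)

text \<open>Each of the two kernels contributes a factor \<open>t powr (- a)\<close>, which gives
  the integrand of \<open>kernel_adjoint_identity\<close>. The remaining \<open>u powr a\<close>
  cancels the \<open>u powr (- a)\<close> on its right-hand side, and \<open>K0_constant\<close>
  takes care of the constant.\<close>

lemma MG_kernel_adjoint:
  assumes u: "0 < u" "u < s"
  shows "(\<integral>\<^sup>+t. ennreal (K0_kernel H t u * MG_kernel H s t) \<partial>lborel) = 1"
proof -
  define a where "a = 1/2 - H"
  have a: "0 < a" "a < 1/2" and Ha: "H = 1/2 - a" using H by (auto simp: a_def)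
  define c where "c = inverse (C1 H) / Gamma a"
  have c: "c \<ge> 0" using H C1_pos a by (auto intro!: divide_nonneg_nonneg simp: c_def)
  let ?D = "2 * Beta (a + 1) a * Beta (1 - a) a * u powr (- a)"
  let ?R = "\<lambda>t. ennreal (Beta (1 - a) a) +
      (\<integral>\<^sup>+v. ennreal ((t - v) powr (a - 1) * v powr a * (s - v) powr (- 2 * a)) * indicator {0<..<t} v \<partial>lborel)"
  have "(\<integral>\<^sup>+t. ennreal (K0_kernel H t u * MG_kernel H s t) \<partial>lborel) =
    (\<integral>\<^sup>+t. ennreal (c\<^sup>2 * H * u powr a) * (ennreal ((t - u) powr (a - 1) * t powr (- 2 * a)) * ?R t * indicator {u<..<s} t) \<partial>lborel)"
  proof (rule nn_integral_cong)
    fix t :: real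
    show "ennreal (K0_kernel H t u * MG_kernel H s t) =
      ennreal (c\<^sup>2 * H * u powr a) * (ennreal ((t - u) powr (a - 1) * t powr (- 2 * a)) * ?R t * indicator {u<..<s} t)"
    proof (cases "u < t \<and> t < s")
      case True
      then have t: "0 < t" "t < s" using u by auto
      have e: "- 1/2 - H = a - 1" "1/2 - H = a" "H - 1/2 = - a" using Ha by auto
      have **: "t powr (- 2 * a) = t powr (- a) * t powr (- a)" by (simp flip: powr_add)
      have *: "K0_kernel H t u * (c * H * t powr (- a)) = c\<^sup>2 * H * u powr a * ((t - u) powr (a - 1) * t powr (- 2 * a))"
        using True u unfolding K0_kernel_def e c_def[symmetric] ** by (simp add: power2_eq_square)
      have "ennreal (MG_kernel H s t) = ennreal (c * H * t powr (- a)) * ?R t"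
        unfolding MG_kernel_eq[OF t] K0_cov_deriv_integral(1)[OF t] by (simp add: e c_def)
      then have "ennreal (K0_kernel H t u * MG_kernel H s t) = ennreal (K0_kernel H t u) * (ennreal (c * H * t powr (- a)) * ?R t)"
        by (simp only: ennreal_mult'[OF K0_kernel_nonneg])
      also have "\<dots> = ennreal (K0_kernel H t u * (c * H * t powr (- a))) * ?R t"
        by (simp add: ennreal_mult'[OF K0_kernel_nonneg] mult.assoc)
      also have "\<dots> = ennreal (c\<^sup>2 * H * u powr a) * (ennreal ((t - u) powr (a - 1) * t powr (- 2 * a)) * ?R t)"
        unfolding * using H by (subst ennreal_mult') (auto simp: mult.assoc)
      finally show ?thesis using True by simp
    qed (use u in \<open>auto simp: K0_kernel_def MG_kernel_def\<close>)
  qed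
  also have "\<dots> = ennreal (c\<^sup>2 * H * u powr a) * ennreal ?D"
  proof -
    have 1: "(\<lambda>t. ennreal ((t - u) powr (a - 1) * t powr (- 2 * a))) \<in> borel_measurable lborel"
      by measurable
    have 2: "?R \<in> borel_measurable lborel"
      unfolding indicator_def greaterThanLessThan_iff by measurable
    have 3: "(\<lambda>t. indicator {u<..<s} t :: ennreal) \<in> borel_measurable lborel"
      by simp
    show ?thesis
      by (simp only: nn_integral_cmult[OF borel_measurable_times_ennreal[OF borel_measurable_times_ennreal[OF 1 2] 3]]
        kernel_adjoint_identity[OF a u])
  qed
  also have "\<dots> = ennreal (c\<^sup>2 * H * u powr a * ?D)"
    using H by (intro ennreal_mult'[symmetric] mult_nonneg_nonneg) auto
  also have "c\<^sup>2 * H * u powr a * ?D = (c\<^sup>2 * H * (2 * Beta (a + 1) a * Beta (1 - a) a)) * (u powr a * u powr (- a))"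
    by (simp add: mult_ac)
  also have "\<dots> = 1"
    using K0_constant u unfolding a_def[symmetric] c_def[symmetric] by (simp add: powr_minus)
  finally show ?thesis by simp
qed

text \<open>Tonelli and \<open>MG_kernel_adjoint\<close>. Applied to \<open>cov_deriv\<close> it
  yields the covariance; applied to an absolute value it yields the integrability behind Fubini in
  \<open>MG_kernel_reproducing\<close>.\<close>

lemma nn_integral_MG_kernel_K0:
  assumes [measurable]: "\<phi> \<in> borel_measurable borel" and "\<And>u. \<phi> u \<ge> 0"
  shows "(\<integral>\<^sup>+x. \<integral>\<^sup>+u. ennreal (MG_kernel H s x * K0_kernel H x u * \<phi> u) \<partial>lborel \<partial>lborel)
    = (\<integral>\<^sup>+u. ennreal (\<phi> u) * indicator {0<..<s} u \<partial>lborel)"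
proof -
  have "(\<integral>\<^sup>+x. \<integral>\<^sup>+u. ennreal (MG_kernel H s x * K0_kernel H x u * \<phi> u) \<partial>lborel \<partial>lborel)
    = (\<integral>\<^sup>+u. \<integral>\<^sup>+x. ennreal (MG_kernel H s x * K0_kernel H x u * \<phi> u) \<partial>lborel \<partial>lborel)"
    by (rule nn_integral_Fubini_lborel) measurable
  also have "\<dots> = (\<integral>\<^sup>+u. ennreal (\<phi> u) * indicator {0<..<s} u \<partial>lborel)"
  proof (rule nn_integral_cong)
    fix u :: real
    have "(\<integral>\<^sup>+x. ennreal (MG_kernel H s x * K0_kernel H x u * \<phi> u) \<partial>lborel) =
      (\<integral>\<^sup>+x. ennreal (\<phi> u) * ennreal (K0_kernel H x u * MG_kernel H s x) \<partial>lborel)"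
      using assms(2)[of u] by (intro nn_integral_cong) (simp add: mult_ac flip: ennreal_mult')
    also have "\<dots> = ennreal (\<phi> u) * (\<integral>\<^sup>+x. ennreal (K0_kernel H x u * MG_kernel H s x) \<partial>lborel)"
      by (subst nn_integral_cmult) auto
    also have "(\<integral>\<^sup>+x. ennreal (K0_kernel H x u * MG_kernel H s x) \<partial>lborel) = indicator {0<..<s} u"
    proof (cases "0 < u \<and> u < s")
      case False
      then have "K0_kernel H x u * MG_kernel H s x = 0" for x by (auto simp: K0_kernel_def MG_kernel_def)
      then show ?thesis using False by (simp only:) simp
    qed (simp add: MG_kernel_adjoint)
    finally show "(\<integral>\<^sup>+x. ennreal (MG_kernel H s x * K0_kernel H x u * \<phi> u) \<partial>lborel) = ennreal (\<phi> u) * indicator {0<..<s} u" .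
  qed
  finally show ?thesis .
qed

text \<open>Only the kernel of the later time \<open>t\<close> is expanded, which is possible on (0,
  s) because \<open>s\<close> is at most \<open>t\<close>. The adjoint identity then leaves the
  integral of \<open>cov_deriv H t\<close> from 0 to \<open>s\<close>, that is, an increment of the
  covariance.\<close>

lemma nn_integral_MG_kernel_product:
  assumes s: "0 < s" "s \<le> t"
  shows "(\<integral>\<^sup>+x. ennreal (MG_kernel H s x * MG_kernel H t x) \<partial>lborel) =
    ennreal ((1/2) * (t powr (2 * H) + s powr (2 * H) - \<bar>t - s\<bar> powr (2 * H)))"
proof -
  have "(\<integral>\<^sup>+x. ennreal (MG_kernel H s x * MG_kernel H t x) \<partial>lborel) =
    (\<integral>\<^sup>+x. \<integral>\<^sup>+u. ennreal (MG_kernel H s x * K0_kernel H x u * cov_deriv H t u) \<partial>lborel \<partial>lborel)"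
  proof (rule nn_integral_cong)
    fix x
    show "ennreal (MG_kernel H s x * MG_kernel H t x) = (\<integral>\<^sup>+u. ennreal (MG_kernel H s x * K0_kernel H x u * cov_deriv H t u) \<partial>lborel)"
    proof (cases "0 < x \<and> x < s")
      case True
      then show ?thesis using s
        by (simp add: ennreal_mult'[OF MG_kernel_nonneg] mult.assoc MG_kernel_eq nn_integral_cmult)
    next
      case False
      then have "MG_kernel H s x = 0" by (auto simp: MG_kernel_def)
      then show ?thesis by simp
    qed
  qed
  also have "\<dots> = (\<integral>\<^sup>+u. ennreal (cov_deriv H t u) * indicator {0<..<s} u \<partial>lborel)"
    by (rule nn_integral_MG_kernel_K0) (auto simp: cov_deriv_nonneg)
  also have "\<dots> = (\<integral>\<^sup>+u. ennreal (H * (u powr (2 * H - 1) + (t - u) powr (2 * H - 1))) * indicator {0<..<s} u \<partial>lborel)"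
    using s by (intro nn_integral_cong) (auto simp: cov_deriv_def split: split_indicator)
  also have "\<dots> = ennreal ((1/2) * (s powr (2 * H) - (t - s) powr (2 * H)) - (1/2) * (0 powr (2 * H) - (t - 0) powr (2 * H)))"
  proof (rule nn_integral_FTC_Ioo)
    show "continuous_on {0..s} (\<lambda>u. (1/2) * (u powr (2 * H) - (t - u) powr (2 * H)))"
      using H s by (intro continuous_intros continuous_on_powr') auto
    show "((\<lambda>u. (1/2) * (u powr (2 * H) - (t - u) powr (2 * H))) has_real_derivative H * (u powr (2 * H - 1) + (t - u) powr (2 * H - 1))) (at u)"
      if "u \<in> {0<..<s}" for u
      using that s H by (auto intro!: derivative_eq_intros simp: algebra_simps)
  qed (use H s in auto)
  also have "\<dots> = ennreal ((1/2) * (t powr (2 * H) + s powr (2 * H) - \<bar>t - s\<bar> powr (2 * H)))"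
    using s H by (simp add: field_simps)
  finally show ?thesis .
qed

end

section \<open>Square-integrable trends\<close>

lemma integrable_mult_L2:
  fixes f g :: "'b \<Rightarrow> real"
  assumes [measurable]: "f \<in> borel_measurable M" "g \<in> borel_measurable M"
    and "integrable M (\<lambda>x. (f x)\<^sup>2)" "integrable M (\<lambda>x. (g x)\<^sup>2)"
  shows "integrable M (\<lambda>x. f x * g x)"
proof (rule Bochner_Integration.integrable_bound)
  show "integrable M (\<lambda>x. (f x)\<^sup>2 + (g x)\<^sup>2)" using assms by auto
  have "\<bar>f x * g x\<bar> \<le> (f x)\<^sup>2 + (g x)\<^sup>2" for x
    using sum_squares_bound[of "\<bar>f x\<bar>" "\<bar>g x\<bar>"] mult_nonneg_nonneg[of "\<bar>f x\<bar>" "\<bar>g x\<bar>"] unfolding abs_mult power2_abs by linarith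
  then show "AE x in M. norm (f x * g x) \<le> norm ((f x)\<^sup>2 + (g x)\<^sup>2)" by simp
qed simp

lemma Cauchy_Schwarz_integral:
  fixes f g :: "'b \<Rightarrow> real"
  assumes [measurable]: "f \<in> borel_measurable M" "g \<in> borel_measurable M"
    and f: "integrable M (\<lambda>x. (f x)\<^sup>2)" and g: "integrable M (\<lambda>x. (g x)\<^sup>2)"
  shows "(\<integral>x. f x * g x \<partial>M)\<^sup>2 \<le> (\<integral>x. (f x)\<^sup>2 \<partial>M) * (\<integral>x. (g x)\<^sup>2 \<partial>M)"
proof -
  have i: "integrable M (\<lambda>x. \<bar>f x * g x\<bar>)"
    using integrable_mult_L2[OF assms] by auto
  have "ennreal ((\<integral>x. \<bar>f x * g x\<bar> \<partial>M)\<^sup>2) = (\<integral>\<^sup>+x. ennreal \<bar>f x\<bar> * ennreal \<bar>g x\<bar> \<partial>M)\<^sup>2"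
    using i by (simp add: nn_integral_eq_integral abs_mult flip: ennreal_power ennreal_mult')
  also have "\<dots> \<le> (\<integral>\<^sup>+x. (ennreal \<bar>f x\<bar>)\<^sup>2 \<partial>M) * (\<integral>\<^sup>+x. (ennreal \<bar>g x\<bar>)\<^sup>2 \<partial>M)"
    by (rule Cauchy_Schwarz_nn_integral) auto
  also have "\<dots> = ennreal ((\<integral>x. (f x)\<^sup>2 \<partial>M) * (\<integral>x. (g x)\<^sup>2 \<partial>M))"
    using f g by (simp add: ennreal_power nn_integral_eq_integral flip: ennreal_mult')
  finally have "(\<integral>x. \<bar>f x * g x\<bar> \<partial>M)\<^sup>2 \<le> (\<integral>x. (f x)\<^sup>2 \<partial>M) * (\<integral>x. (g x)\<^sup>2 \<partial>M)"
    by (simp add: ennreal_le_iff)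
  moreover have "(\<integral>x. f x * g x \<partial>M)\<^sup>2 \<le> (\<integral>x. \<bar>f x * g x\<bar> \<partial>M)\<^sup>2"
    using integral_norm_bound[of M "\<lambda>x. f x * g x"] by (intro power2_le_iff_abs_le[THEN iffD2]) auto
  ultimately show ?thesis by linarith
qed

text \<open>With P the combination of the functions \<open>p t\<close> with coefficients
  \<open>a t\<close>, the left side is the square of the inner product of \<open>h\<close> and P,
  and the double sum is the squared norm of P because \<open>R\<close> is a Gram matrix.\<close>

lemma quadratic_form_bound:
  fixes h :: "'b \<Rightarrow> real" and p :: "'t \<Rightarrow> 'b \<Rightarrow> real"
  assumes S: "finite S" and [measurable]: "h \<in> borel_measurable M" "\<And>t. t \<in> S \<Longrightarrow> p t \<in> borel_measurable M"
    and h: "integrable M (\<lambda>x. (h x)\<^sup>2)" and p: "\<And>t. t \<in> S \<Longrightarrow> integrable M (\<lambda>x. (p t x)\<^sup>2)"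
    and g: "\<And>t. t \<in> S \<Longrightarrow> g t = (\<integral>x. h x * p t x \<partial>M)"
    and R: "\<And>s t. s \<in> S \<Longrightarrow> t \<in> S \<Longrightarrow> R s t = (\<integral>x. p s x * p t x \<partial>M)"
  shows "(\<Sum>t\<in>S. a t * g t)\<^sup>2 \<le> (\<integral>x. (h x)\<^sup>2 \<partial>M) * (\<Sum>s\<in>S. \<Sum>t\<in>S. a s * a t * R s t)"
proof -
  let ?P = "\<lambda>x. \<Sum>t\<in>S. a t * p t x"
  have P2: "(?P x)\<^sup>2 = (\<Sum>s\<in>S. \<Sum>t\<in>S. a s * a t * (p s x * p t x))" for x
    unfolding power2_eq_square sum_product by (intro sum.cong) (auto simp: mult_ac)
  have int: "integrable M (\<lambda>x. p s x * p t x)" if "s \<in> S" "t \<in> S" for s t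
    using that p by (intro integrable_mult_L2) auto
  have inth: "integrable M (\<lambda>x. h x * p t x)" if "t \<in> S" for t
    using that p h by (intro integrable_mult_L2) auto
  have "(\<Sum>t\<in>S. a t * g t) = (\<Sum>t\<in>S. \<integral>x. a t * (h x * p t x) \<partial>M)"
    using inth by (intro sum.cong) (auto simp: g)
  also have "\<dots> = (\<integral>x. h x * ?P x \<partial>M)"
    using inth by (subst Bochner_Integration.integral_sum[symmetric]) (auto simp: sum_distrib_left mult_ac)
  finally have "(\<Sum>t\<in>S. a t * g t)\<^sup>2 \<le> (\<integral>x. (h x)\<^sup>2 \<partial>M) * (\<integral>x. (?P x)\<^sup>2 \<partial>M)"
    using Cauchy_Schwarz_integral[of h M ?P] h int unfolding P2 by auto
  also have "(\<integral>x. (?P x)\<^sup>2 \<partial>M) = (\<Sum>s\<in>S. \<Sum>t\<in>S. a s * a t * R s t)"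
    unfolding P2 using int by (subst Bochner_Integration.integral_sum; auto simp: R)
  finally show ?thesis .
qed

lemma integrable_of_L2:
  fixes f :: "real \<Rightarrow> real"
  assumes [measurable]: "f \<in> borel_measurable borel" and "integrable lborel (\<lambda>x. (f x)\<^sup>2)"
    and "\<And>x. x \<notin> {0..T} \<Longrightarrow> f x = 0"
  shows "integrable lborel f"
proof -
  have "integrable lborel (\<lambda>x. f x * indicator {0..T} x)"
  proof (rule integrable_mult_L2)
    have "(\<lambda>x. (indicator {0..T} x)\<^sup>2) = (indicator {0..T} :: real \<Rightarrow> real)"
      by (auto simp: indicator_def)
    then show "integrable lborel (\<lambda>x. (indicator {0..T} x :: real)\<^sup>2)"
      by (simp add: integrable_indicator_iff emeasure_lborel_Icc_eq)
  qed (use assms(2) in auto)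
  also have "(\<lambda>x. f x * indicator {0..T} x) = f"
    using assms(3) by (auto simp: fun_eq_iff split: split_indicator)
  finally show ?thesis .
qed

section \<open>Boundedness in L2 and duality for the operator and its kernel\<close>

context
  fixes H :: real
  assumes H: "0 < H" "H < 1/2"
begin

text \<open>The two conditions of Schur's test. For u < x and a = 1/2 - H the factor
  \<open>x powr (- a) * u powr a\<close> is at most 1, so the kernel is dominated by
  \<open>c * (x - u) powr (a - 1)\<close>, whose integral over distances up to \<open>T\<close> is
  \<open>c * T powr a / a\<close>, the witness for \<kappa>.\<close>

lemma K0_kernel_mass:
  assumes T: "0 < T"
  obtains \<kappa> where "\<kappa> \<ge> 0"
    "\<And>x. x \<le> T \<Longrightarrow> (\<integral>\<^sup>+u. ennreal (K0_kernel H x u) \<partial>lborel) \<le> ennreal \<kappa>"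
    "\<And>u. (\<integral>\<^sup>+x. ennreal (K0_kernel H x u) * indicator {0..T} x \<partial>lborel) \<le> ennreal \<kappa>"
proof -
  define a where "a = 1/2 - H"
  have a: "0 < a" "a < 1/2" and Ha: "H = 1/2 - a" using H by (auto simp: a_def)
  define c where "c = inverse (C1 H) / Gamma a"
  have c: "c \<ge> 0" using C1_pos[OF H] a by (auto intro!: divide_nonneg_nonneg simp: c_def)
  have le: "K0_kernel H x u \<le> c * (x - u) powr (a - 1)" if "0 < u" "u < x" for x u
  proof -
    have e: "- 1/2 - H = a - 1" "1/2 - H = a" "H - 1/2 = - a" using Ha by auto
    have "x powr (- a) * u powr a \<le> x powr (- a) * x powr a"
      using that a by (intro mult_left_mono powr_mono2) auto
    also have "\<dots> = 1" using that by (simp add: powr_minus)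
    finally have "c * (x - u) powr (a - 1) * (x powr (- a) * u powr a) \<le> c * (x - u) powr (a - 1) * 1"
      using c by (intro mult_left_mono) auto
    then show ?thesis using that unfolding K0_kernel_def e c_def by (simp add: mult_ac)
  qed
  have FTC: "(\<integral>\<^sup>+u. ennreal (c * (x - u) powr (a - 1)) * indicator {0<..<x} u \<partial>lborel) = ennreal (c * x powr a / a)"
    if "0 < x" for x
  proof -
    have "(\<integral>\<^sup>+u. ennreal (c * (x - u) powr (a - 1)) * indicator {0<..<x} u \<partial>lborel) =
      ennreal (- (c * (x - x) powr a / a) - (- (c * (x - 0) powr a / a)))"
      using a c that by (intro nn_integral_FTC_Ioo)
        (auto intro!: derivative_eq_intros continuous_intros continuous_on_powr')
    then show ?thesis by simp
  qed
  have FTC': "(\<integral>\<^sup>+x. ennreal (c * (x - u) powr (a - 1)) * indicator {u<..<T} x \<partial>lborel) = ennreal (c * (T - u) powr a / a)"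
    if "u < T" for u
  proof -
    have "(\<integral>\<^sup>+x. ennreal (c * (x - u) powr (a - 1)) * indicator {u<..<T} x \<partial>lborel) =
      ennreal (c * (T - u) powr a / a - (c * (u - u) powr a / a))"
      using a c that by (intro nn_integral_FTC_Ioo)
        (auto intro!: derivative_eq_intros continuous_intros continuous_on_powr')
    then show ?thesis by simp
  qed
  show ?thesis
  proof
    show "c * T powr a / a \<ge> 0" using c a by simp
    show "(\<integral>\<^sup>+u. ennreal (K0_kernel H x u) \<partial>lborel) \<le> ennreal (c * T powr a / a)" if "x \<le> T" for x
    proof (cases "x > 0")
      case True
      have "(\<integral>\<^sup>+u. ennreal (K0_kernel H x u) \<partial>lborel) \<le> (\<integral>\<^sup>+u. ennreal (c * (x - u) powr (a - 1)) * indicator {0<..<x} u \<partial>lborel)"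
        using le[of _ x] by (intro nn_integral_mono) (auto simp: K0_kernel_def[of H x] intro!: ennreal_leI split: split_indicator)
      also have "\<dots> \<le> ennreal (c * T powr a / a)"
        unfolding FTC[OF True] using True that c a by (intro ennreal_leI divide_right_mono mult_left_mono powr_mono2) auto
      finally show ?thesis .
    next
      case False
      then have "K0_kernel H x u = 0" for u by (auto simp: K0_kernel_def)
      then show ?thesis by simp
    qed
    show "(\<integral>\<^sup>+x. ennreal (K0_kernel H x u) * indicator {0..T} x \<partial>lborel) \<le> ennreal (c * T powr a / a)" for u
    proof (cases "0 < u \<and> u < T")
      case True
      have "(\<integral>\<^sup>+x. ennreal (K0_kernel H x u) * indicator {0..T} x \<partial>lborel) \<le>
          (\<integral>\<^sup>+x. ennreal (c * (x - u) powr (a - 1)) * indicator {u<..<T} x \<partial>lborel)"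
      proof (rule nn_integral_mono_AE)
        show "AE x in lborel. ennreal (K0_kernel H x u) * indicator {0..T} x \<le> ennreal (c * (x - u) powr (a - 1)) * indicator {u<..<T} x"
          using AE_lborel_singleton[of T]
        proof eventually_elim
          case (elim x)
          then show ?case using le[of u x] True
            by (auto simp: K0_kernel_def[of H x] intro!: ennreal_leI split: split_indicator)
        qed
      qed
      also have "\<dots> \<le> ennreal (c * T powr a / a)"
        using True c a by (subst FTC') (auto intro!: ennreal_leI divide_right_mono mult_left_mono powr_mono2)
      finally show ?thesis .
    next
      case False
      then have "ennreal (K0_kernel H x u) * indicator {0..T} x = 0" for x
        by (auto simp: K0_kernel_def split: split_indicator)
      then show ?thesis by (simp only:) simp
    qed
  qed
qed

text \<open>Schur's test: the kernel is split into two square roots in the Cauchy-Schwarz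
  inequality. Row masses bound one factor, and column masses the other after exchanging the
  integrals.\<close>

lemma K0_kernel_L2:
  fixes \<phi> :: "real \<Rightarrow> real"
  assumes T: "0 < T" and [measurable]: "\<phi> \<in> borel_measurable borel"
    and \<phi>2: "integrable lborel (\<lambda>x. (\<phi> x)\<^sup>2)"
  shows "integrable lborel (\<lambda>x. (indicator {0..T} x * (\<integral>u. K0_kernel H x u * \<phi> u \<partial>lborel))\<^sup>2)"
proof (rule integrableI_bounded)
  obtain \<kappa> where \<kappa>: "\<kappa> \<ge> 0"
    "\<And>x. x \<le> T \<Longrightarrow> (\<integral>\<^sup>+u. ennreal (K0_kernel H x u) \<partial>lborel) \<le> ennreal \<kappa>"
    "\<And>u. (\<integral>\<^sup>+x. ennreal (K0_kernel H x u) * indicator {0..T} x \<partial>lborel) \<le> ennreal \<kappa>"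
    using K0_kernel_mass[OF T] by blast
  note K = K0_kernel_nonneg[OF H]
  have b: "ennreal (norm ((indicator {0..T} x * (\<integral>u. K0_kernel H x u * \<phi> u \<partial>lborel))\<^sup>2)) \<le>
    ennreal \<kappa> * (\<integral>\<^sup>+u. ennreal (K0_kernel H x u * (\<phi> u)\<^sup>2) * indicator {0..T} x \<partial>lborel)" for x
  proof (cases "x \<in> {0..T}")
    case True
    let ?I = "\<integral>u. K0_kernel H x u * \<phi> u \<partial>lborel"
    \<comment> \<open>If the integrand is not integrable, \<open>?I\<close> is 0 by convention and
      the bound is trivial.\<close>
    have "ennreal \<bar>?I\<bar> \<le> (\<integral>\<^sup>+u. ennreal (norm (K0_kernel H x u * \<phi> u)) \<partial>lborel)"
      using integral_norm_bound_ennreal[of lborel "\<lambda>u. K0_kernel H x u * \<phi> u"]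
      by (cases "integrable lborel (\<lambda>u. K0_kernel H x u * \<phi> u)") (auto simp: not_integrable_integral_eq)
    also have "\<dots> = (\<integral>\<^sup>+u. ennreal (sqrt (K0_kernel H x u)) * ennreal (sqrt (K0_kernel H x u) * \<bar>\<phi> u\<bar>) \<partial>lborel)"
      using K by (intro nn_integral_cong) (simp add: abs_mult flip: ennreal_mult' mult.assoc)
    finally have "(ennreal \<bar>?I\<bar>)\<^sup>2 \<le> (\<integral>\<^sup>+u. ennreal (sqrt (K0_kernel H x u)) * ennreal (sqrt (K0_kernel H x u) * \<bar>\<phi> u\<bar>) \<partial>lborel)\<^sup>2"
      by (intro power_mono) auto
    also have "\<dots> \<le> (\<integral>\<^sup>+u. (ennreal (sqrt (K0_kernel H x u)))\<^sup>2 \<partial>lborel) * (\<integral>\<^sup>+u. (ennreal (sqrt (K0_kernel H x u) * \<bar>\<phi> u\<bar>))\<^sup>2 \<partial>lborel)"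
      by (intro Cauchy_Schwarz_nn_integral) measurable
    also have "\<dots> = (\<integral>\<^sup>+u. ennreal (K0_kernel H x u) \<partial>lborel) * (\<integral>\<^sup>+u. ennreal (K0_kernel H x u * (\<phi> u)\<^sup>2) \<partial>lborel)"
      using K by (simp add: ennreal_power power_mult_distrib)
    also have "\<dots> \<le> ennreal \<kappa> * (\<integral>\<^sup>+u. ennreal (K0_kernel H x u * (\<phi> u)\<^sup>2) \<partial>lborel)"
      using \<kappa>(2)[of x] True by (intro mult_right_mono) auto
    finally show ?thesis using True by (simp add: ennreal_power)
  qed simp
  have "(\<integral>\<^sup>+x. ennreal (norm ((indicator {0..T} x * (\<integral>u. K0_kernel H x u * \<phi> u \<partial>lborel))\<^sup>2)) \<partial>lborel) \<le>
    (\<integral>\<^sup>+x. ennreal \<kappa> * (\<integral>\<^sup>+u. ennreal (K0_kernel H x u * (\<phi> u)\<^sup>2) * indicator {0..T} x \<partial>lborel) \<partial>lborel)"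
    by (intro nn_integral_mono b)
  also have "\<dots> = ennreal \<kappa> * (\<integral>\<^sup>+x. \<integral>\<^sup>+u. ennreal (K0_kernel H x u * (\<phi> u)\<^sup>2) * indicator {0..T} x \<partial>lborel \<partial>lborel)"
    by (rule nn_integral_cmult) measurable
  also have "(\<integral>\<^sup>+x. \<integral>\<^sup>+u. ennreal (K0_kernel H x u * (\<phi> u)\<^sup>2) * indicator {0..T} x \<partial>lborel \<partial>lborel)
    = (\<integral>\<^sup>+u. \<integral>\<^sup>+x. ennreal (K0_kernel H x u * (\<phi> u)\<^sup>2) * indicator {0..T} x \<partial>lborel \<partial>lborel)"
    by (rule nn_integral_Fubini_lborel) measurable
  also have "\<dots> \<le> (\<integral>\<^sup>+u. ennreal ((\<phi> u)\<^sup>2) * ennreal \<kappa> \<partial>lborel)"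
  proof (rule nn_integral_mono)
    fix u
    have "(\<integral>\<^sup>+x. ennreal (K0_kernel H x u * (\<phi> u)\<^sup>2) * indicator {0..T} x \<partial>lborel) =
      (\<integral>\<^sup>+x. ennreal ((\<phi> u)\<^sup>2) * (ennreal (K0_kernel H x u) * indicator {0..T} x) \<partial>lborel)"
      using K by (intro nn_integral_cong) (auto simp: mult_ac simp flip: ennreal_mult' split: split_indicator)
    also have "\<dots> = ennreal ((\<phi> u)\<^sup>2) * (\<integral>\<^sup>+x. ennreal (K0_kernel H x u) * indicator {0..T} x \<partial>lborel)"
      by (rule nn_integral_cmult) measurable
    also have "\<dots> \<le> ennreal ((\<phi> u)\<^sup>2) * ennreal \<kappa>" using \<kappa>(3) by (intro mult_left_mono) auto
    finally show "(\<integral>\<^sup>+x. ennreal (K0_kernel H x u * (\<phi> u)\<^sup>2) * indicator {0..T} x \<partial>lborel) \<le> ennreal ((\<phi> u)\<^sup>2) * ennreal \<kappa>" .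
  qed
  also have "(\<integral>\<^sup>+u. ennreal ((\<phi> u)\<^sup>2) * ennreal \<kappa> \<partial>lborel) = ennreal (\<integral>u. (\<phi> u)\<^sup>2 \<partial>lborel) * ennreal \<kappa>"
    using \<phi>2 by (subst nn_integral_multc) (auto simp: nn_integral_eq_integral)
  finally have "(\<integral>\<^sup>+x. ennreal (norm ((indicator {0..T} x * (\<integral>u. K0_kernel H x u * \<phi> u \<partial>lborel))\<^sup>2)) \<partial>lborel) \<le>
     ennreal \<kappa> * (ennreal (\<integral>u. (\<phi> u)\<^sup>2 \<partial>lborel) * ennreal \<kappa>)" by (auto simp: mult_left_mono)
  also have "\<dots> < \<infinity>" by (simp add: ennreal_mult_less_top)
  finally show "(\<integral>\<^sup>+x. ennreal (norm ((indicator {0..T} x * (\<integral>u. K0_kernel H x u * \<phi> u \<partial>lborel))\<^sup>2)) \<partial>lborel) < \<infinity>" .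
qed measurable

text \<open>Moves the operator to the other side of the inner product, where
  \<open>MG_kernel_adjoint\<close> evaluates it. Fubini is justified by the same computation with
  absolute values, whose result is at most the L1 norm of \<phi>.\<close>

lemma MG_kernel_reproducing:
  fixes \<phi> :: "real \<Rightarrow> real"
  assumes [measurable]: "\<phi> \<in> borel_measurable borel" and int: "integrable lborel \<phi>"
  shows "(\<integral>x. (\<integral>u. K0_kernel H x u * \<phi> u \<partial>lborel) * MG_kernel H s x \<partial>lborel) = (\<integral>u. indicator {0<..<s} u * \<phi> u \<partial>lborel)"
proof -
  let ?f = "\<lambda>x u. MG_kernel H s x * K0_kernel H x u * \<phi> u"
  note K = K0_kernel_nonneg[OF H] and MG = MG_kernel_nonneg[OF H]
  have "integrable (lborel \<Otimes>\<^sub>M lborel) (case_prod ?f)"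
  proof (rule integrableI_bounded)
    have "(\<integral>\<^sup>+z. ennreal (norm (case_prod ?f z)) \<partial>(lborel \<Otimes>\<^sub>M lborel)) =
      (\<integral>\<^sup>+x. \<integral>\<^sup>+u. ennreal (MG_kernel H s x * K0_kernel H x u * \<bar>\<phi> u\<bar>) \<partial>lborel \<partial>lborel)"
      using K MG by (subst lborel.nn_integral_fst[symmetric]) (auto simp: abs_mult)
    also have "\<dots> = (\<integral>\<^sup>+u. ennreal \<bar>\<phi> u\<bar> * indicator {0<..<s} u \<partial>lborel)"
      by (rule nn_integral_MG_kernel_K0[OF H]) auto
    also have "\<dots> \<le> (\<integral>\<^sup>+u. ennreal (norm (\<phi> u)) \<partial>lborel)"
      by (intro nn_integral_mono) (auto split: split_indicator)
    also have "\<dots> < \<infinity>" using int by (simp add: integrable_iff_bounded)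
    finally show "(\<integral>\<^sup>+z. ennreal (norm (case_prod ?f z)) \<partial>(lborel \<Otimes>\<^sub>M lborel)) < \<infinity>" .
  qed measurable
  then have "(\<integral>u. (\<integral>x. ?f x u \<partial>lborel) \<partial>lborel) = (\<integral>x. (\<integral>u. ?f x u \<partial>lborel) \<partial>lborel)"
    by (rule lborel_pair.Fubini_integral)
  moreover have "(\<integral>x. ?f x u \<partial>lborel) = indicator {0<..<s} u * \<phi> u" for u
  proof -
    have "(\<integral>x. ?f x u \<partial>lborel) = (\<integral>x. K0_kernel H x u * MG_kernel H s x \<partial>lborel) * \<phi> u"
      by (simp add: mult_ac)
    also have "(\<integral>x. K0_kernel H x u * MG_kernel H s x \<partial>lborel) = indicator {0<..<s} u"
    proof (cases "0 < u \<and> u < s")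
      case True
      then show ?thesis using K MG
        by (subst integral_eq_nn_integral) (auto simp: MG_kernel_adjoint[OF H])
    next
      case False
      then have "K0_kernel H x u * MG_kernel H s x = 0" for x by (auto simp: K0_kernel_def MG_kernel_def)
      then show ?thesis using False by (simp only:) simp
    qed
    finally show ?thesis .
  qed
  moreover have "(\<integral>u. ?f x u \<partial>lborel) = (\<integral>u. K0_kernel H x u * \<phi> u \<partial>lborel) * MG_kernel H s x" for x
    by (simp add: mult.assoc mult.commute[of _ "MG_kernel H s x"])
  ultimately show ?thesis by (simp only:)
qed

lemma MG_kernel_covariance:
  assumes "0 \<le> s" "0 \<le> t"
  shows "(\<integral>x. MG_kernel H s x * MG_kernel H t x \<partial>lborel) = (1/2) * (t powr (2 * H) + s powr (2 * H) - \<bar>t - s\<bar> powr (2 * H))"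
    (is "?I s t = ?R s t")
proof -
  have pos: "?I s t = ?R s t" if st: "0 < s" "s \<le> t" for s t
  proof -
    \<comment> \<open>Nonnegativity of \<open>?R s t\<close> is needed because
      \<open>ennreal\<close> truncates negative numbers to 0.\<close>
    have "(t - s) powr (2 * H) \<le> t powr (2 * H)" using st H by (intro powr_mono2) auto
    then have "(t - s) powr (2 * H) \<le> t powr (2 * H) + s powr (2 * H)"
      using powr_ge_zero[of s "2 * H"] by linarith
    then have "?R s t \<ge> 0" using st by simp
    have "?I s t = enn2real (\<integral>\<^sup>+x. ennreal (MG_kernel H s x * MG_kernel H t x) \<partial>lborel)"
      by (rule integral_eq_nn_integral) (auto simp: MG_kernel_nonneg[OF H])
    also have "\<dots> = ?R s t"
      unfolding nn_integral_MG_kernel_product[OF H st] using \<open>?R s t \<ge> 0\<close> by (rule enn2real_ennreal)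
    finally show ?thesis .
  qed
  have z: "?I 0 t = ?R 0 t" if "0 \<le> t" for t
  proof -
    have "MG_kernel H 0 x = 0" for x by (simp add: MG_kernel_def)
    then show ?thesis using that by simp
  qed
  have *: "?I s t = ?R s t" if "s \<le> t" "0 \<le> s" for s t
    using pos[of s t] z[of t] that by (cases "s = 0") auto
  show ?thesis
  proof (cases "s \<le> t")
    case False
    then have "?I t s = ?R t s" using * assms by simp
    then show ?thesis by (simp add: mult.commute abs_minus_commute add.commute)
  qed (use * assms in simp)
qed

lemma MG_kernel_L2: "integrable lborel (\<lambda>x. (MG_kernel H s x)\<^sup>2)"
proof (cases "0 < s")
  case True
  show ?thesis
  proof (rule integrableI_bounded)
    have "(\<integral>\<^sup>+x. ennreal (norm ((MG_kernel H s x)\<^sup>2)) \<partial>lborel) = (\<integral>\<^sup>+x. ennreal (MG_kernel H s x * MG_kernel H s x) \<partial>lborel)"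
      by (simp add: power2_eq_square)
    also have "\<dots> < \<infinity>" using nn_integral_MG_kernel_product[OF H True order_refl] by (simp only:) simp
    finally show "(\<integral>\<^sup>+x. ennreal (norm ((MG_kernel H s x)\<^sup>2)) \<partial>lborel) < \<infinity>" .
  qed simp
next
  case False
  then have "MG_kernel H s x = 0" for x by (auto simp: MG_kernel_def)
  then show ?thesis by simp
qed

end

text \<open>Trends are Lebesgue measurable, whereas the exchanges of integrals above take place in
  products of \<open>lborel\<close>. A Borel version of the function, cut off outside the interval,
  bridges the two.\<close>

lemma L2_on_borel_version:
  assumes "L2_on T \<phi>"
  shows "\<exists>\<psi>. \<psi> \<in> borel_measurable borel \<and> (\<forall>x. x \<notin> {0..T} \<longrightarrow> \<psi> x = 0) \<and>
    integrable lborel (\<lambda>x. (\<psi> x)\<^sup>2) \<and> (AE x in lebesgue. indicator {0..T} x * \<phi> x = \<psi> x) \<and>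
    (\<lambda>x. indicator {0..T} x * \<phi> x) \<in> borel_measurable lebesgue"
proof -
  have m[measurable]: "(\<lambda>x. indicator {0..T} x * \<phi> x) \<in> borel_measurable lebesgue"
    and i: "integrable lebesgue (\<lambda>x. indicator {0..T} x * (\<phi> x)\<^sup>2)"
    using assms by (auto simp: L2_on_def set_borel_measurable_def set_integrable_def)
  obtain g where g[measurable]: "g \<in> borel_measurable lborel" and ae: "AE x in lborel. indicator {0..T} x * \<phi> x = g x"
    using completion_ex_borel_measurable_real[OF m] by auto
  define \<psi> where "\<psi> x = indicator {0..T} x * g x" for x
  have \<psi>[measurable]: "\<psi> \<in> borel_measurable borel" unfolding \<psi>_def[abs_def] using g by measurable
  have ae': "AE x in lebesgue. indicator {0..T} x * \<phi> x = \<psi> x"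
    using AE_completion[OF ae] by eventually_elim (auto simp: \<psi>_def split: split_indicator)
  have "integrable lebesgue (\<lambda>x. (\<psi> x)\<^sup>2)"
  proof (rule integrable_cong_AE_imp[OF i])
    show "AE x in lebesgue. indicator {0..T} x * (\<phi> x)\<^sup>2 = (\<psi> x)\<^sup>2"
      using ae' by eventually_elim (auto split: split_indicator_asm split_indicator)
    show "(\<lambda>x. (\<psi> x)\<^sup>2) \<in> borel_measurable lebesgue"
      by (intro measurable_completion) measurable
  qed
  then have "integrable lborel (\<lambda>x. (\<psi> x)\<^sup>2)"
    by (subst (asm) integrable_completion) auto
  with ae' \<psi> m show ?thesis by (intro exI[of _ \<psi>]) (auto simp: \<psi>_def)
qed

text \<open>The integral depends only on the almost-everywhere class of the function, so passing to
  the Borel version changes nothing at any \<open>x\<close>.\<close>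

lemma K0_star_borel_version:
  fixes \<phi> \<psi> :: "real \<Rightarrow> real"
  assumes \<psi>: "\<psi> \<in> borel_measurable borel" and ae: "AE x in lebesgue. indicator {0..T} x * \<phi> x = \<psi> x"
    and m: "(\<lambda>x. indicator {0..T} x * \<phi> x) \<in> borel_measurable lebesgue" and x: "x \<in> {0..T}"
  shows "K0_star H \<phi> x = (\<integral>u. K0_kernel H x u * \<psi> u \<partial>lborel)"
proof -
  have K: "K0_kernel H x \<in> borel_measurable lebesgue"
    by (intro measurable_completion) measurable
  have "K0_star H \<phi> x = (\<integral>u. K0_kernel H x u * (indicator {0..T} u * \<phi> u) \<partial>lebesgue)"
    unfolding K0_star_def set_lebesgue_integral_def integral_mult_right_zero[symmetric]
  proof (rule Bochner_Integration.integral_cong)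
    fix u
    show "inverse (C1 H) * x powr (H - 1 / 2) / Gamma (1 / 2 - H) *
         indicat_real {0..x} u *\<^sub>R ((x - u) powr (- 1 / 2 - H) * u powr (1 / 2 - H) * \<phi> u) =
         K0_kernel H x u * (indicat_real {0..T} u * \<phi> u)"
      \<comment> \<open>At these two points \<open>K0_kernel\<close> is 0 by definition, and the
        other integrand is 0 because a power with base 0 is 0.\<close>
      using x by (cases "u = 0"; cases "u = x") (auto simp: K0_kernel_def split: split_indicator)
  qed simp
  also have "\<dots> = (\<integral>u. K0_kernel H x u * \<psi> u \<partial>lebesgue)"
  proof (rule integral_cong_AE)
    show "AE u in lebesgue. K0_kernel H x u * (indicat_real {0..T} u * \<phi> u) = K0_kernel H x u * \<psi> u"
      using ae by eventually_elim simp
    show "(\<lambda>u. K0_kernel H x u * \<psi> u) \<in> borel_measurable lebesgue"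
      using \<psi> by (intro borel_measurable_times[OF K] measurable_completion) simp
  qed (rule borel_measurable_times[OF K m])
  also have "\<dots> = (\<integral>u. K0_kernel H x u * \<psi> u \<partial>lborel)"
    using \<psi> by (intro integral_completion) measurable
  finally show ?thesis .
qed

lemma L2_integral_version:
  fixes \<phi> \<psi> :: "real \<Rightarrow> real"
  assumes \<psi>[measurable]: "\<psi> \<in> borel_measurable borel" and ae: "AE x in lebesgue. indicator {0..T} x * \<phi> x = \<psi> x"
    and m: "(\<lambda>x. indicator {0..T} x * \<phi> x) \<in> borel_measurable lebesgue" and t: "t \<in> {0..T}"
  shows "(LINT s:{0..t}|lebesgue. \<phi> s) = (\<integral>u. indicator {0<..<t} u * \<psi> u \<partial>lborel)"
proof -
  have "(LINT s:{0..t}|lebesgue. \<phi> s) = (\<integral>s. indicator {0..t} s * (indicator {0..T} s * \<phi> s) \<partial>lebesgue)"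
    unfolding set_lebesgue_integral_def using t by (intro Bochner_Integration.integral_cong) (auto simp: indicator_def)
  also have "\<dots> = (\<integral>s. indicator {0..t} s * \<psi> s \<partial>lebesgue)"
  proof (rule integral_cong_AE)
    show "AE u in lebesgue. indicator {0..t} u * (indicat_real {0..T} u * \<phi> u) = indicator {0..t} u * \<psi> u"
      using ae by eventually_elim simp
  qed (auto intro!: borel_measurable_times borel_measurable_indicator m measurable_completion[of \<psi>])
  also have "\<dots> = (\<integral>s. indicator {0..t} s * \<psi> s \<partial>lborel)"
    by (intro integral_completion) measurable
  also have "\<dots> = (\<integral>s. indicator {0<..<t} s * \<psi> s \<partial>lborel)"
  proof (rule integral_cong_AE)
    show "AE s in lborel. indicator {0..t} s * \<psi> s = indicator {0<..<t} s * \<psi> s"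
      using AE_lborel_singleton[of 0] AE_lborel_singleton[of t] by eventually_elim (auto split: split_indicator)
  qed measurable
  finally show ?thesis .
qed

text \<open>The instance of \<open>quadratic_form_bound\<close> for the functions
  \<open>MG_kernel H t\<close>: their Gram matrix is the covariance of \<open>B\<close>, and
  \<open>MG_kernel_reproducing\<close> writes \<open>g t\<close> as an inner product with the image
  of \<phi>.\<close>

lemma fbm_shift_bound:
  assumes H: "0 < H" "H < 1/2" and T: "0 < T" and L2: "L2_on T \<phi>"
    and g: "\<And>t. t \<in> {0..T} \<Longrightarrow> g t = (LINT s:{0..t}|lebesgue. \<phi> s)"
  shows "set_integrable lebesgue {0..T} (\<lambda>t. (K0_star H \<phi> t)\<^sup>2)"
    and "finite S \<Longrightarrow> S \<subseteq> {0..T} \<Longrightarrow> (\<Sum>t\<in>S. a t * g t)\<^sup>2 \<le> (LINT t:{0..T}|lebesgue. (K0_star H \<phi> t)\<^sup>2) *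
      (\<Sum>s\<in>S. \<Sum>t\<in>S. a s * a t * ((1/2) * (t powr (2 * H) + s powr (2 * H) - \<bar>t - s\<bar> powr (2 * H))))"
proof -
  obtain \<psi> where \<psi>[measurable]: "\<psi> \<in> borel_measurable borel" and z: "\<And>x. x \<notin> {0..T} \<Longrightarrow> \<psi> x = 0"
    and \<psi>2: "integrable lborel (\<lambda>x. (\<psi> x)\<^sup>2)" and ae: "AE x in lebesgue. indicator {0..T} x * \<phi> x = \<psi> x"
    and m: "(\<lambda>x. indicator {0..T} x * \<phi> x) \<in> borel_measurable lebesgue"
    using L2_on_borel_version[OF L2] by blast
  define h where "h x = indicator {0..T} x * (\<integral>u. K0_kernel H x u * \<psi> u \<partial>lborel)" for x
  have h[measurable]: "h \<in> borel_measurable borel" unfolding h_def[abs_def] by measurable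
  have h2: "integrable lborel (\<lambda>x. (h x)\<^sup>2)" unfolding h_def by (rule K0_kernel_L2[OF H T \<psi> \<psi>2])
  have eq: "indicator {0..T} x *\<^sub>R (K0_star H \<phi> x)\<^sup>2 = (h x)\<^sup>2" for x
    using K0_star_borel_version[OF \<psi> ae m, of x H] by (auto simp: h_def split: split_indicator)
  have h2': "integrable lebesgue (\<lambda>x. (h x)\<^sup>2)"
    using h2 by (subst integrable_completion) auto
  then show "set_integrable lebesgue {0..T} (\<lambda>t. (K0_star H \<phi> t)\<^sup>2)"
    unfolding set_integrable_def eq .
  have I: "(LINT t:{0..T}|lebesgue. (K0_star H \<phi> t)\<^sup>2) = (\<integral>x. (h x)\<^sup>2 \<partial>lborel)"
    unfolding set_lebesgue_integral_def eq by (intro integral_completion) measurable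
  assume S: "finite S" "S \<subseteq> {0..T}"
  show "(\<Sum>t\<in>S. a t * g t)\<^sup>2 \<le> (LINT t:{0..T}|lebesgue. (K0_star H \<phi> t)\<^sup>2) *
      (\<Sum>s\<in>S. \<Sum>t\<in>S. a s * a t * ((1/2) * (t powr (2 * H) + s powr (2 * H) - \<bar>t - s\<bar> powr (2 * H))))"
    unfolding I
  proof (rule quadratic_form_bound[where p = "MG_kernel H"])
    fix t assume t: "t \<in> S"
    have "g t = (\<integral>u. indicator {0<..<t} u * \<psi> u \<partial>lborel)"
      using g[of t] t S L2_integral_version[OF \<psi> ae m, of t] by auto
    also have "\<dots> = (\<integral>x. (\<integral>u. K0_kernel H x u * \<psi> u \<partial>lborel) * MG_kernel H t x \<partial>lborel)"
      using integrable_of_L2[OF \<psi> \<psi>2 z] by (intro MG_kernel_reproducing[OF H, symmetric]) auto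
    \<comment> \<open>The cut-off in \<open>h\<close> is harmless: the kernel for time
      \<open>t\<close> lives on (0, t), inside the interval.\<close>
    also have "\<dots> = (\<integral>x. h x * MG_kernel H t x \<partial>lborel)"
      using S t by (intro Bochner_Integration.integral_cong) (auto simp: h_def MG_kernel_def split: split_indicator)
    finally show "g t = (\<integral>x. h x * MG_kernel H t x \<partial>lborel)" .
  next
    fix s t assume "s \<in> S" "t \<in> S"
    with S show "1 / 2 * (t powr (2 * H) + s powr (2 * H) - \<bar>t - s\<bar> powr (2 * H)) = (\<integral>x. MG_kernel H s x * MG_kernel H t x \<partial>lborel)"
      by (intro MG_kernel_covariance[OF H, symmetric]) auto
  qed (use S h2 MG_kernel_L2[OF H] in auto)
qed

text \<open>The Brownian counterpart: the indicators of \<open>{0..t}\<close> have Gram matrix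
  \<open>min\<close>, and the integral of \<phi> up to \<open>t\<close> is an inner product with
  such an indicator.\<close>

lemma wiener_shift_bound:
  assumes L2: "L2_on T \<phi>"
    and g: "\<And>t. t \<in> {0..T} \<Longrightarrow> g t = (LINT s:{0..t}|lebesgue. \<phi> s)"
    and S: "finite S" "S \<subseteq> {0..T}"
  shows "(\<Sum>t\<in>S. a t * g t)\<^sup>2 \<le> (LINT t:{0..T}|lebesgue. (\<phi> t)\<^sup>2) * (\<Sum>s\<in>S. \<Sum>t\<in>S. a s * a t * min s t)"
proof -
  have m: "(\<lambda>x. indicator {0..T} x * \<phi> x) \<in> borel_measurable lebesgue"
    and i: "integrable lebesgue (\<lambda>x. indicator {0..T} x * (\<phi> x)\<^sup>2)"
    using L2 by (auto simp: L2_on_def set_borel_measurable_def set_integrable_def)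
  have sq: "(indicator {0..T} x * \<phi> x)\<^sup>2 = indicator {0..T} x * (\<phi> x)\<^sup>2" for x
    by (auto split: split_indicator)
  have "(\<Sum>t\<in>S. a t * g t)\<^sup>2 \<le> (\<integral>x. (indicator {0..T} x * \<phi> x)\<^sup>2 \<partial>lebesgue) * (\<Sum>s\<in>S. \<Sum>t\<in>S. a s * a t * min s t)"
  proof (rule quadratic_form_bound[where p = "\<lambda>t. indicator {0..t}"])
    fix t assume t: "t \<in> S"
    then have *: "indicator {0..t} x *\<^sub>R \<phi> x = indicator {0..T} x * \<phi> x * indicator {0..t} x" for x
      using S by (auto simp: indicator_def)
    have "t \<in> {0..T}" using t S by auto
    show "g t = (\<integral>x. indicator {0..T} x * \<phi> x * indicator {0..t} x \<partial>lebesgue)"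
      unfolding g[OF \<open>t \<in> {0..T}\<close>] set_lebesgue_integral_def * by (rule refl)
    have "(\<lambda>x. (indicator {0..t} x)\<^sup>2) = (indicator {0..t} :: real \<Rightarrow> real)"
      by (auto simp: indicator_def)
    then show "integrable lebesgue (\<lambda>x. (indicator {0..t} x :: real)\<^sup>2)"
      by (simp add: integrable_indicator_iff emeasure_lborel_Icc_eq)
  next
    fix s t assume "s \<in> S" "t \<in> S"
    then have "0 \<le> s" "0 \<le> t" using S by auto
    moreover have "(\<lambda>x. indicator {0..s} x * indicator {0..t} x) = (indicator {0..min s t} :: real \<Rightarrow> real)"
      by (auto simp: indicator_def)
    ultimately show "min s t = (\<integral>x. indicator {0..s} x * indicator {0..t} x \<partial>lebesgue)" by simp
  qed (use S m i in \<open>auto simp: sq intro!: borel_measurable_indicator\<close>)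
  then show ?thesis by (simp add: sq set_lebesgue_integral_def)
qed

section \<open>Shifts of Gaussian vectors\<close>

definition quad_form :: "'i set \<Rightarrow> ('i \<Rightarrow> 'i \<Rightarrow> real) \<Rightarrow> ('i \<Rightarrow> real) \<Rightarrow> real" where
  "quad_form I R a = (\<Sum>i\<in>I. \<Sum>j\<in>I. a i * a j * R i j)"

lemma quad_form_insert:
  assumes "finite F" "k \<notin> F" and sym: "\<And>i j. R i j = R j i"
  shows "quad_form (insert k F) R a = (a k)\<^sup>2 * R k k + 2 * a k * (\<Sum>j\<in>F. a j * R k j) + quad_form F R a"
proof -
  have "quad_form (insert k F) R a =
    a k * a k * R k k + (\<Sum>j\<in>F. a k * a j * R k j) + ((\<Sum>i\<in>F. a i * a k * R i k) + quad_form F R a)"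
    unfolding quad_form_def using assms(1,2) by (simp add: sum.distrib)
  also have "(\<Sum>i\<in>F. a i * a k * R i k) = (\<Sum>j\<in>F. a k * a j * R k j)"
    using sym by (intro sum.cong) (auto simp: mult_ac)
  also have "(\<Sum>j\<in>F. a k * a j * R k j) = a k * (\<Sum>j\<in>F. a j * R k j)"
    by (simp add: sum_distrib_left mult_ac)
  finally show ?thesis by (simp add: power2_eq_square)
qed

lemma affine_nonneg_imp_zero:
  fixes A B :: real
  assumes "\<And>t. 0 \<le> A + t * B"
  shows "B = 0"
proof (rule ccontr)
  assume "B \<noteq> 0"
  then show False using assms[of "- (A + 1) / B"] by simp
qed

text \<open>Induction on the index set, passing to the Schur complement of one diagonal entry.\<close>

lemma quad_form_range:
  fixes R :: "'i \<Rightarrow> 'i \<Rightarrow> real"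
  assumes "finite I" and "\<And>i j. R i j = R j i"
    and "\<And>a. 0 \<le> quad_form I R a" and "\<And>a. (\<Sum>i\<in>I. a i * m i)\<^sup>2 \<le> K * quad_form I R a"
  shows "\<exists>c. \<forall>i\<in>I. m i = (\<Sum>j\<in>I. R i j * c j)"
  using assms
proof (induction I arbitrary: R m rule: finite_induct)
  case (insert k F)
  note sym = insert.prems(1) and psd = insert.prems(2) and bd = insert.prems(3)
  note ins = quad_form_insert[OF insert.hyps sym]
  have upd: "(\<Sum>i\<in>F. (a(k := x)) i * b i) = (\<Sum>i\<in>F. a i * b i)" for a b :: "'i \<Rightarrow> real" and x
    using insert.hyps by (intro sum.cong) auto
  have updq: "quad_form F S (a(k := x)) = quad_form F S a" for a S x
    unfolding quad_form_def using insert.hyps by (intro sum.cong) auto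
  show ?case
  proof (cases "R k k = 0")
    case True
    \<comment> \<open>A zero diagonal entry of a positive semidefinite form kills its whole row: on
      the vector with entry 1 at \<open>j\<close> and \<open>t\<close> at \<open>k\<close> the form
      is affine in \<open>t\<close> and never negative.\<close>
    have Rk: "R k j = 0" if "j \<in> F" for j
    proof -
      have "0 \<le> R j j + t * (2 * R k j)" for t
      proof -
        let ?a = "(\<lambda>i. if i = j then 1 else 0)(k := t)"
        have \<delta>: "(\<Sum>i\<in>F. (if i = j then 1 else 0) * f i) = f j" for f :: "'i \<Rightarrow> real"
        proof -
          have "(if i = j then 1 else 0) * f i = (if i = j then f i else 0)" for i by simp
          then show ?thesis using insert.hyps that by (simp only:) simp
        qed
        have "quad_form F R (\<lambda>i. if i = j then 1 else 0) = R j j"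
          unfolding quad_form_def mult.assoc sum_distrib_left[symmetric] \<delta> ..
        note this \<delta>[of "R k"]
        then have "quad_form (insert k F) R ?a = R j j + t * (2 * R k j)"
          unfolding ins upd updq True by (simp only:) simp
        then show ?thesis using psd[of ?a] by (simp only:)
      qed
      from affine_nonneg_imp_zero[OF this] show ?thesis by simp
    qed
    \<comment> \<open>The form vanishes on the unit vector at \<open>k\<close>, and the assumed
      bound then forces \<open>m k = 0\<close>.\<close>
    have "quad_form (insert k F) R ((\<lambda>_. 0)(k := 1)) = 0"
      unfolding ins upd updq True by (simp add: quad_form_def)
    moreover have "(\<Sum>i\<in>insert k F. ((\<lambda>_. 0)(k := 1)) i * m i) = m k"
      using insert.hyps upd[of "\<lambda>_. 0" 1 m] by simp
    ultimately have "(m k)\<^sup>2 \<le> K * 0" using bd[of "(\<lambda>_. 0)(k := 1)"] by (simp only:)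
    then have mk: "m k = 0" by simp
    have "\<exists>c. \<forall>i\<in>F. m i = (\<Sum>j\<in>F. R i j * c j)"
    proof (rule insert.IH)
      fix a
      have *: "quad_form (insert k F) R (a(k := 0)) = quad_form F R a"
        unfolding ins upd updq by simp
      then show "0 \<le> quad_form F R a" using psd[of "a(k := 0)"] by (simp only:)
      have "(\<Sum>i\<in>insert k F. (a(k := 0)) i * m i) = (\<Sum>i\<in>F. a i * m i)"
        using insert.hyps upd[of a 0 m] by simp
      then show "(\<Sum>i\<in>F. a i * m i)\<^sup>2 \<le> K * quad_form F R a" using bd[of "a(k := 0)"] * by (simp only:)
    qed (rule sym)
    then obtain c where c: "\<And>i. i \<in> F \<Longrightarrow> m i = (\<Sum>j\<in>F. R i j * c j)" by blast
    show ?thesis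
    proof (intro exI ballI)
      fix i assume "i \<in> insert k F"
      then show "m i = (\<Sum>j\<in>insert k F. R i j * c j)"
        using insert.hyps c[of i] mk Rk True sym[of i k] by auto
    qed
  next
    case False
    define r where "r = R k k"
    have r: "r \<noteq> 0" using False by (simp add: r_def)
    \<comment> \<open>The Schur complement, and the right-hand side after eliminating the unknown at
      \<open>k\<close>.\<close>
    define R' where "R' i j = R i j - R k i * R k j / r" for i j
    define m' where "m' i = m i - R k i * m k / r" for i
    have "\<exists>c. \<forall>i\<in>F. m' i = (\<Sum>j\<in>F. R' i j * c j)"
    proof (rule insert.IH)
      show "R' i j = R' j i" for i j by (simp add: R'_def sym[of i j] mult.commute)
      fix a
      define s where "s = (\<Sum>j\<in>F. a j * R k j)"
      \<comment> \<open>This entry at \<open>k\<close> minimises the form for given entries on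
        \<open>F\<close>; the minimum is the form of \<open>R'\<close>, so both hypotheses pass to
        the complement.\<close>
      let ?a = "a(k := - s / r)"
      have "quad_form F R' a = quad_form F R a - (\<Sum>i\<in>F. \<Sum>j\<in>F. (a i * R k i) * (a j * R k j)) / r"
        unfolding quad_form_def R'_def by (simp add: algebra_simps sum_subtractf sum_divide_distrib)
      also have "(\<Sum>i\<in>F. \<Sum>j\<in>F. (a i * R k i) * (a j * R k j)) = s * s"
        unfolding s_def sum_product ..
      finally have q: "quad_form (insert k F) R ?a = quad_form F R' a"
        unfolding ins upd updq using r by (simp add: s_def[symmetric] r_def[symmetric] power2_eq_square field_simps)
      then show "0 \<le> quad_form F R' a" using psd[of ?a] by (simp only:)
      have "(\<Sum>i\<in>F. a i * m' i) = (\<Sum>i\<in>F. a i * m i) - (\<Sum>i\<in>F. a i * R k i) * m k / r"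
        unfolding m'_def by (simp add: algebra_simps sum_subtractf sum_divide_distrib sum_distrib_left)
      then have "(\<Sum>i\<in>insert k F. ?a i * m i) = (\<Sum>i\<in>F. a i * m' i)"
        using insert.hyps upd[of a "- s / r" m] by (simp add: s_def)
      then show "(\<Sum>i\<in>F. a i * m' i)\<^sup>2 \<le> K * quad_form F R' a" using bd[of ?a] q by (simp only:)
    qed
    then obtain c where c: "\<And>i. i \<in> F \<Longrightarrow> m' i = (\<Sum>j\<in>F. R' i j * c j)" by blast
    \<comment> \<open>Solves the equation of row \<open>k\<close> once the other unknowns are
      \<open>c\<close>.\<close>
    define c0 where "c0 = (m k - (\<Sum>j\<in>F. R k j * c j)) / r"
    show ?thesis
    proof (intro exI ballI)
      fix i assume i: "i \<in> insert k F"
      have sum_upd: "(\<Sum>j\<in>insert k F. R i j * (c(k := c0)) j) = R i k * c0 + (\<Sum>j\<in>F. R i j * c j)" for i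
      proof -
        have "(\<Sum>j\<in>F. R i j * (c(k := c0)) j) = (\<Sum>j\<in>F. R i j * c j)"
          using insert.hyps by (intro sum.cong) auto
        then show ?thesis using insert.hyps by simp
      qed
      show "m i = (\<Sum>j\<in>insert k F. R i j * (c(k := c0)) j)"
      proof (cases "i = k")
        case True
        then show ?thesis unfolding sum_upd using r by (simp add: c0_def r_def)
      next
        case False
        with i have "m' i = (\<Sum>j\<in>F. R' i j * c j)" using c by simp
        also have "\<dots> = (\<Sum>j\<in>F. R i j * c j) - R k i * (\<Sum>j\<in>F. R k j * c j) / r"
          unfolding R'_def by (simp add: algebra_simps sum_subtractf sum_divide_distrib sum_distrib_left)
        finally show ?thesis unfolding sum_upd using r sym[of i k]
          by (simp add: m'_def c0_def field_simps)
      qed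
    qed
  qed
qed simp

lemma quad_form_add_scaled:
  assumes "finite I" and sym: "\<And>i j. R i j = R j i" and c: "\<And>i. i \<in> I \<Longrightarrow> m i = (\<Sum>j\<in>I. R i j * c j)"
  shows "quad_form I R (\<lambda>i. a i + t * c i) = quad_form I R a + 2 * t * (\<Sum>i\<in>I. a i * m i) + t\<^sup>2 * quad_form I R c"
proof -
  have "(\<Sum>i\<in>I. a i * m i) = (\<Sum>i\<in>I. \<Sum>j\<in>I. a i * c j * R i j)"
    using c by (intro sum.cong) (auto simp: sum_distrib_left mult_ac)
  moreover have "(\<Sum>i\<in>I. \<Sum>j\<in>I. c i * a j * R i j) = (\<Sum>i\<in>I. \<Sum>j\<in>I. a i * c j * R i j)"
    by (subst sum.swap, intro sum.cong refl) (simp add: sym mult_ac)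
  ultimately have "2 * t * (\<Sum>i\<in>I. a i * m i) = t * (\<Sum>i\<in>I. \<Sum>j\<in>I. a i * c j * R i j) + t * (\<Sum>i\<in>I. \<Sum>j\<in>I. c i * a j * R i j)"
    by simp
  then show ?thesis
    unfolding quad_form_def
    by (simp add: algebra_simps sum.distrib sum_distrib_left power2_eq_square)
qed

lemma quad_form_range_self:
  assumes "\<And>i. i \<in> I \<Longrightarrow> m i = (\<Sum>j\<in>I. R i j * c j)"
  shows "quad_form I R c = (\<Sum>i\<in>I. c i * m i)"
  unfolding quad_form_def using assms by (intro sum.cong) (auto simp: sum_distrib_left mult_ac)

section \<open>Uniqueness of joint laws through cosine integrals\<close>

lemma integrable_mult_bounded:
  fixes \<rho> f :: "'a \<Rightarrow> real"
  assumes "integrable M \<rho>" "f \<in> borel_measurable M" "\<And>x. \<bar>f x\<bar> \<le> C"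
  shows "integrable M (\<lambda>x. \<rho> x * f x)"
proof (rule Bochner_Integration.integrable_bound)
  show "integrable M (\<lambda>x. C * \<rho> x)" using assms by simp
  have "\<bar>\<rho> x * f x\<bar> \<le> \<bar>C * \<rho> x\<bar>" for x
    using assms(3)[of x] by (simp add: abs_mult mult.commute[of C] mult_left_mono order.trans[OF _ abs_ge_self])
  then show "AE x in M. norm (\<rho> x * f x) \<le> norm (C * \<rho> x)" by simp
qed (use assms in auto)

text \<open>The sine is written as a cosine with phase \<open>- pi/2\<close>, so that assumptions on
  cosines with arbitrary phase determine real and imaginary parts alike.\<close>

lemma complex_integral_cos_sin:
  fixes \<rho> u :: "'a \<Rightarrow> real"
  assumes "integrable M \<rho>" "u \<in> borel_measurable M"
  shows "(\<integral>x. \<rho> x *\<^sub>R iexp (u x) \<partial>M) = Complex (\<integral>x. \<rho> x * cos (u x) \<partial>M) (\<integral>x. \<rho> x * cos (u x - pi/2) \<partial>M)"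
    and "integrable M (\<lambda>x. \<rho> x *\<^sub>R iexp (u x))"
proof -
  have c: "integrable M (\<lambda>x. \<rho> x * cos (u x))" "integrable M (\<lambda>x. \<rho> x * cos (u x - pi/2))"
    using assms by (auto intro!: integrable_mult_bounded[where C=1])
  have eq: "(\<lambda>x. \<rho> x *\<^sub>R iexp (u x)) = (\<lambda>x. Complex (\<rho> x * cos (u x)) (\<rho> x * cos (u x - pi/2)))"
    by (auto simp: complex_eq_iff Re_exp Im_exp cos_diff)
  have eq2: "(\<lambda>x. \<rho> x *\<^sub>R iexp (u x)) = (\<lambda>x. complex_of_real (\<rho> x * cos (u x)) + \<i> * complex_of_real (\<rho> x * cos (u x - pi/2)))"
    unfolding eq by (auto simp: complex_eq_iff)
  show int: "integrable M (\<lambda>x. \<rho> x *\<^sub>R iexp (u x))"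
    unfolding eq2 by (intro Bochner_Integration.integrable_add integrable_mult_right integrable_of_real c)
  show "(\<integral>x. \<rho> x *\<^sub>R iexp (u x) \<partial>M) = Complex (\<integral>x. \<rho> x * cos (u x) \<partial>M) (\<integral>x. \<rho> x * cos (u x - pi/2) \<partial>M)"
  proof -
    let ?f = "\<lambda>x. complex_of_real (\<rho> x * cos (u x))" and ?g = "\<lambda>x. complex_of_real (\<rho> x * cos (u x - pi/2))"
    have "(\<integral>x. \<rho> x *\<^sub>R iexp (u x) \<partial>M) = (\<integral>x. ?f x \<partial>M) + \<i> * (\<integral>x. ?g x \<partial>M)"
      unfolding eq2 integral_mult_right_zero[symmetric]
      by (intro Bochner_Integration.integral_add integrable_mult_right integrable_of_real c)
    then show ?thesis unfolding integral_complex_of_real by (simp add: complex_eq_iff)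
  qed
qed

text \<open>The assumption at t = 0 shows that both weights have the same total mass
  \<open>m\<close>. After division by \<open>m\<close>, the phases 0 and \<open>- pi/2\<close> say
  that the two weighted laws have equal characteristic functions. If \<open>m\<close> is 0, both
  weights vanish almost everywhere.\<close>

lemma weighted_Levy_uniqueness:
  fixes \<rho> X :: "'a \<Rightarrow> real" and \<rho>' Y :: "'b \<Rightarrow> real"
  assumes \<rho>: "integrable M \<rho>" "\<And>x. \<rho> x \<ge> 0" and \<rho>': "integrable N \<rho>'" "\<And>x. \<rho>' x \<ge> 0"
    and X[measurable]: "X \<in> borel_measurable M" and Y[measurable]: "Y \<in> borel_measurable N"
    and eq: "\<And>t \<theta>. (\<integral>x. \<rho> x * cos (t * X x + \<theta>) \<partial>M) = (\<integral>x. \<rho>' x * cos (t * Y x + \<theta>) \<partial>N)"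
    and A[measurable]: "A \<in> sets borel"
  shows "(\<integral>x. \<rho> x * indicator A (X x) \<partial>M) = (\<integral>x. \<rho>' x * indicator A (Y x) \<partial>N)"
proof -
  define m where "m = (\<integral>x. \<rho> x \<partial>M)"
  have m': "m = (\<integral>x. \<rho>' x \<partial>N)" using eq[of 0 0] by (simp add: m_def)
  have [measurable]: "\<rho> \<in> borel_measurable M" "\<rho>' \<in> borel_measurable N" using \<rho> \<rho>' by auto
  have "m \<ge> 0" using \<rho> by (simp add: m_def)
  show ?thesis
  proof (cases "m = 0")
    case True
    have "AE x in M. \<rho> x = 0" using True \<rho> integral_nonneg_eq_0_iff_AE[of M \<rho>] by (simp add: m_def)
    then have "(\<integral>x. \<rho> x * indicator A (X x) \<partial>M) = (\<integral>x. 0 \<partial>M)" by (intro integral_cong_AE) auto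
    moreover have "AE x in N. \<rho>' x = 0" using True \<rho>' integral_nonneg_eq_0_iff_AE[of N \<rho>'] by (simp add: m')
    then have "(\<integral>x. \<rho>' x * indicator A (Y x) \<partial>N) = (\<integral>x. 0 \<partial>N)" by (intro integral_cong_AE) auto
    ultimately show ?thesis by simp
  next
    case False
    with \<open>m \<ge> 0\<close> have m: "m > 0" by simp
    have prob: "prob_space (density M (\<lambda>x. ennreal (\<rho> x / m)))"
      if "integrable M \<rho>" "\<And>x. \<rho> x \<ge> 0" "m = (\<integral>x. \<rho> x \<partial>M)" for M and \<rho> :: "'c \<Rightarrow> real"
    proof (rule prob_spaceI)
      have "emeasure (density M (\<lambda>x. ennreal (\<rho> x / m))) (space M) = (\<integral>\<^sup>+x. ennreal (\<rho> x / m) \<partial>M)"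
        using that by (subst emeasure_density) (auto intro!: nn_integral_cong)
      also have "\<dots> = ennreal (\<integral>x. \<rho> x / m \<partial>M)"
        using that m by (intro nn_integral_eq_integral) auto
      also have "\<dots> = 1" using that m by simp
      finally show "emeasure (density M (\<lambda>x. ennreal (\<rho> x / m))) (space (density M (\<lambda>x. ennreal (\<rho> x / m)))) = 1" by simp
    qed
    interpret P: prob_space "density M (\<lambda>x. ennreal (\<rho> x / m))" by (rule prob) (use \<rho> in \<open>auto simp: m_def\<close>)
    interpret Q: prob_space "density N (\<lambda>x. ennreal (\<rho>' x / m))" by (rule prob) (use \<rho>' m' in auto)
    let ?P = "distr (density M (\<lambda>x. ennreal (\<rho> x / m))) borel X"
    let ?Q = "distr (density N (\<lambda>x. ennreal (\<rho>' x / m))) borel Y"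
    have char: "char (distr (density M (\<lambda>x. ennreal (\<rho> x / m))) borel X) t =
        Complex ((\<integral>x. \<rho> x * cos (t * X x + 0) \<partial>M) / m) ((\<integral>x. \<rho> x * cos (t * X x + - (pi/2)) \<partial>M) / m)"
      if "integrable M \<rho>" "\<And>x. \<rho> x \<ge> 0" "X \<in> borel_measurable M" for M and \<rho> X :: "'c \<Rightarrow> real" and t
    proof -
      note [measurable] = that(3)
      have "char (distr (density M (\<lambda>x. ennreal (\<rho> x / m))) borel X) t = (\<integral>x. (\<rho> x / m) *\<^sub>R iexp (t * X x) \<partial>M)"
        unfolding char_def using that m by (subst integral_distr; simp) (subst integral_density; auto)
      also have "\<dots> = Complex (\<integral>x. \<rho> x / m * cos (t * X x) \<partial>M) (\<integral>x. \<rho> x / m * cos (t * X x - pi/2) \<partial>M)"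
        using that by (intro complex_integral_cos_sin) auto
      finally show ?thesis by simp
    qed
    have "?P = ?Q"
    proof (rule Levy_uniqueness)
      show "real_distribution ?P" by (rule P.real_distribution_distr) simp
      show "real_distribution ?Q" by (rule Q.real_distribution_distr) simp
      show "char ?P = char ?Q"
        using \<rho> \<rho>' by (intro ext) (simp only: char X Y eq)
    qed
    moreover have ind: "measure (distr (density M (\<lambda>x. ennreal (\<rho> x / m))) borel X) A = (\<integral>x. \<rho> x * indicator A (X x) \<partial>M) / m"
      if "integrable M \<rho>" "\<And>x. \<rho> x \<ge> 0" "X \<in> borel_measurable M" for M and \<rho> X :: "'c \<Rightarrow> real"
    proof -
      note [measurable] = that(3)
      have "measure (distr (density M (\<lambda>x. ennreal (\<rho> x / m))) borel X) A = (\<integral>z. indicator A z \<partial>distr (density M (\<lambda>x. ennreal (\<rho> x / m))) borel X)"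
        by simp
      also have "\<dots> = (\<integral>x. (\<rho> x / m) *\<^sub>R indicator A (X x) \<partial>M)"
        using that m by (subst integral_distr, simp, simp) (subst integral_density; auto)
      finally show ?thesis by simp
    qed
    ultimately have "(\<integral>x. \<rho> x * indicator A (X x) \<partial>M) / m = (\<integral>x. \<rho>' x * indicator A (Y x) \<partial>N) / m"
      using ind[OF \<rho> X] ind[OF \<rho>' Y] by (simp only:)
    with m show ?thesis by simp
  qed
qed

text \<open>The coordinates are converted one by one from trigonometric to indicator test functions; the weights
  \<open>1 + cos (\<dots>)\<close> keep the measures positive, so that the one-dimensional uniqueness theorem applies.\<close>

lemma cramer_wold_rectangles:
  fixes X :: "'i \<Rightarrow> 'a \<Rightarrow> real" and Y :: "'i \<Rightarrow> 'b \<Rightarrow> real"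
  assumes "prob_space M" "prob_space N" and I: "finite I"
    and X: "\<And>i. i \<in> I \<Longrightarrow> X i \<in> borel_measurable M" and Y: "\<And>i. i \<in> I \<Longrightarrow> Y i \<in> borel_measurable N"
    and eq: "\<And>a \<theta>. (\<integral>x. cos ((\<Sum>i\<in>I. a i * X i x) + \<theta>) \<partial>M) = (\<integral>x. cos ((\<Sum>i\<in>I. a i * Y i x) + \<theta>) \<partial>N)"
    and A: "\<And>i. i \<in> I \<Longrightarrow> A i \<in> sets borel"
  shows "measure M {x \<in> space M. \<forall>i\<in>I. X i x \<in> A i} = measure N {x \<in> space N. \<forall>i\<in>I. Y i x \<in> A i}"
proof -
  interpret M: prob_space M by fact
  interpret N: prob_space N by fact
  have prod01: "\<bar>\<Prod>j\<in>J. indicator (A j) (f j) :: real\<bar> \<le> 1" for J and f :: "'i \<Rightarrow> real"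
    unfolding abs_prod by (intro prod_le_1) (auto split: split_indicator)
  \<comment> \<open>Coordinates in \<open>J\<close> are already tested by indicators; the others
    still enter through the cosine of an arbitrary linear combination.\<close>
  have step: "J \<subseteq> I \<Longrightarrow> (\<integral>x. (\<Prod>j\<in>J. indicator (A j) (X j x)) * cos ((\<Sum>i\<in>I - J. a i * X i x) + \<theta>) \<partial>M) =
      (\<integral>x. (\<Prod>j\<in>J. indicator (A j) (Y j x)) * cos ((\<Sum>i\<in>I - J. a i * Y i x) + \<theta>) \<partial>N)" if "finite J" for J a \<theta>
    using that
  proof (induction J arbitrary: a \<theta> rule: finite_induct)
    case empty
    then show ?case using eq by simp
  next
    case (insert k J)
    then have k: "k \<in> I" "J \<subseteq> I" by auto
    note [measurable] = X[OF k(1)] Y[OF k(1)] A[OF k(1)]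
    have Xm[measurable]: "\<And>i. i \<in> J \<Longrightarrow> X i \<in> borel_measurable M" "\<And>i. i \<in> I - insert k J \<Longrightarrow> X i \<in> borel_measurable M"
      and Ym[measurable]: "\<And>i. i \<in> J \<Longrightarrow> Y i \<in> borel_measurable N" "\<And>i. i \<in> I - insert k J \<Longrightarrow> Y i \<in> borel_measurable N"
      and [measurable]: "\<And>i. i \<in> J \<Longrightarrow> A i \<in> sets borel" using X Y A k by auto
    let ?wX = "\<lambda>x. (\<Prod>j\<in>J. indicator (A j) (X j x)) :: real" and ?wY = "\<lambda>x. (\<Prod>j\<in>J. indicator (A j) (Y j x)) :: real"
    let ?uX = "\<lambda>x. (\<Sum>i\<in>I - insert k J. a i * X i x)" and ?uY = "\<lambda>x. (\<Sum>i\<in>I - insert k J. a i * Y i x)"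
    have iX: "integrable M ?wX" using prod01 by (intro M.integrable_const_bound[where B=1] AE_I2) auto
    have iY: "integrable N ?wY" using prod01 by (intro N.integrable_const_bound[where B=1] AE_I2) auto
    have split: "(\<Sum>i\<in>I - J. (b(k := t)) i * Z i) = t * Z k + (\<Sum>i\<in>I - insert k J. b i * Z i)" for b t and Z :: "'i \<Rightarrow> real"
    proof -
      have e: "I - J = insert k (I - insert k J)" using k insert.hyps by auto
      have "(\<Sum>i\<in>I - insert k J. (b(k := t)) i * Z i) = (\<Sum>i\<in>I - insert k J. b i * Z i)"
        by (intro sum.cong) auto
      then show ?thesis
        by (subst e, subst sum.insert) (use I in auto)
    qed
    have IH: "(\<integral>x. ?wX x * cos (t * X k x + (\<Sum>i\<in>I - insert k J. b i * X i x) + \<eta>) \<partial>M) =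
       (\<integral>x. ?wY x * cos (t * Y k x + (\<Sum>i\<in>I - insert k J. b i * Y i x) + \<eta>) \<partial>N)" for t b \<eta>
      using insert.IH[OF k(2), of "b(k := t)" \<eta>] unfolding split .
    have key: "(\<integral>x. ?wX x * (1 + cos (?uX x + \<eta>)) * indicator (A k) (X k x) \<partial>M) =
      (\<integral>x. ?wY x * (1 + cos (?uY x + \<eta>)) * indicator (A k) (Y k x) \<partial>N)" for \<eta>
    proof (rule weighted_Levy_uniqueness)
      show "integrable M (\<lambda>x. ?wX x * (1 + cos (?uX x + \<eta>)))"
        using iX by (intro integrable_mult_bounded[where C=2]) (auto intro!: order.trans[OF abs_triangle_ineq])
      show "integrable N (\<lambda>x. ?wY x * (1 + cos (?uY x + \<eta>)))"
        using iY by (intro integrable_mult_bounded[where C=2]) (auto intro!: order.trans[OF abs_triangle_ineq])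
      have c: "0 \<le> 1 + cos x" for x :: real using cos_ge_minus_one[of x] by linarith
      show "0 \<le> ?wX x * (1 + cos (?uX x + \<eta>))" for x by (intro mult_nonneg_nonneg prod_nonneg c) auto
      show "0 \<le> ?wY x * (1 + cos (?uY x + \<eta>))" for x by (intro mult_nonneg_nonneg prod_nonneg c) auto
      fix t \<theta>
      \<comment> \<open>Product-to-sum: each of the three terms is covered by the induction
        hypothesis, with coefficient \<open>t\<close> or \<open>- t\<close> at \<open>k\<close> and
        a new phase.\<close>
      have trig: "w * (1 + cos (u + \<eta>)) * cos (t * z + \<theta>) = w * cos (t * z + 0 + \<theta>) +
          (1/2) * (w * cos (t * z + u + (\<theta> + \<eta>))) + (1/2) * (w * cos ((- t) * z + u + (\<eta> - \<theta>)))" for w u z :: real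
      proof -
        have "cos (u + \<eta>) * cos (t * z + \<theta>) = (cos ((u + \<eta>) - (t * z + \<theta>)) + cos ((u + \<eta>) + (t * z + \<theta>))) / 2"
          by (rule cos_times_cos)
        also have "(u + \<eta>) - (t * z + \<theta>) = (- t) * z + u + (\<eta> - \<theta>)" by simp
        also have "(u + \<eta>) + (t * z + \<theta>) = t * z + u + (\<theta> + \<eta>)" by simp
        finally have e: "cos (u + \<eta>) * cos (t * z + \<theta>) =
          (cos ((- t) * z + u + (\<eta> - \<theta>)) + cos (t * z + u + (\<theta> + \<eta>))) / 2" .
        have "w * (1 + cos (u + \<eta>)) * cos (t * z + \<theta>) = w * cos (t * z + \<theta>) + w * (cos (u + \<eta>) * cos (t * z + \<theta>))"
          by (simp add: distrib_left distrib_right mult.assoc)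
        then show ?thesis unfolding e by (simp add: distrib_left add_divide_distrib)
      qed
      have X3: "(\<integral>x. ?wX x * (1 + cos (?uX x + \<eta>)) * cos (t * X k x + \<theta>) \<partial>M) =
         (\<integral>x. ?wX x * cos (t * X k x + 0 + \<theta>) \<partial>M) + (1/2) * (\<integral>x. ?wX x * cos (t * X k x + ?uX x + (\<theta> + \<eta>)) \<partial>M)
         + (1/2) * (\<integral>x. ?wX x * cos ((- t) * X k x + ?uX x + (\<eta> - \<theta>)) \<partial>M)"
        unfolding trig using integrable_mult_bounded[OF iX, where C=1] by simp
      have Y3: "(\<integral>x. ?wY x * (1 + cos (?uY x + \<eta>)) * cos (t * Y k x + \<theta>) \<partial>N) =
         (\<integral>x. ?wY x * cos (t * Y k x + 0 + \<theta>) \<partial>N) + (1/2) * (\<integral>x. ?wY x * cos (t * Y k x + ?uY x + (\<theta> + \<eta>)) \<partial>N)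
         + (1/2) * (\<integral>x. ?wY x * cos ((- t) * Y k x + ?uY x + (\<eta> - \<theta>)) \<partial>N)"
        unfolding trig using integrable_mult_bounded[OF iY, where C=1] by simp
      have "(\<integral>x. ?wX x * cos (t * X k x + 0 + \<theta>) \<partial>M) = (\<integral>x. ?wY x * cos (t * Y k x + 0 + \<theta>) \<partial>N)"
        using IH[of t "\<lambda>_. 0" \<theta>] by simp
      then show "(\<integral>x. ?wX x * (1 + cos (?uX x + \<eta>)) * cos (t * X k x + \<theta>) \<partial>M) =
        (\<integral>x. ?wY x * (1 + cos (?uY x + \<eta>)) * cos (t * Y k x + \<theta>) \<partial>N)"
        unfolding X3 Y3 IH by simp
    qed measurable
    have iX': "integrable M (\<lambda>x. ?wX x * indicator (A k) (X k x))"
      using iX by (intro integrable_mult_bounded[where C=1]) (auto split: split_indicator)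
    have iY': "integrable N (\<lambda>x. ?wY x * indicator (A k) (Y k x))"
      using iY by (intro integrable_mult_bounded[where C=1]) (auto split: split_indicator)
    let ?cX = "\<lambda>\<eta>. \<integral>x. ?wX x * indicator (A k) (X k x) * cos (?uX x + \<eta>) \<partial>M"
    let ?cY = "\<lambda>\<eta>. \<integral>x. ?wY x * indicator (A k) (Y k x) * cos (?uY x + \<eta>) \<partial>N"
    let ?dX = "\<integral>x. ?wX x * indicator (A k) (X k x) \<partial>M" and ?dY = "\<integral>x. ?wY x * indicator (A k) (Y k x) \<partial>N"
    have "?dX + ?cX \<eta> = ?dY + ?cY \<eta>" for \<eta>
    proof -
      have "(\<integral>x. ?wX x * (1 + cos (?uX x + \<eta>)) * indicator (A k) (X k x) \<partial>M) = ?dX + ?cX \<eta>"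
      proof -
        have "(\<integral>x. ?wX x * (1 + cos (?uX x + \<eta>)) * indicator (A k) (X k x) \<partial>M) =
          (\<integral>x. ?wX x * indicator (A k) (X k x) + ?wX x * indicator (A k) (X k x) * cos (?uX x + \<eta>) \<partial>M)"
          by (intro Bochner_Integration.integral_cong refl) (simp add: algebra_simps)
        also have "\<dots> = ?dX + ?cX \<eta>"
          by (intro Bochner_Integration.integral_add iX' integrable_mult_bounded[OF iX', where C=1]) auto
        finally show ?thesis .
      qed
      moreover have "(\<integral>x. ?wY x * (1 + cos (?uY x + \<eta>)) * indicator (A k) (Y k x) \<partial>N) = ?dY + ?cY \<eta>"
      proof -
        have "(\<integral>x. ?wY x * (1 + cos (?uY x + \<eta>)) * indicator (A k) (Y k x) \<partial>N) =
          (\<integral>x. ?wY x * indicator (A k) (Y k x) + ?wY x * indicator (A k) (Y k x) * cos (?uY x + \<eta>) \<partial>N)"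
          by (intro Bochner_Integration.integral_cong refl) (simp add: algebra_simps)
        also have "\<dots> = ?dY + ?cY \<eta>"
          by (intro Bochner_Integration.integral_add iY' integrable_mult_bounded[OF iY', where C=1]) auto
        finally show ?thesis .
      qed
      ultimately show ?thesis using key by simp
    qed
    \<comment> \<open>A phase shift by \<open>pi\<close> reverses the sign of the cosine, so
      subtracting the two equations removes the contribution of the constant 1 in the
      weight.\<close>
    from this[of \<theta>] this[of "\<theta> + pi"] have "?cX \<theta> = ?cY \<theta>"
      by (simp add: add.assoc[symmetric])
    then show ?case using insert.hyps by (simp add: mult_ac)
  qed
  have ind: "(\<Prod>j\<in>I. indicator (A j) (f j)) = (if \<forall>j\<in>I. f j \<in> A j then 1 else (0::real))" for f
    using I by (auto simp: indicator_def)
  have "measure M {x \<in> space M. \<forall>i\<in>I. X i x \<in> A i} = (\<integral>x. indicator {x \<in> space M. \<forall>i\<in>I. X i x \<in> A i} x \<partial>M)"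
    by (simp add: Int_absorb2 subset_eq)
  also have "\<dots> = (\<integral>x. (\<Prod>j\<in>I. indicator (A j) (X j x)) \<partial>M)"
    unfolding ind by (intro Bochner_Integration.integral_cong) (auto simp: indicator_def)
  also have "\<dots> = (\<integral>x. (\<Prod>j\<in>I. indicator (A j) (Y j x)) \<partial>N)"
    using step[OF I subset_refl, of "\<lambda>_. 0" 0] by simp
  also have "\<dots> = (\<integral>x. indicator {x \<in> space N. \<forall>i\<in>I. Y i x \<in> A i} x \<partial>N)"
    unfolding ind by (intro Bochner_Integration.integral_cong) (auto simp: indicator_def)
  also have "\<dots> = measure N {x \<in> space N. \<forall>i\<in>I. Y i x \<in> A i}"
    by (simp add: Int_absorb2 subset_eq)
  finally show ?thesis .
qed

text \<open>The density shifted by \<open>\<sigma>\<close> is the original one times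
  \<open>exp (- (\<sigma>\<^sup>2) / 2) * exp (z * \<sigma>)\<close>. Adding the shift by
  \<open>- \<sigma>\<close> replaces the last factor by a sum of exponentials of opposite arguments,
  which is at least 2 pointwise; hence \<open>B\<close> need not be symmetric.\<close>

lemma std_normal_shift_average:
  assumes B: "B \<in> sets borel"
  shows "2 * (ennreal (exp (- (\<sigma>\<^sup>2) / 2)) * emeasure std_normal_distribution B) \<le>
    emeasure std_normal_distribution {z. z + \<sigma> \<in> B} + emeasure std_normal_distribution {z. z - \<sigma> \<in> B}"
proof -
  note [measurable] = B
  have sh: "emeasure std_normal_distribution {z. z + s \<in> B} = (\<integral>\<^sup>+z. ennreal (std_normal_density (z - s)) * indicator B z \<partial>lborel)" for s
  proof -
    have "{z. z + s \<in> B} \<in> sets lborel" using measurable_sets[of "\<lambda>z::real. z + s" borel borel B] B by (simp add: vimage_def)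
    then have "emeasure std_normal_distribution {z. z + s \<in> B} = (\<integral>\<^sup>+z. ennreal (std_normal_density z) * indicator {z. z + s \<in> B} z \<partial>lborel)"
      by (subst emeasure_density) auto
    also have "\<dots> = (\<integral>\<^sup>+z. ennreal (std_normal_density (- s + 1 * z)) * indicator {z. z + s \<in> B} (- s + 1 * z) \<partial>lborel)"
      using \<open>{z. z + s \<in> B} \<in> sets lborel\<close> by (subst nn_integral_real_affine[where c = 1 and t = "- s"]) auto
    also have "\<dots> = (\<integral>\<^sup>+z. ennreal (std_normal_density (z - s)) * indicator B z \<partial>lborel)"
      by (intro nn_integral_cong) (auto split: split_indicator)
    finally show ?thesis .
  qed
  have pw: "2 * exp (- (\<sigma>\<^sup>2) / 2) * std_normal_density z \<le> std_normal_density (z - \<sigma>) + std_normal_density (z - - \<sigma>)" for z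
  proof -
    have 1: "exp (- ((z - s)\<^sup>2) / 2) = exp (- (z\<^sup>2) / 2) * exp (- (s\<^sup>2) / 2) * exp (z * s)" for s
      by (simp add: power2_eq_square algebra_simps flip: exp_add) (simp add: field_simps)
    have "2 \<le> exp (z * \<sigma>) + exp (z * (- \<sigma>))"
    proof -
      have "1 + z * \<sigma> \<le> exp (z * \<sigma>)" "1 + z * (- \<sigma>) \<le> exp (z * (- \<sigma>))"
        by (rule exp_ge_add_one_self)+
      then show ?thesis unfolding mult_minus_right by linarith
    qed
    then have "exp (- (z\<^sup>2) / 2) * exp (- (\<sigma>\<^sup>2) / 2) * 2 \<le> exp (- (z\<^sup>2) / 2) * exp (- (\<sigma>\<^sup>2) / 2) * (exp (z * \<sigma>) + exp (z * (- \<sigma>)))"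
      by (intro mult_left_mono) auto
    also have "\<dots> = exp (- ((z - \<sigma>)\<^sup>2) / 2) + exp (- ((z - - \<sigma>)\<^sup>2) / 2)"
      unfolding 1 by (simp add: algebra_simps)
    finally have "(1 / sqrt (2 * pi)) * (exp (- (z\<^sup>2) / 2) * exp (- (\<sigma>\<^sup>2) / 2) * 2) \<le>
       (1 / sqrt (2 * pi)) * (exp (- ((z - \<sigma>)\<^sup>2) / 2) + exp (- ((z - - \<sigma>)\<^sup>2) / 2))"
      by (intro mult_left_mono) auto
    then show ?thesis by (simp add: std_normal_density_def distrib_left mult_ac)
  qed
  have "2 * (ennreal (exp (- (\<sigma>\<^sup>2) / 2)) * emeasure std_normal_distribution B) =
    ennreal (2 * exp (- (\<sigma>\<^sup>2) / 2)) * (\<integral>\<^sup>+z. ennreal (std_normal_density z) * indicator B z \<partial>lborel)"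
    by (simp add: ennreal_mult' mult.assoc emeasure_density)
  also have "\<dots> = (\<integral>\<^sup>+z. ennreal (2 * exp (- (\<sigma>\<^sup>2) / 2)) * (ennreal (std_normal_density z) * indicator B z) \<partial>lborel)"
    by (subst nn_integral_cmult) auto
  also have "\<dots> \<le> (\<integral>\<^sup>+z. ennreal (std_normal_density (z - \<sigma>)) * indicator B z + ennreal (std_normal_density (z - - \<sigma>)) * indicator B z \<partial>lborel)"
  proof (rule nn_integral_mono)
    fix z
    show "ennreal (2 * exp (- (\<sigma>\<^sup>2) / 2)) * (ennreal (std_normal_density z) * indicator B z) \<le>
      ennreal (std_normal_density (z - \<sigma>)) * indicator B z + ennreal (std_normal_density (z - - \<sigma>)) * indicator B z"
    proof (cases "z \<in> B")
      case True
      have "ennreal (2 * exp (- (\<sigma>\<^sup>2) / 2)) * ennreal (std_normal_density z) \<le> ennreal (std_normal_density (z - \<sigma>)) + ennreal (std_normal_density (z - - \<sigma>))"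
        using pw[of z] by (subst ennreal_mult'[symmetric], simp, subst ennreal_plus[symmetric], simp, simp, intro ennreal_leI)
      then show ?thesis using True by simp
    qed simp
  qed
  also have "\<dots> = (\<integral>\<^sup>+z. ennreal (std_normal_density (z - \<sigma>)) * indicator B z \<partial>lborel) + (\<integral>\<^sup>+z. ennreal (std_normal_density (z - - \<sigma>)) * indicator B z \<partial>lborel)"
    by (intro nn_integral_add) auto
  also have "\<dots> = emeasure std_normal_distribution {z. z + \<sigma> \<in> B} + emeasure std_normal_distribution {z. z - \<sigma> \<in> B}"
    using sh[of \<sigma>] sh[of "- \<sigma>"] by simp
  finally show ?thesis .
qed

lemma std_normal_integral_cos:
  "(\<integral>z. cos (v + s * z) \<partial>std_normal_distribution) = exp (- (s\<^sup>2) / 2) * cos v"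
proof -
  interpret real_distribution std_normal_distribution by (rule real_dist_normal_dist)
  have "(\<integral>z. 1 *\<^sub>R iexp (s * z) \<partial>std_normal_distribution) = complex_of_real (exp (- (s\<^sup>2) / 2))"
    using fun_cong[OF char_std_normal_distribution, of s] by (simp add: char_def)
  moreover have "(\<integral>z. 1 *\<^sub>R iexp (s * z) \<partial>std_normal_distribution) =
      Complex (\<integral>z. 1 * cos (s * z) \<partial>std_normal_distribution) (\<integral>z. 1 * cos (s * z - pi/2) \<partial>std_normal_distribution)"
    by (rule complex_integral_cos_sin) auto
  ultimately have c: "(\<integral>z. cos (s * z) \<partial>std_normal_distribution) = exp (- (s\<^sup>2) / 2)"
    and sn: "(\<integral>z. sin (s * z) \<partial>std_normal_distribution) = 0"
    by (auto simp: complex_eq_iff cos_diff)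
  have "integrable std_normal_distribution (\<lambda>z. cos (s * z))" "integrable std_normal_distribution (\<lambda>z. sin (s * z))"
    by (auto intro!: integrable_const_bound[where B=1])
  then have "(\<integral>z. cos v * cos (s * z) - sin v * sin (s * z) \<partial>std_normal_distribution) = cos v * exp (- (s\<^sup>2) / 2)"
    by (simp add: c sn)
  then show ?thesis by (simp add: cos_add mult.commute)
qed

text \<open>With \<open>Z = \<Sum>\<^sub>j c\<^sub>j X\<^sub>j\<close>, where \<open>Cov(X\<^sub>i, Z) = m\<^sub>i\<close> and \<open>\<sigma>\<^sup>2 = Var Z\<close>, the vector \<open>X\<close> has the law of
  \<open>X - (Z/\<sigma>\<^sup>2) m + (z/\<sigma>) m\<close> for an independent standard normal variable \<open>z\<close>. Shifting by \<open>\<plusminus>m\<close> shifts \<open>z\<close> by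
  \<open>\<plusminus>\<sigma>\<close>, and both shifts are equally likely to stay in a symmetric box.\<close>

lemma gaussian_vector_shift:
  fixes X :: "'i \<Rightarrow> 'a \<Rightarrow> real"
  assumes M: "prob_space M" and I: "finite I"
    and X: "\<And>i. i \<in> I \<Longrightarrow> X i \<in> borel_measurable M"
    and sym: "\<And>i j. R i j = R j i"
    and gauss: "\<And>a \<theta>. (\<integral>x. cos ((\<Sum>i\<in>I. a i * X i x) + \<theta>) \<partial>M) = exp (- quad_form I R a / 2) * cos \<theta>"
    and K: "0 \<le> K" and psd: "\<And>a. 0 \<le> quad_form I R a"
    and bound: "\<And>a. (\<Sum>i\<in>I. a i * m i)\<^sup>2 \<le> K * quad_form I R a"
  shows "exp (- K / 2) * measure M {x \<in> space M. \<forall>i\<in>I. \<bar>X i x\<bar> \<le> r i}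
    \<le> measure M {x \<in> space M. \<forall>i\<in>I. \<bar>X i x + m i\<bar> \<le> r i}"
proof -
  interpret M: prob_space M by fact
  interpret G: real_distribution std_normal_distribution by (rule real_dist_normal_dist)
  interpret MG: pair_prob_space M std_normal_distribution ..
  obtain c where c: "\<And>i. i \<in> I \<Longrightarrow> m i = (\<Sum>j\<in>I. R i j * c j)"
    using quad_form_range[OF I sym psd bound] by blast
  define q where "q = quad_form I R c"
  have qm: "q = (\<Sum>i\<in>I. c i * m i)" unfolding q_def using c by (rule quad_form_range_self)
  have q0: "0 \<le> q" unfolding q_def by (rule psd)
  have addq: "quad_form I R (\<lambda>i. a i + t * c i) = quad_form I R a + 2 * t * (\<Sum>i\<in>I. a i * m i) + t\<^sup>2 * q" for a t
    unfolding q_def by (rule quad_form_add_scaled[OF I sym c])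
  let ?P = "\<lambda>s. measure M {x \<in> space M. \<forall>i\<in>I. \<bar>X i x + s * m i\<bar> \<le> r i}"
  show ?thesis
  proof (cases "q = 0")
    case True
    \<comment> \<open>The degenerate case: along the line \<open>?a + t * c\<close> the nonnegative
      form is now affine in \<open>t\<close>, so its slope \<open>2 * m i\<close> is 0 and there is
      no shift at all.\<close>
    have m0: "m i = 0" if "i \<in> I" for i
    proof -
      let ?a = "\<lambda>j. if j = i then 1 else 0"
      have "(\<Sum>j\<in>I. ?a j * m j) = (\<Sum>j\<in>I. if j = i then m j else 0)" by (intro sum.cong) auto
      also have "\<dots> = m i" using I that by simp
      finally have s: "(\<Sum>j\<in>I. ?a j * m j) = m i" .
      have "0 \<le> quad_form I R ?a + t * (2 * m i)" for t
      proof -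
        have "0 \<le> quad_form I R (\<lambda>j. ?a j + t * c j)" by (rule psd)
        also have "\<dots> = quad_form I R ?a + 2 * t * m i + t\<^sup>2 * q"
          unfolding addq s ..
        finally show ?thesis using True by (simp add: mult_ac)
      qed
      from affine_nonneg_imp_zero[OF this] show ?thesis by simp
    qed
    have "exp (- K / 2) * ?P 0 \<le> 1 * ?P 0"
      using K by (intro mult_right_mono) auto
    also have "\<dots> = measure M {x \<in> space M. \<forall>i\<in>I. \<bar>X i x + m i\<bar> \<le> r i}"
      using m0 by (auto intro!: arg_cong[where f="measure M"])
    finally show ?thesis by simp
  next
    case False
    with q0 have q: "0 < q" by simp
    \<comment> \<open>The assumed bound at \<open>a = c\<close>, where the linear functional and the
      form both equal \<open>q\<close>.\<close>
    have "q\<^sup>2 \<le> K * q" using bound[of c] unfolding qm[symmetric] q_def[symmetric] .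
    then have qK: "q \<le> K" using q by (simp add: power2_eq_square)
    define \<sigma> where "\<sigma> = sqrt q"
    have \<sigma>: "0 < \<sigma>" "\<sigma>\<^sup>2 = q" using q by (auto simp: \<sigma>_def)
    define Y where "Y i x = X i x - m i * (\<Sum>j\<in>I. c j * X j x) / q" for i x
    define X' where "X' i p = Y i (fst p) + m i * snd p / \<sigma>" for i and p :: "'a \<times> real"
    let ?N = "M \<Otimes>\<^sub>M std_normal_distribution"
    have Ym: "Y i \<in> borel_measurable M" if "i \<in> I" for i
      unfolding Y_def[abs_def] using X that by measurable
    have X'm: "X' i \<in> borel_measurable ?N" if "i \<in> I" for i
      unfolding X'_def[abs_def] using Ym[OF that] by measurable
    have law: "(\<integral>p. cos ((\<Sum>i\<in>I. a i * X' i p) + \<theta>) \<partial>?N) = exp (- quad_form I R a / 2) * cos \<theta>" for a \<theta>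
    proof -
      define am where "am = (\<Sum>i\<in>I. a i * m i)"
      \<comment> \<open>Passing from X to \<open>Y\<close> in a linear combination amounts to
        replacing its coefficients \<open>a\<close> by \<open>a + t * c\<close>.\<close>
      define t where "t = - am / q"
      have X'_sum: "(\<Sum>i\<in>I. a i * X' i (x, z)) = (\<Sum>i\<in>I. (a i + t * c i) * X i x) + am / \<sigma> * z" for x z
      proof -
        have "(\<Sum>i\<in>I. a i * X' i (x, z)) = (\<Sum>i\<in>I. a i * X i x) - am * (\<Sum>j\<in>I. c j * X j x) / q + am * z / \<sigma>"
        proof -
          have "(\<Sum>i\<in>I. a i * (m i * w / d)) = am * w / d" for w d
            by (simp add: am_def sum_distrib_right sum_divide_distrib mult.assoc)
          then show ?thesis
            unfolding X'_def Y_def fst_conv snd_conv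
            by (simp add: distrib_left right_diff_distrib sum.distrib sum_subtractf)
        qed
        also have "\<dots> = (\<Sum>i\<in>I. (a i + t * c i) * X i x) + am / \<sigma> * z"
          by (simp add: t_def algebra_simps sum.distrib sum_subtractf sum_distrib_left sum_divide_distrib)
        finally show ?thesis .
      qed
      have "integrable ?N (\<lambda>p. cos ((\<Sum>i\<in>I. a i * X' i p) + \<theta>))"
        using X'm by (intro MG.P.integrable_const_bound[where B=1] AE_I2) auto
      then have "(\<integral>p. cos ((\<Sum>i\<in>I. a i * X' i p) + \<theta>) \<partial>?N) =
          (\<integral>x. (\<integral>z. cos ((\<Sum>i\<in>I. a i * X' i (x, z)) + \<theta>) \<partial>std_normal_distribution) \<partial>M)"
        by (rule MG.integral_fst'[symmetric])
      also have "\<dots> = (\<integral>x. (\<integral>z. cos (((\<Sum>i\<in>I. (a i + t * c i) * X i x) + \<theta>) + am / \<sigma> * z) \<partial>std_normal_distribution) \<partial>M)"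
        unfolding X'_sum by (simp add: add_ac)
      also have "\<dots> = exp (- ((am / \<sigma>)\<^sup>2) / 2) * (\<integral>x. cos ((\<Sum>i\<in>I. (a i + t * c i) * X i x) + \<theta>) \<partial>M)"
        unfolding std_normal_integral_cos by simp
      also have "\<dots> = exp (- ((am / \<sigma>)\<^sup>2) / 2) * exp (- (quad_form I R a + 2 * t * am + t\<^sup>2 * q) / 2) * cos \<theta>"
        unfolding gauss addq am_def[symmetric] by simp
      also have "\<dots> = exp (- ((am / \<sigma>)\<^sup>2) / 2 + - (quad_form I R a + 2 * t * am + t\<^sup>2 * q) / 2) * cos \<theta>"
        unfolding exp_add ..
      \<comment> \<open>The projection takes away the variance \<open>am\<^sup>2 / q\<close>, and
        the normal variable gives it back.\<close>
      also have "- ((am / \<sigma>)\<^sup>2) / 2 + - (quad_form I R a + 2 * t * am + t\<^sup>2 * q) / 2 = - quad_form I R a / 2"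
        using q unfolding power_divide \<sigma>(2) t_def by (simp add: field_simps power2_eq_square)
      finally show ?thesis .
    qed
    let ?Q = "\<lambda>s. measure ?N {p \<in> space ?N. \<forall>i\<in>I. \<bar>X' i p + s * m i\<bar> \<le> r i}"
    have PQ: "?P s = ?Q s" for s
    proof -
      have "measure M {x \<in> space M. \<forall>i\<in>I. X i x \<in> {y. \<bar>y + s * m i\<bar> \<le> r i}} =
        measure ?N {p \<in> space ?N. \<forall>i\<in>I. X' i p \<in> {y. \<bar>y + s * m i\<bar> \<le> r i}}"
      proof (rule cramer_wold_rectangles[OF M MG.P.prob_space_axioms I X X'm])
        show "{y. \<bar>y + s * m i\<bar> \<le> r i} \<in> sets borel" for i by measurable
      qed (simp_all only: gauss law)
      then show ?thesis by simp
    qed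
    \<comment> \<open>\<open>X\<close> and \<open>- X\<close> have the same law, and the box is
      symmetric.\<close>
    have sym_P: "?P (-1) = ?P 1"
    proof -
      have "measure M {x \<in> space M. \<forall>i\<in>I. X i x \<in> {y. \<bar>y + m i\<bar> \<le> r i}} =
        measure M {x \<in> space M. \<forall>i\<in>I. - X i x \<in> {y. \<bar>y + m i\<bar> \<le> r i}}"
      proof (rule cramer_wold_rectangles[OF M M I X])
        fix a \<theta>
        have "(\<integral>x. cos ((\<Sum>i\<in>I. a i * - X i x) + \<theta>) \<partial>M) = (\<integral>x. cos ((\<Sum>i\<in>I. a i * X i x) + - \<theta>) \<partial>M)"
        proof (rule Bochner_Integration.integral_cong)
          fix x
          have "(\<Sum>i\<in>I. a i * - X i x) + \<theta> = - ((\<Sum>i\<in>I. a i * X i x) + - \<theta>)" by (simp add: sum_negf)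
          then show "cos ((\<Sum>i\<in>I. a i * - X i x) + \<theta>) = cos ((\<Sum>i\<in>I. a i * X i x) + - \<theta>)"
            by (simp only: cos_minus)
        qed simp
        then show "(\<integral>x. cos ((\<Sum>i\<in>I. a i * X i x) + \<theta>) \<partial>M) = (\<integral>x. cos ((\<Sum>i\<in>I. a i * - X i x) + \<theta>) \<partial>M)"
          unfolding gauss by simp
        show "{y. \<bar>y + m i\<bar> \<le> r i} \<in> sets borel" for i by measurable
      qed (use X in auto)
      moreover have "\<bar>- X i x + m i\<bar> = \<bar>X i x + -1 * m i\<bar>" for i x by simp
      ultimately show ?thesis by simp
    qed
    \<comment> \<open>The box seen along the normal coordinate at a fixed \<open>x\<close>: shifting
      \<open>X'\<close> by \<open>s * m\<close> is the same as shifting \<open>z\<close> by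
      \<open>s * \<sigma>\<close>.\<close>
    define B where "B x = {z. \<forall>i\<in>I. \<bar>Y i x + m i * z / \<sigma>\<bar> \<le> r i}" for x
    have B: "B x \<in> sets borel" for x unfolding B_def using I by measurable
    have Q: "ennreal (?Q s) = (\<integral>\<^sup>+x. emeasure std_normal_distribution {z. z + s * \<sigma> \<in> B x} \<partial>M)"
      and Qm: "(\<lambda>x. emeasure std_normal_distribution {z. z + s * \<sigma> \<in> B x}) \<in> borel_measurable M" for s
    proof -
      let ?E = "{p \<in> space ?N. \<forall>i\<in>I. \<bar>X' i p + s * m i\<bar> \<le> r i}"
      have E: "?E \<in> sets ?N" using X'm I by measurable
      have sec: "Pair x -` ?E = {z. z + s * \<sigma> \<in> B x}" if "x \<in> space M" for x
        using that \<sigma> by (auto simp: space_pair_measure X'_def B_def add_divide_distrib distrib_left add.assoc mult_ac)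
      show "ennreal (?Q s) = (\<integral>\<^sup>+x. emeasure std_normal_distribution {z. z + s * \<sigma> \<in> B x} \<partial>M)"
        unfolding MG.P.emeasure_eq_measure[symmetric] G.emeasure_pair_measure_alt[OF E]
        by (intro nn_integral_cong arg_cong[where f = "emeasure std_normal_distribution"] sec)
      show "(\<lambda>x. emeasure std_normal_distribution {z. z + s * \<sigma> \<in> B x}) \<in> borel_measurable M"
        using G.measurable_emeasure_Pair[OF E] by (rule measurable_cong[THEN iffD1, rotated]) (simp only: sec)
    qed
    have "ennreal (2 * (exp (- q / 2) * ?Q 0)) = (\<integral>\<^sup>+x. 2 * (ennreal (exp (- (\<sigma>\<^sup>2) / 2)) * emeasure std_normal_distribution (B x)) \<partial>M)"
    proof -
      have "ennreal (2 * (exp (- q / 2) * ?Q 0)) = 2 * (ennreal (exp (- (\<sigma>\<^sup>2) / 2)) * ennreal (?Q 0))"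
        by (simp add: ennreal_mult' \<sigma>)
      also have "\<dots> = (\<integral>\<^sup>+x. 2 * (ennreal (exp (- (\<sigma>\<^sup>2) / 2)) * emeasure std_normal_distribution (B x)) \<partial>M)"
        unfolding Q using Qm[of 0] by (simp add: nn_integral_cmult)
      finally show ?thesis .
    qed
    also have "\<dots> \<le> (\<integral>\<^sup>+x. emeasure std_normal_distribution {z. z + 1 * \<sigma> \<in> B x} + emeasure std_normal_distribution {z. z + (-1) * \<sigma> \<in> B x} \<partial>M)"
      using std_normal_shift_average[OF B, of \<sigma>] by (intro nn_integral_mono) simp
    also have "\<dots> = ennreal (?Q 1) + ennreal (?Q (-1))"
      unfolding Q by (intro nn_integral_add Qm)
    also have "\<dots> = ennreal (2 * ?P 1)"
      unfolding PQ[symmetric] sym_P by (simp flip: ennreal_plus)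
    finally have "2 * (exp (- q / 2) * ?Q 0) \<le> 2 * ?P 1"
      by (subst (asm) ennreal_le_iff) auto
    then have "exp (- q / 2) * ?P 0 \<le> ?P 1" unfolding PQ by simp
    moreover have "exp (- K / 2) * ?P 0 \<le> exp (- q / 2) * ?P 0"
      using qK by (intro mult_right_mono) auto
    ultimately show ?thesis by simp
  qed
qed

section \<open>Finite-dimensional laws of the processes\<close>

context prob_space
begin

text \<open>The expectation being real, the sine integral vanishes, and a phase contributes only the
  factor \<open>cos \<theta>\<close>.\<close>

lemma expectation_cos_of_iexp:
  assumes [measurable]: "V \<in> borel_measurable M" and "(\<integral>x. iexp (V x) \<partial>M) = complex_of_real e"
  shows "(\<integral>x. cos (V x + \<theta>) \<partial>M) = e * cos \<theta>"
proof -
  have "(\<integral>x. 1 *\<^sub>R iexp (V x) \<partial>M) = Complex (\<integral>x. 1 * cos (V x) \<partial>M) (\<integral>x. 1 * cos (V x - pi/2) \<partial>M)"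
    by (rule complex_integral_cos_sin) auto
  with assms(2) have c: "(\<integral>x. cos (V x) \<partial>M) = e" and s: "(\<integral>x. sin (V x) \<partial>M) = 0"
    by (auto simp: complex_eq_iff cos_diff)
  have "integrable M (\<lambda>x. cos (V x))" "integrable M (\<lambda>x. sin (V x))"
    by (auto intro!: integrable_const_bound[where B=1])
  then have "(\<integral>x. cos \<theta> * cos (V x) - sin \<theta> * sin (V x) \<partial>M) = cos \<theta> * e"
    by (simp add: c s)
  then show ?thesis by (simp add: cos_add mult.commute)
qed

lemma normal_iexp:
  assumes \<sigma>: "\<sigma> > 0" and D: "distributed M lborel V (\<lambda>x. ennreal (normal_density 0 \<sigma> x))"
  shows "(\<integral>x. iexp (c * V x) \<partial>M) = complex_of_real (exp (- ((c * \<sigma>)\<^sup>2) / 2))"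
proof -
  have D': "distributed M lborel (\<lambda>x. (V x - 0) / \<sigma>) std_normal_density"
    using normal_standard_normal_convert[OF \<sigma>, of V 0] D by simp
  have [measurable]: "(\<lambda>x. (V x - 0) / \<sigma>) \<in> M \<rightarrow>\<^sub>M lborel" using D' by (simp add: distributed_def)
  have "(\<integral>x. iexp (c * V x) \<partial>M) = (\<integral>x. iexp (c * \<sigma> * ((V x - 0) / \<sigma>)) \<partial>M)"
    using \<sigma> by simp
  also have "\<dots> = (\<integral>z. iexp (c * \<sigma> * z) \<partial>distr M lborel (\<lambda>x. (V x - 0) / \<sigma>))"
    by (rule integral_distr[symmetric]) measurable
  also have "distr M lborel (\<lambda>x. (V x - 0) / \<sigma>) = std_normal_distribution"
    using D' by (simp add: distributed_def)
  also have "(\<integral>z. iexp (c * \<sigma> * z) \<partial>std_normal_distribution) = complex_of_real (exp (- ((c * \<sigma>)\<^sup>2) / 2))"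
    using fun_cong[OF char_std_normal_distribution, of "c * \<sigma>"] by (simp add: char_def)
  finally show ?thesis .
qed

lemma normal_square_integrable:
  assumes \<sigma>: "\<sigma> > 0" and D: "distributed M lborel V (\<lambda>x. ennreal (normal_density m \<sigma> x))"
  shows "integrable M (\<lambda>x. (V x)\<^sup>2)" "integrable M V"
proof -
  have D': "distributed M lborel (\<lambda>x. (V x - m) / \<sigma>) std_normal_density"
    using normal_standard_normal_convert[OF \<sigma>, of V m] D by simp
  have k: "integrable M (\<lambda>x. ((V x - m) / \<sigma>) ^ k)" for k
    using integrable_std_normal_moment[of k] distributed_integrable[OF D', of "\<lambda>x. x ^ k"] by simp
  have V: "V x = \<sigma> * ((V x - m) / \<sigma>) ^ 1 + m" for x using \<sigma> by simp
  have "integrable M (\<lambda>x. \<sigma> * ((V x - m) / \<sigma>) ^ 1 + m)" using k[of 1] by (intro Bochner_Integration.integrable_add integrable_mult_right) auto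
  then show "integrable M V" unfolding V[symmetric] .
  have "(V x)\<^sup>2 = \<sigma>\<^sup>2 * ((V x - m) / \<sigma>) ^ 2 + 2 * m * V x - m\<^sup>2" for x
    using \<sigma> by (simp add: power2_eq_square field_simps)
  then show "integrable M (\<lambda>x. (V x)\<^sup>2)" using k[of 2] \<open>integrable M V\<close> by simp
qed

lemma gaussian_rv_square_integrable:
  assumes "gaussian_rv V"
  shows "integrable M (\<lambda>x. (V x)\<^sup>2)" "integrable M V"
proof -
  have [measurable]: "V \<in> borel_measurable M" using assms by (simp add: gaussian_rv_def)
  consider m where "AE \<omega> in M. V \<omega> = m" |
    m \<sigma> where "\<sigma> > 0" "distributed M lborel V (\<lambda>x. ennreal (normal_density m \<sigma> x))"
    using assms by (auto simp: gaussian_rv_def)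
  then have "integrable M (\<lambda>x. (V x)\<^sup>2) \<and> integrable M V"
  proof cases
    case 1
    have "integrable M (\<lambda>x. (V x)\<^sup>2) \<longleftrightarrow> integrable M (\<lambda>x. m\<^sup>2)"
      using 1 by (intro integrable_cong_AE) auto
    moreover have "integrable M V \<longleftrightarrow> integrable M (\<lambda>x. m)"
      using 1 by (intro integrable_cong_AE) auto
    ultimately show ?thesis by simp
  qed (use normal_square_integrable in blast)
  then show "integrable M (\<lambda>x. (V x)\<^sup>2)" "integrable M V" by auto
qed

lemma gaussian_rv_cos:
  assumes "gaussian_rv V" and E: "expectation V = 0"
  shows "(\<integral>x. cos (V x + \<theta>) \<partial>M) = exp (- expectation (\<lambda>x. (V x)\<^sup>2) / 2) * cos \<theta>"
proof -
  have [measurable]: "V \<in> borel_measurable M" using assms by (simp add: gaussian_rv_def)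
  consider m where "AE \<omega> in M. V \<omega> = m" |
    m \<sigma> where "\<sigma> > 0" "distributed M lborel V (\<lambda>x. ennreal (normal_density m \<sigma> x))"
    using assms by (auto simp: gaussian_rv_def)
  then show ?thesis
  proof cases
    case 1
    have "expectation V = expectation (\<lambda>_. m)" using 1 by (intro integral_cong_AE) auto
    then have "m = 0" using E by (simp add: prob_space)
    have "expectation (\<lambda>x. (V x)\<^sup>2) = expectation (\<lambda>_. 0)" using 1 \<open>m = 0\<close> by (intro integral_cong_AE) auto
    moreover have "(\<integral>x. cos (V x + \<theta>) \<partial>M) = (\<integral>x. cos \<theta> \<partial>M)" using 1 \<open>m = 0\<close> by (intro integral_cong_AE) auto
    ultimately show ?thesis by (simp add: prob_space)
  next
    case 2
    have "m = 0" using normal_distributed_expectation[OF 2] E by simp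
    then have "(\<integral>x. iexp (V x) \<partial>M) = complex_of_real (exp (- (\<sigma>\<^sup>2) / 2))"
      using normal_iexp[OF 2(1), of V 1] 2 by simp
    moreover have "expectation (\<lambda>x. (V x)\<^sup>2) = \<sigma>\<^sup>2"
      using normal_distributed_variance[OF 2] E by simp
    ultimately show ?thesis using expectation_cos_of_iexp[of V] by simp
  qed
qed

lemma gaussian_process_rv:
  assumes "gaussian_process I B" "t \<in> I"
  shows "gaussian_rv (B t)"
proof -
  have "gaussian_rv (\<lambda>\<omega>. \<Sum>t\<in>{t}. 1 * B t \<omega>)"
    using assms unfolding gaussian_process_def
    by (elim allE[of _ "{t}"] allE[of _ "\<lambda>_. 1"]) auto
  then show ?thesis by simp
qed

lemma centered_gaussian_process_law:
  assumes B: "centered_gaussian_process I B" and S: "finite S" "S \<subseteq> I"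
    and R: "\<And>s t. s \<in> S \<Longrightarrow> t \<in> S \<Longrightarrow> expectation (\<lambda>\<omega>. B s \<omega> * B t \<omega>) = R s t"
  shows "(\<integral>x. cos ((\<Sum>t\<in>S. a t * B t x) + \<theta>) \<partial>M) = exp (- quad_form S R a / 2) * cos \<theta>"
    and "0 \<le> quad_form S R a"
proof -
  have g1: "gaussian_rv (B t)" if "t \<in> I" for t
    using B that by (auto simp: centered_gaussian_process_def intro: gaussian_process_rv)
  have g: "gaussian_rv (\<lambda>\<omega>. \<Sum>t\<in>S. a t * B t \<omega>)"
    using B S unfolding centered_gaussian_process_def gaussian_process_def by blast
  have m: "B t \<in> borel_measurable M" if "t \<in> S" for t using g1[of t] that S by (auto simp: gaussian_rv_def)
  have int: "integrable M (\<lambda>x. B s x * B t x)" if "s \<in> S" "t \<in> S" for s t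
    using that S m by (intro integrable_mult_L2 gaussian_rv_square_integrable g1) auto
  have int1: "integrable M (B t)" if "t \<in> S" for t
    using that S by (intro gaussian_rv_square_integrable g1) auto
  have "expectation (\<lambda>\<omega>. \<Sum>t\<in>S. a t * B t \<omega>) = (\<Sum>t\<in>S. a t * expectation (B t))"
    using int1 by (subst Bochner_Integration.integral_sum) auto
  also have "\<dots> = 0"
    using B S by (auto simp: centered_gaussian_process_def intro!: sum.neutral)
  finally have 0: "expectation (\<lambda>\<omega>. \<Sum>t\<in>S. a t * B t \<omega>) = 0" .
  have sq: "(\<Sum>t\<in>S. a t * B t x)\<^sup>2 = (\<Sum>s\<in>S. \<Sum>t\<in>S. a s * a t * (B s x * B t x))" for x
    unfolding power2_eq_square sum_product by (intro sum.cong) (auto simp: mult_ac)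
  have q: "expectation (\<lambda>x. (\<Sum>t\<in>S. a t * B t x)\<^sup>2) = quad_form S R a"
    unfolding sq quad_form_def using int by (subst Bochner_Integration.integral_sum; auto simp: R)
  show "(\<integral>x. cos ((\<Sum>t\<in>S. a t * B t x) + \<theta>) \<partial>M) = exp (- quad_form S R a / 2) * cos \<theta>"
    unfolding gaussian_rv_cos[OF g 0] q ..
  show "0 \<le> quad_form S R a" unfolding q[symmetric] by simp
qed

end

text \<open>The grid consists of the sorted points of \<open>S\<close> and 0. The last clause is
  kept general in \<open>F\<close> because it serves twice: with a path of \<open>W\<close> it
  expresses values by increments, with the identity it recovers \<open>min\<close> from the lengths
  of the steps.\<close>

lemma finite_grid:
  fixes S :: "real set"
  assumes "finite S" "S \<subseteq> {0..T}" "0 \<le> T"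
  obtains n and t :: "nat \<Rightarrow> real" where "mono_on {..n} t" "t ` {..n} \<subseteq> {0..T}" "t 0 = 0"
    "\<And>j. j < n \<Longrightarrow> t j < t (Suc j)"
    "\<And>(F :: real \<Rightarrow> real) s. s \<in> S \<Longrightarrow> F s - F 0 = (\<Sum>j<n. (if t (Suc j) \<le> s then 1 else 0) * (F (t (Suc j)) - F (t j)))"
proof -
  define L where "L = sorted_list_of_set (insert 0 S)"
  define n where "n = length L - 1"
  define t where "t i = L ! i" for i
  have setL: "set L = insert 0 S" using assms(1) by (simp only: L_def set_sorted_list_of_set finite_insert)
  have srt: "sorted_wrt (<) L" unfolding L_def by simp
  have len: "length L = Suc n" using setL by (cases L) (auto simp: n_def)
  have less: "t i < t j" if "i < j" "j \<le> n" for i j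
    using sorted_wrt_nth_less[OF srt that(1)] that len by (simp add: t_def)
  have le_iff: "t i \<le> t j \<longleftrightarrow> i \<le> j" if "i \<le> n" "j \<le> n" for i j
    using less[of i j] less[of j i] that by (cases i j rule: linorder_cases) auto
  have img: "t ` {..n} = insert 0 S"
    using setL len by (auto simp: t_def set_conv_nth less_Suc_eq_le image_def) 
  have t0: "t 0 = 0"
  proof -
    obtain k where k: "k \<le> n" "t k = 0" using img by (metis atMost_iff image_iff insertI1)
    have "t 0 \<in> insert 0 S" using img by (metis atMost_iff image_eqI le0)
    then have "0 \<le> t 0" using assms by auto
    then show ?thesis using less[of 0 k] k by (cases "k = 0") auto
  qed
  show ?thesis
  proof
    show "mono_on {..n} t" using le_iff by (intro mono_onI) auto
    show "t ` {..n} \<subseteq> {0..T}" using img assms by auto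
    show "t 0 = 0" by (rule t0)
    show "t j < t (Suc j)" if "j < n" for j using less that by simp
    fix F :: "real \<Rightarrow> real" and s assume "s \<in> S"
    then obtain k where k: "k \<le> n" "s = t k" using img by (metis atMost_iff image_iff insertI2)
    have "(\<Sum>j<n. (if t (Suc j) \<le> s then 1 else 0) * (F (t (Suc j)) - F (t j))) =
      (\<Sum>j\<in>{..<n} \<inter> {j. Suc j \<le> k}. F (t (Suc j)) - F (t j))"
      using k le_iff by (subst sum.inter_restrict) (auto intro!: sum.cong)
    also have "{..<n} \<inter> {j. Suc j \<le> k} = {..<k}" using k by auto
    also have "(\<Sum>j<k. F (t (Suc j)) - F (t j)) = F s - F 0"
      using sum_lessThan_telescope[of "\<lambda>j. F (t j)" k] k t0 by simp
    finally show "F s - F 0 = (\<Sum>j<n. (if t (Suc j) \<le> s then 1 else 0) * (F (t (Suc j)) - F (t j)))" ..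
  qed
qed

context prob_space
begin

lemma wiener_process_law:
  assumes W: "wiener_process {0..T} W" and S: "finite S" "S \<subseteq> {0..T}" and T: "0 \<le> T"
  shows "(\<integral>x. cos ((\<Sum>t\<in>S. a t * W t x) + \<theta>) \<partial>M) = exp (- quad_form S min a / 2) * cos \<theta>"
    and "0 \<le> quad_form S min a"
proof -
  obtain n and t :: "nat \<Rightarrow> real" where t: "mono_on {..n} t" "t ` {..n} \<subseteq> {0..T}" "t 0 = 0"
      "\<And>j. j < n \<Longrightarrow> t j < t (Suc j)"
    and tel: "\<And>(F :: real \<Rightarrow> real) s. s \<in> S \<Longrightarrow> F s - F 0 = (\<Sum>j<n. (if t (Suc j) \<le> s then 1 else 0) * (F (t (Suc j)) - F (t j)))"
    using finite_grid[OF S T] by blast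
  \<comment> \<open>The coefficient of the \<open>j\<close>-th increment once the linear combination
    of values is rewritten in increments.\<close>
  define A where "A j = (\<Sum>s\<in>S. a s * (if t (Suc j) \<le> s then 1 else 0))" for j
  define V where "V j x = A j * (W (t (Suc j)) x - W (t j) x)" for j x
  have tI: "t j \<in> {0..T}" if "j \<le> n" for j using t(2) that by auto
  have m: "W s \<in> borel_measurable M" if "s \<in> {0..T}" for s using W that by (auto simp: wiener_process_def)
  have mW: "W s \<in> borel_measurable M" if "s \<in> S" for s using m S that by auto
  have W0: "AE x in M. W 0 x = 0" using W by (simp add: wiener_process_def)
  have indep: "indep_vars (\<lambda>_. borel) (\<lambda>j x. W (t (Suc j)) x - W (t j) x) {..<n}"
    using W t by (simp add: wiener_process_def)
  then have "indep_vars (\<lambda>_. borel) V {..<n}"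
    unfolding V_def[abs_def] by (rule indep_vars_compose2) measurable
  then have "char (distr M borel (\<lambda>x. \<Sum>j<n. V j x)) 1 = (\<Prod>j<n. char (distr M borel (V j)) 1)"
    by (rule char_distr_sum)
  also have "\<dots> = (\<Prod>j<n. complex_of_real (exp (- ((A j)\<^sup>2 * (t (Suc j) - t j)) / 2)))"
  proof (rule prod.cong)
    fix j assume j: "j \<in> {..<n}"
    then have l: "t j < t (Suc j)" using t by simp
    have "V j \<in> borel_measurable M" unfolding V_def[abs_def] using m[of "t j"] m[of "t (Suc j)"] tI j by simp
    then have "char (distr M borel (V j)) 1 = (\<integral>x. iexp (A j * (W (t (Suc j)) x - W (t j) x)) \<partial>M)"
      unfolding char_def by (subst integral_distr) (auto simp: V_def)
    also have "\<dots> = complex_of_real (exp (- ((A j * sqrt (t (Suc j) - t j))\<^sup>2) / 2))"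
      using W tI[of j] tI[of "Suc j"] j l by (intro normal_iexp) (auto simp: wiener_process_def)
    finally show "char (distr M borel (V j)) 1 = complex_of_real (exp (- ((A j)\<^sup>2 * (t (Suc j) - t j)) / 2))"
      using l by (simp add: power_mult_distrib)
  qed simp
  also have "\<dots> = complex_of_real (exp (\<Sum>j<n. - ((A j)\<^sup>2 * (t (Suc j) - t j)) / 2))"
    by (simp only: exp_sum finite_lessThan of_real_prod)
  also have "(\<Sum>j<n. - ((A j)\<^sup>2 * (t (Suc j) - t j)) / 2) = - (\<Sum>j<n. (A j)\<^sup>2 * (t (Suc j) - t j)) / 2"
    by (simp add: sum_negf sum_divide_distrib)
  also have "(\<Sum>j<n. (A j)\<^sup>2 * (t (Suc j) - t j)) = quad_form S min a"
  \<comment> \<open>In the square of \<open>A j\<close>, the conditions for two times hold together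
    exactly when \<open>t (Suc j)\<close> is at most their minimum; telescoping then sums the steps
    up to that minimum.\<close>
  proof -
    have "(\<Sum>j<n. (A j)\<^sup>2 * (t (Suc j) - t j)) =
      (\<Sum>j<n. \<Sum>r\<in>S. \<Sum>s\<in>S. a r * a s * ((if t (Suc j) \<le> min r s then 1 else 0) * (t (Suc j) - t j)))"
      unfolding A_def power2_eq_square sum_product unfolding sum_distrib_right
      by (intro sum.cong) auto
    also have "\<dots> = (\<Sum>r\<in>S. \<Sum>s\<in>S. \<Sum>j<n. a r * a s * ((if t (Suc j) \<le> min r s then 1 else 0) * (t (Suc j) - t j)))"
      by (subst sum.swap, intro sum.cong refl, subst sum.swap) simp
    also have "\<dots> = (\<Sum>r\<in>S. \<Sum>s\<in>S. a r * a s * min r s)"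
    proof (intro sum.cong refl)
      fix r s assume "r \<in> S" "s \<in> S"
      then have "min r s \<in> S" by (simp add: min_def)
      have e: "(\<Sum>j<n. (if t (Suc j) \<le> min r s then 1 else 0) * (t (Suc j) - t j)) = min r s"
        using tel[OF \<open>min r s \<in> S\<close>, of "\<lambda>x. x"] by (simp only: diff_zero)
      show "(\<Sum>j<n. a r * a s * ((if t (Suc j) \<le> min r s then 1 else 0) * (t (Suc j) - t j))) = a r * a s * min r s"
        unfolding sum_distrib_left[symmetric] e ..
    qed
    finally show ?thesis by (simp add: quad_form_def)
  qed
  finally have char: "char (distr M borel (\<lambda>x. \<Sum>j<n. V j x)) 1 = complex_of_real (exp (- quad_form S min a / 2))" .
  have Vm: "(\<lambda>x. \<Sum>j<n. V j x) \<in> borel_measurable M"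
    unfolding V_def using m tI by (intro borel_measurable_sum borel_measurable_times borel_measurable_diff borel_measurable_const) auto
  have "(\<integral>x. iexp (\<Sum>j<n. V j x) \<partial>M) = complex_of_real (exp (- quad_form S min a / 2))"
    using char Vm unfolding char_def by (subst (asm) integral_distr) auto
  then have "(\<integral>x. cos ((\<Sum>j<n. V j x) + \<theta>) \<partial>M) = exp (- quad_form S min a / 2) * cos \<theta>"
    by (rule expectation_cos_of_iexp[OF Vm])
  moreover have "(\<integral>x. cos ((\<Sum>t\<in>S. a t * W t x) + \<theta>) \<partial>M) = (\<integral>x. cos ((\<Sum>j<n. V j x) + \<theta>) \<partial>M)"
  proof (rule integral_cong_AE)
    show "AE x in M. cos ((\<Sum>t\<in>S. a t * W t x) + \<theta>) = cos ((\<Sum>j<n. V j x) + \<theta>)"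
      using W0
    proof eventually_elim
      case (elim x)
      have "(\<Sum>s\<in>S. a s * W s x) = (\<Sum>s\<in>S. \<Sum>j<n. a s * ((if t (Suc j) \<le> s then 1 else 0) * (W (t (Suc j)) x - W (t j) x)))"
      proof (intro sum.cong refl)
        fix s assume "s \<in> S"
        from tel[OF this, of "\<lambda>u. W u x"] elim
        show "a s * W s x = (\<Sum>j<n. a s * ((if t (Suc j) \<le> s then 1 else 0) * (W (t (Suc j)) x - W (t j) x)))"
          by (simp add: sum_distrib_left[symmetric])
      qed
      also have "\<dots> = (\<Sum>j<n. V j x)"
        unfolding V_def A_def sum_distrib_right by (subst sum.swap) (simp add: mult.assoc)
      finally show ?case by simp
    qed
    show "(\<lambda>x. cos ((\<Sum>t\<in>S. a t * W t x) + \<theta>)) \<in> borel_measurable M"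
      using mW by measurable
    show "(\<lambda>x. cos ((\<Sum>j<n. V j x) + \<theta>)) \<in> borel_measurable M"
      using Vm by measurable
  qed
  ultimately show "(\<integral>x. cos ((\<Sum>t\<in>S. a t * W t x) + \<theta>) \<partial>M) = exp (- quad_form S min a / 2) * cos \<theta>" by simp
  have "(\<Sum>j<n. (A j)\<^sup>2 * (t (Suc j) - t j)) \<ge> 0"
    using t(4) by (intro sum_nonneg mult_nonneg_nonneg) (auto simp: less_imp_le)
  then show "0 \<le> quad_form S min a"
    using \<open>(\<Sum>j<n. (A j)\<^sup>2 * (t (Suc j) - t j)) = quad_form S min a\<close> by simp
qed

text \<open>The addition formula splits the cosine of the sum into two products of functions of
  independent variables. The product of sines has expectation 0, since a sine is a cosine with phase
  \<open>- pi/2\<close> and \<open>cos (- (pi/2))\<close> is 0.\<close>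

lemma independent_sum_law:
  assumes ind: "independent_processes I B W" and S: "finite S" "S \<subseteq> I"
    and B: "\<And>\<theta>. (\<integral>x. cos ((\<Sum>t\<in>S. a t * B t x) + \<theta>) \<partial>M) = p * cos \<theta>"
    and W: "\<And>\<theta>. (\<integral>x. cos ((\<Sum>t\<in>S. a t * W t x) + \<theta>) \<partial>M) = q * cos \<theta>"
  shows "(\<integral>x. cos ((\<Sum>t\<in>S. a t * (B t x + W t x)) + \<theta>) \<partial>M) = p * q * cos \<theta>"
proof -
  let ?s = "\<lambda>(x :: real \<Rightarrow> real). \<Sum>t\<in>S. a t * x t"
  have SI: "t \<in> I" if "t \<in> S" for t using S that by auto
  have sm: "?s \<in> borel_measurable (PiM I (\<lambda>_. borel))"
    by measurable (rule SI)
  have "indep_var borel (?s \<circ> (\<lambda>\<omega>. \<lambda>t\<in>I. B t \<omega>)) borel (?s \<circ> (\<lambda>\<omega>. \<lambda>t\<in>I. W t \<omega>))"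
    using ind unfolding independent_processes_def by (rule indep_var_compose[OF _ sm sm])
  moreover have "?s \<circ> (\<lambda>\<omega>. \<lambda>t\<in>I. X t \<omega>) = (\<lambda>\<omega>. \<Sum>t\<in>S. a t * X t \<omega>)" for X :: "real \<Rightarrow> 'a \<Rightarrow> real"
    using S by (auto simp: fun_eq_iff intro!: sum.cong)
  ultimately have iv: "indep_var borel (\<lambda>\<omega>. \<Sum>t\<in>S. a t * B t \<omega>) borel (\<lambda>\<omega>. \<Sum>t\<in>S. a t * W t \<omega>)"
    by simp
  let ?U = "\<lambda>\<omega>. \<Sum>t\<in>S. a t * B t \<omega>" and ?V = "\<lambda>\<omega>. \<Sum>t\<in>S. a t * W t \<omega>"
  have [measurable]: "?U \<in> borel_measurable M" "?V \<in> borel_measurable M"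
    using indep_var_rv1[OF iv] indep_var_rv2[OF iv] by auto
  have prod: "(\<integral>x. cos (?U x + \<alpha>) * cos (?V x + \<beta>) \<partial>M) = p * cos \<alpha> * (q * cos \<beta>)"
    and int: "integrable M (\<lambda>x. cos (?U x + \<alpha>) * cos (?V x + \<beta>))" for \<alpha> \<beta>
  proof -
    have "indep_var borel ((\<lambda>u. cos (u + \<alpha>)) \<circ> ?U) borel ((\<lambda>u. cos (u + \<beta>)) \<circ> ?V)"
      using iv by (rule indep_var_compose) measurable
    then have i: "indep_var borel (\<lambda>x. cos (?U x + \<alpha>)) borel (\<lambda>x. cos (?V x + \<beta>))" by (simp add: o_def)
    have b: "integrable M (\<lambda>x. cos (?U x + \<alpha>))" "integrable M (\<lambda>x. cos (?V x + \<beta>))"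
      by (auto intro!: integrable_const_bound[where B=1])
    show "(\<integral>x. cos (?U x + \<alpha>) * cos (?V x + \<beta>) \<partial>M) = p * cos \<alpha> * (q * cos \<beta>)"
      unfolding indep_var_lebesgue_integral[OF i b] B W ..
    show "integrable M (\<lambda>x. cos (?U x + \<alpha>) * cos (?V x + \<beta>))" by (rule indep_var_integrable[OF i b])
  qed
  have "cos ((\<Sum>t\<in>S. a t * (B t x + W t x)) + \<theta>) =
      cos (?U x + 0) * cos (?V x + \<theta>) - cos (?U x + - (pi/2)) * cos (?V x + (\<theta> - pi/2))" for x
  proof -
    have "(\<Sum>t\<in>S. a t * (B t x + W t x)) + \<theta> = ?U x + (?V x + \<theta>)"
      by (simp add: distrib_left sum.distrib)
    moreover have "cos (?U x + - (pi/2)) = sin (?U x)" by (simp add: cos_diff)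
    moreover have "cos (?V x + (\<theta> - pi/2)) = sin (?V x + \<theta>)"
      using cos_diff[of "?V x + \<theta>" "pi/2"] by (simp add: add_diff_eq)
    ultimately show ?thesis by (simp only: cos_add[of "?U x" "?V x + \<theta>"] add_0_right)
  qed
  then have "(\<integral>x. cos ((\<Sum>t\<in>S. a t * (B t x + W t x)) + \<theta>) \<partial>M) =
    (\<integral>x. cos (?U x + 0) * cos (?V x + \<theta>) \<partial>M) - (\<integral>x. cos (?U x + - (pi/2)) * cos (?V x + (\<theta> - pi/2)) \<partial>M)"
    by (simp only: Bochner_Integration.integral_diff[OF int int])
  also have "\<dots> = p * q * cos \<theta>" unfolding prod by simp
  finally show ?thesis .
qed

end

section \<open>From finitely many times to the whole interval\<close>

text \<open>The graph of \<open>(l, u)\<close> over \<open>I\<close> is separable, even though \<open>l\<close> and \<open>u\<close> are arbitrary functions.\<close>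

lemma countable_constraints:
  fixes l u :: "real \<Rightarrow> real"
  obtains D where "countable D" "D \<subseteq> I"
    "\<And>x. continuous_on I x \<Longrightarrow> \<forall>t\<in>D. l t \<le> x t \<and> x t \<le> u t \<Longrightarrow> \<forall>t\<in>I. l t \<le> x t \<and> x t \<le> u t"
proof -
  let ?G = "(\<lambda>t. (t, l t, u t)) ` I"
  obtain C where C: "countable C" "C \<subseteq> ?G" "?G \<subseteq> closure C"
    using separable[of ?G] by blast
  show ?thesis
  proof
    show "countable (fst ` C)" using C by simp
    show D: "fst ` C \<subseteq> I" using C by auto
    fix x :: "real \<Rightarrow> real"
    assume x: "continuous_on I x" and le: "\<forall>t\<in>fst ` C. l t \<le> x t \<and> x t \<le> u t"
    show "\<forall>t\<in>I. l t \<le> x t \<and> x t \<le> u t"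
    proof
      fix t assume t: "t \<in> I"
      have "(t, l t, u t) \<in> closure C" using C t by auto
      \<comment> \<open>Along this sequence of times both bounds converge to their values at
        \<open>t\<close>, so the non-strict inequalities survive the limit even where
        \<open>l\<close> and \<open>u\<close> are discontinuous.\<close>
      then obtain s where s: "\<And>n. s n \<in> C" "s \<longlonglongrightarrow> (t, l t, u t)"
        by (auto simp: closure_sequential)
      have sn: "s n = (fst (s n), l (fst (s n)), u (fst (s n)))" for n using s(1)[of n] C(2) by auto
      have f: "(\<lambda>n. fst (s n)) \<longlonglongrightarrow> t" using tendsto_fst[OF s(2)] by simp
      have "(\<lambda>n. x (fst (s n))) \<longlonglongrightarrow> x t"
      proof -
        have "fst (s n) \<in> I" for n using D s(1) by blast
        then show ?thesis using x t f unfolding continuous_on_sequentially by (auto simp: o_def)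
      qed
      moreover have "(\<lambda>n. fst (snd (s n))) \<longlonglongrightarrow> l t" using tendsto_fst[OF tendsto_snd[OF s(2)]] by simp
      moreover have "(\<lambda>n. snd (snd (s n))) \<longlonglongrightarrow> u t" using tendsto_snd[OF tendsto_snd[OF s(2)]] by simp
      moreover have "fst (snd (s n)) \<le> x (fst (s n))" "x (fst (s n)) \<le> snd (snd (s n))" for n
        using bspec[OF le, of "fst (s n)"] s(1)[of n] sn[of n] by (metis imageI fst_conv snd_conv)+
      ultimately show "l t \<le> x t \<and> x t \<le> u t"
        by (blast intro: LIMSEQ_le)
    qed
  qed
qed

text \<open>Combines the bounds for the Wiener part and the fractional part into one for the sum. It
  reduces to \<open>2 * (x * y) \<le> p * s + q * r\<close>, which is the inequality of arithmetic
  and geometric means.\<close>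

lemma square_sum_bound:
  fixes x y p q r s :: real
  assumes "x\<^sup>2 \<le> p * r" "y\<^sup>2 \<le> q * s" "0 \<le> p" "0 \<le> q" "0 \<le> r" "0 \<le> s"
  shows "(x + y)\<^sup>2 \<le> (p + q) * (r + s)"
proof -
  have "(2 * (x * y))\<^sup>2 = 4 * (x\<^sup>2 * y\<^sup>2)" by (simp add: power2_eq_square)
  also have "\<dots> \<le> 4 * ((p * r) * (q * s))"
    using assms by (intro mult_left_mono mult_mono) auto
  also have "\<dots> \<le> (p * s + q * r)\<^sup>2"
    using zero_le_power2[of "p * s - q * r"] by (simp add: power2_eq_square algebra_simps)
  finally have "2 * (x * y) \<le> p * s + q * r"
    using assms by (intro power2_le_imp_le[of "2 * (x * y)"]) auto
  then show ?thesis using assms(1,2) by (simp add: power2_eq_square algebra_simps)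
qed

text \<open>Continuity from above along finite subsets exhausting \<open>D\<close>. Both sides
  converge, and the factor \<open>c\<close> does not depend on the subset.\<close>

lemma measure_mono_countable_limit:
  assumes "countable D" and M: "finite_measure M"
    and A: "\<And>t. t \<in> D \<Longrightarrow> {x \<in> space M. P t x} \<in> sets M" and B: "\<And>t. t \<in> D \<Longrightarrow> {x \<in> space M. Q t x} \<in> sets M"
    and fin: "\<And>F. finite F \<Longrightarrow> F \<subseteq> D \<Longrightarrow>
      c * measure M {x \<in> space M. \<forall>t\<in>F. P t x} \<le> measure M {x \<in> space M. \<forall>t\<in>F. Q t x}"
  shows "c * measure M {x \<in> space M. \<forall>t\<in>D. P t x} \<le> measure M {x \<in> space M. \<forall>t\<in>D. Q t x}"
proof -
  interpret finite_measure M by fact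
  \<comment> \<open>Cutting off an enumeration works for finite and infinite \<open>D\<close>
    alike.\<close>
  define F where "F n = {t \<in> D. to_nat_on D t \<le> n}" for n
  have F: "finite (F n)" "F n \<subseteq> D" for n
  proof -
    have "inj_on (to_nat_on D) (F n)" using inj_on_to_nat_on[OF assms(1)] by (rule inj_on_subset) (auto simp: F_def)
    then show "finite (F n)" by (rule finite_imageD[rotated]) (auto intro: finite_subset[of _ "{..n}"] simp: F_def)
  qed (auto simp: F_def)
  have lim: "(\<lambda>n. measure M {x \<in> space M. \<forall>t\<in>F n. R t x}) \<longlonglongrightarrow> measure M {x \<in> space M. \<forall>t\<in>D. R t x}"
    if R: "\<And>t. t \<in> D \<Longrightarrow> {x \<in> space M. R t x} \<in> sets M" for R
  proof -
    have "(\<lambda>n. measure M {x \<in> space M. \<forall>t\<in>F n. R t x}) \<longlonglongrightarrow> measure M (\<Inter>n. {x \<in> space M. \<forall>t\<in>F n. R t x})"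
    proof (rule finite_Lim_measure_decseq)
      show "range (\<lambda>n. {x \<in> space M. \<forall>t\<in>F n. R t x}) \<subseteq> sets M"
        using F R by (auto intro!: sets.sets_Collect_finite_All)
      show "decseq (\<lambda>n. {x \<in> space M. \<forall>t\<in>F n. R t x})"
        by (auto simp: decseq_def F_def)
    qed
    also have "(\<Inter>n. {x \<in> space M. \<forall>t\<in>F n. R t x}) = {x \<in> space M. \<forall>t\<in>D. R t x}"
      by (auto simp: F_def)
    finally show ?thesis .
  qed
  show ?thesis
    by (rule LIMSEQ_le[OF tendsto_mult_left[OF lim[OF A]] lim[OF B]]) (use fin F in auto)
qed

text \<open>The event is contained in its countable version, and the difference lies in the null set
  of discontinuous paths. That difference may fail to be measurable, which is why the completion is
  needed.\<close>

lemma measure_completion_small_ball: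
  assumes M: "prob_space M" and D: "countable D" "D \<subseteq> {0..T}"
    and Bm: "\<And>t. t \<in> {0..T} \<Longrightarrow> B t \<in> borel_measurable M" and Wm: "\<And>t. t \<in> {0..T} \<Longrightarrow> W t \<in> borel_measurable M"
    and cont: "AE \<omega> in M. continuous_on {0..T} (\<lambda>t. B t \<omega> + W t \<omega>)"
    and det: "\<And>x. continuous_on {0..T} x \<Longrightarrow> \<forall>t\<in>D. \<bar>x t + g t\<bar> \<le> e * f t \<Longrightarrow> \<forall>t\<in>{0..T}. \<bar>x t + g t\<bar> \<le> e * f t"
  shows "measure (completion M) (small_ball_event M B W f T g e) =
    measure M {\<omega> \<in> space M. \<forall>t\<in>D. \<bar>B t \<omega> + W t \<omega> + g t\<bar> \<le> e * f t}"
proof -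
  let ?E = "{\<omega> \<in> space M. \<forall>t\<in>D. \<bar>B t \<omega> + W t \<omega> + g t\<bar> \<le> e * f t}" and ?A = "small_ball_event M B W f T g e"
  have E: "?E \<in> sets M"
  proof (rule sets.sets_Collect_countable_All'[OF _ D(1)])
    fix t assume "t \<in> D"
    then have [measurable]: "B t \<in> borel_measurable M" "W t \<in> borel_measurable M" using Bm Wm D by auto
    show "{\<omega> \<in> space M. \<bar>B t \<omega> + W t \<omega> + g t\<bar> \<le> e * f t} \<in> sets M" by measurable
  qed
  obtain N where N: "N \<in> null_sets M" "{\<omega> \<in> space M. \<not> continuous_on {0..T} (\<lambda>t. B t \<omega> + W t \<omega>)} \<subseteq> N"
    using cont by (auto simp: eventually_ae_filter)
  have "?E - ?A \<subseteq> N"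
  proof
    fix \<omega> assume \<omega>: "\<omega> \<in> ?E - ?A"
    have "\<not> continuous_on {0..T} (\<lambda>t. B t \<omega> + W t \<omega>)"
    proof
      assume "continuous_on {0..T} (\<lambda>t. B t \<omega> + W t \<omega>)"
      from det[OF this] \<omega> show False by (auto simp: small_ball_event_def)
    qed
    then show "\<omega> \<in> N" using N \<omega> by auto
  qed
  then have null: "?E - ?A \<in> null_sets (completion M)"
    using N(1) by (rule null_sets_completion_subset[OF _ null_sets_completionI])
  have "?A \<subseteq> ?E" using D by (auto simp: small_ball_event_def)
  then have "?A = ?E - (?E - ?A)" by blast
  then have "measure (completion M) ?A = measure (completion M) (?E - (?E - ?A))" by simp
  also have "\<dots> = measure (completion M) ?E"
    using E by (intro measure_Diff_null_set null) auto
  also have "\<dots> = measure M ?E" using E by (rule measure_completion)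
  finally show ?thesis .
qed

theorem lemma3p3:
  fixes M :: "'a measure"
    and B W :: "real \<Rightarrow> 'a \<Rightarrow> real"
    and f g g' gW gW' gB gB' :: "real \<Rightarrow> real"
    and H T \<epsilon> :: real
  assumes "prob_space M"
    and "0 < H" and "H < 1/2" and "T > 0"
    and "prob_space.fractional_brownian_motion M H {0..T} B"
    and "prob_space.continuous_paths M {0..T} B"
    and "prob_space.wiener_process M {0..T} W"
    and "prob_space.independent_processes M {0..T} B W"
    and "set_borel_measurable lebesgue {0..T} f" and "\<forall>t\<in>{0..T}. f t > 0"
    and "AC_with_L2_deriv T g g'"
    and "\<epsilon> > 0"
    and "suitable_expansion T g gW gW' gB gB'"
  shows "measure (completion M) (small_ball_event M B W f T g \<epsilon>)
    \<ge> exp (- (1/2) * (LINT t:{0..T}|lebesgue. (gW' t)\<^sup>2 + (K0_star H gB' t)\<^sup>2))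
       * measure (completion M) (small_ball_event M B W f T (\<lambda>_. 0) \<epsilon>)"
proof -
  interpret prob_space M by fact
  note H = assms(2,3) and T = assms(4)
  have Bg: "centered_gaussian_process {0..T} B" and
    cov: "\<And>s t. s \<in> {0..T} \<Longrightarrow> t \<in> {0..T} \<Longrightarrow>
      expectation (\<lambda>\<omega>. B t \<omega> * B s \<omega>) = (1/2) * (t powr (2 * H) + s powr (2 * H) - \<bar>t - s\<bar> powr (2 * H))"
    using assms(5) by (auto simp: fractional_brownian_motion_def)
  have gW: "\<And>t. t \<in> {0..T} \<Longrightarrow> gW t = (LINT s:{0..t}|lebesgue. gW' s)" and LW: "L2_on T gW'"
    and gB: "\<And>t. t \<in> {0..T} \<Longrightarrow> gB t = (LINT s:{0..t}|lebesgue. gB' s)" and LB: "L2_on T gB'"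
    and g: "\<And>t. t \<in> {0..T} \<Longrightarrow> g t = gW t + gB t"
    using assms(13) by (auto simp: suitable_expansion_def AC_with_L2_deriv_def)
  have Bm: "B t \<in> borel_measurable M" if "t \<in> {0..T}" for t
    using gaussian_process_rv[of "{0..T}" B t] Bg that
    by (auto simp: centered_gaussian_process_def gaussian_rv_def)
  have Wm: "W t \<in> borel_measurable M" if "t \<in> {0..T}" for t
    using assms(7) that by (auto simp: wiener_process_def)
  have cont: "AE \<omega> in M. continuous_on {0..T} (\<lambda>t. B t \<omega> + W t \<omega>)"
  proof -
    have "AE \<omega> in M. continuous_on {0..T} (\<lambda>t. B t \<omega>)" using assms(6) by (simp add: continuous_paths_def)
    moreover have "AE \<omega> in M. continuous_on {0..T} (\<lambda>t. W t \<omega>)"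
      using assms(7) by (simp add: wiener_process_def continuous_paths_def)
    ultimately show ?thesis by eventually_elim (rule continuous_on_add)
  qed
  define KW where "KW = (LINT t:{0..T}|lebesgue. (gW' t)\<^sup>2)"
  define KB where "KB = (LINT t:{0..T}|lebesgue. (K0_star H gB' t)\<^sup>2)"
  have K0: "0 \<le> KW" "0 \<le> KB"
    unfolding KW_def KB_def set_lebesgue_integral_def by auto
  \<comment> \<open>Splitting the integral requires both summands to be integrable; for the second
    this is the L2 bound on the operator.\<close>
  have K: "(LINT t:{0..T}|lebesgue. (gW' t)\<^sup>2 + (K0_star H gB' t)\<^sup>2) = KW + KB"
    unfolding KW_def KB_def using LW fbm_shift_bound(1)[OF H T LB gB]
    by (intro set_integral_add) (auto simp: L2_on_def)
  define RB where "RB s t = (1/2) * (t powr (2 * H) + s powr (2 * H) - \<bar>t - s\<bar> powr (2 * H))" for s t :: real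
  have fin: "exp (- (KW + KB) / 2) * measure M {\<omega> \<in> space M. \<forall>t\<in>F. \<bar>B t \<omega> + W t \<omega> + 0\<bar> \<le> \<epsilon> * f t} \<le>
      measure M {\<omega> \<in> space M. \<forall>t\<in>F. \<bar>B t \<omega> + W t \<omega> + g t\<bar> \<le> \<epsilon> * f t}" if F: "finite F" "F \<subseteq> {0..T}" for F
  proof -
    have lawB: "(\<integral>x. cos ((\<Sum>t\<in>F. a t * B t x) + \<theta>) \<partial>M) = exp (- quad_form F RB a / 2) * cos \<theta>"
      and qB: "0 \<le> quad_form F RB a" for a \<theta>
    proof -
      have "expectation (\<lambda>\<omega>. B s \<omega> * B t \<omega>) = RB s t" if "s \<in> F" "t \<in> F" for s t
      proof -
        have "s \<in> {0..T}" "t \<in> {0..T}" using that F by auto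
        from cov[OF this(2,1)] show ?thesis by (simp add: RB_def abs_minus_commute)
      qed
      from centered_gaussian_process_law[OF Bg F this]
      show "(\<integral>x. cos ((\<Sum>t\<in>F. a t * B t x) + \<theta>) \<partial>M) = exp (- quad_form F RB a / 2) * cos \<theta>"
        and "0 \<le> quad_form F RB a" by auto
    qed
    note lawW = wiener_process_law(1)[OF assms(7) F less_imp_le[OF T]]
      and qW = wiener_process_law(2)[OF assms(7) F less_imp_le[OF T]]
    have q: "quad_form F (\<lambda>s t. min s t + RB s t) a = quad_form F min a + quad_form F RB a" for a
      unfolding quad_form_def by (simp add: distrib_left sum.distrib)
    have "exp (- (KW + KB) / 2) * measure M {\<omega> \<in> space M. \<forall>t\<in>F. \<bar>B t \<omega> + W t \<omega>\<bar> \<le> \<epsilon> * f t} \<le>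
      measure M {\<omega> \<in> space M. \<forall>t\<in>F. \<bar>B t \<omega> + W t \<omega> + g t\<bar> \<le> \<epsilon> * f t}"
    proof (rule gaussian_vector_shift[where R = "\<lambda>s t. min s t + RB s t"])
      show "(\<lambda>\<omega>. B t \<omega> + W t \<omega>) \<in> borel_measurable M" if "t \<in> F" for t
        using Bm[of t] Wm[of t] that F by auto
      show "min s t + RB s t = min t s + RB t s" for s t
        by (simp add: RB_def min.commute abs_minus_commute)
      show "(\<integral>x. cos ((\<Sum>t\<in>F. a t * (B t x + W t x)) + \<theta>) \<partial>M) =
          exp (- quad_form F (\<lambda>s t. min s t + RB s t) a / 2) * cos \<theta>" for a \<theta>
        unfolding independent_sum_law[OF assms(8) F lawB lawW] q by (simp flip: exp_add)
      show "0 \<le> quad_form F (\<lambda>s t. min s t + RB s t) a" for a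
        unfolding q using qW qB by (intro add_nonneg_nonneg)
      show "(\<Sum>t\<in>F. a t * g t)\<^sup>2 \<le> (KW + KB) * quad_form F (\<lambda>s t. min s t + RB s t) a" for a
      proof -
        have "(\<Sum>t\<in>F. a t * g t) = (\<Sum>t\<in>F. a t * gW t) + (\<Sum>t\<in>F. a t * gB t)"
          using g F by (subst sum.distrib[symmetric], intro sum.cong) (auto simp: distrib_left)
        moreover have "(\<Sum>t\<in>F. a t * gW t)\<^sup>2 \<le> KW * quad_form F min a"
          unfolding KW_def quad_form_def using wiener_shift_bound[OF LW gW F] .
        moreover have "(\<Sum>t\<in>F. a t * gB t)\<^sup>2 \<le> KB * quad_form F RB a"
          unfolding KB_def quad_form_def RB_def using fbm_shift_bound(2)[OF H T LB gB F] .
        ultimately show ?thesis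
          unfolding q by (simp only:) (intro square_sum_bound K0 qW qB)
      qed
    qed (use F K0 in \<open>auto intro: prob_space_axioms\<close>)
    then show ?thesis by simp
  qed
  \<comment> \<open>The trend is moved into the bounds, so that they constrain the continuous path
    \<open>B + W\<close> alone.\<close>
  obtain D1 where D1: "countable D1" "D1 \<subseteq> {0..T}"
    "\<And>x. continuous_on {0..T} x \<Longrightarrow> \<forall>t\<in>D1. - (\<epsilon> * f t) - g t \<le> x t \<and> x t \<le> \<epsilon> * f t - g t \<Longrightarrow>
      \<forall>t\<in>{0..T}. - (\<epsilon> * f t) - g t \<le> x t \<and> x t \<le> \<epsilon> * f t - g t"
    using countable_constraints[of "{0..T}" "\<lambda>t. - (\<epsilon> * f t) - g t" "\<lambda>t. \<epsilon> * f t - g t"] by blast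
  obtain D2 where D2: "countable D2" "D2 \<subseteq> {0..T}"
    "\<And>x. continuous_on {0..T} x \<Longrightarrow> \<forall>t\<in>D2. - (\<epsilon> * f t) \<le> x t \<and> x t \<le> \<epsilon> * f t \<Longrightarrow>
      \<forall>t\<in>{0..T}. - (\<epsilon> * f t) \<le> x t \<and> x t \<le> \<epsilon> * f t"
    using countable_constraints[of "{0..T}" "\<lambda>t. - (\<epsilon> * f t)" "\<lambda>t. \<epsilon> * f t"] by blast
  \<comment> \<open>One countable set must decide both events, since the finite-dimensional
    inequality compares them at the same times.\<close>
  define D where "D = D1 \<union> D2"
  have D: "countable D" "D \<subseteq> {0..T}" using D1 D2 by (auto simp: D_def)
  have eg: "\<bar>x + y\<bar> \<le> c \<longleftrightarrow> - c - y \<le> x \<and> x \<le> c - y" for x y c :: real by linarith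
  have e0: "\<bar>x + 0\<bar> \<le> c \<longleftrightarrow> - c \<le> x \<and> x \<le> c" for x c :: real by linarith
  have 1: "measure (completion M) (small_ball_event M B W f T g \<epsilon>) =
    measure M {\<omega> \<in> space M. \<forall>t\<in>D. \<bar>B t \<omega> + W t \<omega> + g t\<bar> \<le> \<epsilon> * f t}"
  proof (rule measure_completion_small_ball[OF assms(1) D Bm Wm cont])
    fix x assume "continuous_on {0..T} x" "\<forall>t\<in>D. \<bar>x t + g t\<bar> \<le> \<epsilon> * f t"
    then show "\<forall>t\<in>{0..T}. \<bar>x t + g t\<bar> \<le> \<epsilon> * f t"
      unfolding eg by (intro D1(3)) (auto simp: D_def)
  qed
  have 2: "measure (completion M) (small_ball_event M B W f T (\<lambda>_. 0) \<epsilon>) =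
    measure M {\<omega> \<in> space M. \<forall>t\<in>D. \<bar>B t \<omega> + W t \<omega> + 0\<bar> \<le> \<epsilon> * f t}"
  proof (rule measure_completion_small_ball[OF assms(1) D Bm Wm cont])
    fix x assume "continuous_on {0..T} x" "\<forall>t\<in>D. \<bar>x t + 0\<bar> \<le> \<epsilon> * f t"
    then show "\<forall>t\<in>{0..T}. \<bar>x t + 0\<bar> \<le> \<epsilon> * f t"
      unfolding e0 by (intro D2(3)) (auto simp: D_def)
  qed
  have meas: "{\<omega> \<in> space M. \<bar>B t \<omega> + W t \<omega> + y\<bar> \<le> \<epsilon> * f t} \<in> sets M" if "t \<in> D" for t y
  proof -
    have [measurable]: "B t \<in> borel_measurable M" "W t \<in> borel_measurable M" using Bm Wm that D by auto
    show ?thesis by measurable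
  qed
  have e: "- (1/2) * (KW + KB) = - (KW + KB) / 2" by (simp add: field_simps)
  have "exp (- (KW + KB) / 2) * measure M {\<omega> \<in> space M. \<forall>t\<in>D. \<bar>B t \<omega> + W t \<omega> + 0\<bar> \<le> \<epsilon> * f t} \<le>
      measure M {\<omega> \<in> space M. \<forall>t\<in>D. \<bar>B t \<omega> + W t \<omega> + g t\<bar> \<le> \<epsilon> * f t}"
    using D(2) by (intro measure_mono_countable_limit[OF D(1) finite_measure_axioms meas meas] fin) auto
  then show ?thesis unfolding 1 2 K e .
qed

end
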